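(* Let $G=W(H_3)$ and $\mu=1$. (2) For every $\tau\in\mathbb C$, $B_G(\Upsilon)$ has dimension $1045$ and the set $\Lambda=\{T_w\}_{w\in G}\ \sqcup\ \{w^s_j e_s\}_{s\in R,\,1\le j\le60}\ \sqcup\ \{w^\alpha_\beta e_{i_\alpha}e_{j_\alpha}\}_{1\le\alpha,\beta\le5}$ is a basis. (1) There is a nonzero polynomial $f\in\mathbb C[\tau]$ (divisible by $(\tau-1)^4(\tau+4)$) such that $B_G(\Upsilon)$ is semisimple whenever $f(\tau)\neq0$.
   Context: $W(H_3)$ is the Coxeter group generated by $s_0,s_1,s_2$ with $s_i^2=1$, $(s_0s_1)^5=1$, $(s_0s_2)^2=1$, $(s_1s_2)^3=1$, realized as a real reflection group on $\mathbb C^3$; order 120, 15 reflections $R$, all conjugate. Commuting is an equivalence relation on $R$ with 5 classes $R_1,\dots,R_5$ of 3 pairwise commuting reflections; write $R_\alpha=\{i_\alpha,j_\alpha,k_\alpha\}$ (reflections). For each $s\in R$, $\{w^s_j\}_{1\le j\le60}$ is a set of representatives of the left cosets of $\{1,s\}$ in $G$; for each $\alpha$, $\{w^\alpha_\beta\}_{1\le\beta\le5}$ is a set of representatives of the left cosets of the stabilizer $G_\alpha=\{w: wR_\alpha w^{-1}=R_\alpha\}$ (of order 24). $e_s$ is the generator for the hyperplane of $s$; $T_w$ written $w$. Parameters: single $\mu=1$, single $\tau$. $B_G(\Upsilon)$ is the unital $\mathbb C$-algebra generated by $T_w$ ($T_1=1$) and $e_s$ with relations: $T_{w_1}T_{w_2}=T_{w_1w_2}$;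 $se_s=e_ss=e_s$; $T_we_s=e_sT_w=e_s$ if $w$ stabilizes $H_s$ and $H_s\cap V_w$ ($V_w$ the fixed space) is a noncrossing codimension-2 edge; $e_s^2=\tau e_s$; $we_s=e_{wsw^{-1}}w$; $e_se_{s'}=e_{s'}e_s$ if $H_s\pitchfork H_{s'}$; for $s\ne s'$ with $H_s\cap H_{s'}$ noncrossing, $e_se_{s'}=(\sum_{r\in R(s,s')}r)e_{s'}=e_s(\sum_{r\in R(s,s')}r)$, $R(s,s')=\{r: rs'r=s\}$, product $0$ if $R(s,s')=\emptyset$. $H_s\pitchfork H_{s'}$ means the only reflecting hyperplanes containing $H_s\cap H_{s'}$ are $H_s,H_{s'}$; a codimension-2 edge is crossing iff it is such an intersection. *)

theory Defs
  imports "HOL-Analysis.Analysis" "HOL-Computational_Algebra.Polynomial"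
begin

type_synonym mat3 = "complex^3^3"
type_synonym vec3 = "complex^3"

text \<open>Gram matrix of the Coxeter system: simple roots a1,a2,a3 (standing for s_0,s_1,s_2)
  with B(a_i,a_j) = -cos(pi/m_ij), m_01 = 5, m_02 = 2, m_12 = 3.\<close>
definition h3_gram :: "3 \<Rightarrow> 3 \<Rightarrow> real" where
  "h3_gram i j =
     (if i = j then 1
      else if {i, j} = {1, 2} then - cos (pi / 5)
      else if {i, j} = {2, 3} then - 1 / 2
      else 0)"

text \<open>Simple reflection s_i : e_l \<mapsto> e_l - 2 B(i,l) e_i (matrix w.r.t. the basis of simple roots).\<close>
definition sref :: "3 \<Rightarrow> mat3" where
  "sref i = (\<chi> k l. (if k = l then 1 else 0) - (if k = i then 2 * complex_of_real (h3_gram i l) else 0))"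

inductive_set H3G :: "mat3 set" where
  one: "mat 1 \<in> H3G"
| step: "w \<in> H3G \<Longrightarrow> w ** sref i \<in> H3G"

definition conj :: "mat3 \<Rightarrow> mat3 \<Rightarrow> mat3" where
  "conj w s = w ** s ** matrix_inv w"

definition H3R :: "mat3 set" where
  "H3R = {conj w (sref i) | w i. w \<in> H3G}"

definition fixsp :: "mat3 \<Rightarrow> vec3 set" where
  "fixsp w = {x. w *v x = x}"

abbreviation hyp :: "mat3 \<Rightarrow> vec3 set" where
  "hyp s \<equiv> fixsp s"

definition codim2_edge :: "vec3 set \<Rightarrow> bool" where
  "codim2_edge E \<longleftrightarrow> (\<exists>a\<in>H3R. \<exists>b\<in>H3R. hyp a \<noteq> hyp b \<and> E = hyp a \<inter> hyp b)"

definition transverse :: "mat3 \<Rightarrow> mat3 \<Rightarrow> bool" where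
  "transverse s s' \<longleftrightarrow>
     (\<forall>c\<in>H3R. hyp s \<inter> hyp s' \<subseteq> hyp c \<longrightarrow> hyp c = hyp s \<or> hyp c = hyp s')"

definition crossing_edge :: "vec3 set \<Rightarrow> bool" where
  "crossing_edge E \<longleftrightarrow> codim2_edge E \<and>
     (\<exists>s\<in>H3R. \<exists>s'\<in>H3R. transverse s s' \<and> E = hyp s \<inter> hyp s')"

definition noncrossing_edge :: "vec3 set \<Rightarrow> bool" where
  "noncrossing_edge E \<longleftrightarrow> codim2_edge E \<and> \<not> crossing_edge E"

definition Rss :: "mat3 \<Rightarrow> mat3 \<Rightarrow> mat3 set" where
  "Rss s s' = {r \<in> H3R. r ** s' ** r = s}"

definition commclass :: "mat3 \<Rightarrow> mat3 set" where
  "commclass s = {r \<in> H3R. r ** s = s ** r}"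

definition stab :: "mat3 set \<Rightarrow> mat3 set" where
  "stab A = {g \<in> H3G. (\<lambda>r. conj g r) ` A = A}"

datatype gen = GT mat3 | GE mat3

type_synonym fa = "gen list \<Rightarrow> complex"

definition Gens :: "gen set" where
  "Gens = GT ` H3G \<union> GE ` H3R"

definition FA :: "fa set" where
  "FA = {p. finite {w. p w \<noteq> 0} \<and> (\<forall>w. p w \<noteq> 0 \<longrightarrow> set w \<subseteq> Gens)}"

definition fa_zero :: fa where "fa_zero = (\<lambda>_. 0)"
definition fa_add :: "fa \<Rightarrow> fa \<Rightarrow> fa" where "fa_add p q = (\<lambda>w. p w + q w)"
definition fa_sub :: "fa \<Rightarrow> fa \<Rightarrow> fa" where "fa_sub p q = (\<lambda>w. p w - q w)"
definition fa_smult :: "complex \<Rightarrow> fa \<Rightarrow> fa" where "fa_smult c p = (\<lambda>w. c * p w)"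
definition fa_mult :: "fa \<Rightarrow> fa \<Rightarrow> fa" where
  "fa_mult p q = (\<lambda>w. \<Sum>i\<le>length w. p (take i w) * q (drop i w))"
definition fa_word :: "gen list \<Rightarrow> fa" where
  "fa_word u = (\<lambda>w. if w = u then 1 else 0)"
definition fa_one :: fa where "fa_one = fa_word []"
definition fa_setsum :: "('i \<Rightarrow> fa) \<Rightarrow> 'i set \<Rightarrow> fa" where
  "fa_setsum f A = (\<lambda>w. \<Sum>a\<in>A. f a w)"

abbreviation Tw :: "mat3 \<Rightarrow> fa" where "Tw w \<equiv> fa_word [GT w]"
abbreviation Es :: "mat3 \<Rightarrow> fa" where "Es s \<equiv> fa_word [GE s]"

text \<open>Defining relations of B_G(Upsilon) for mu = 1 and parameter tau, as elements lhs - rhs.\<close>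
definition rels :: "complex \<Rightarrow> fa set" where
  "rels \<tau> =
     {fa_sub (fa_mult (Tw w1) (Tw w2)) (Tw (w1 ** w2)) | w1 w2. w1 \<in> H3G \<and> w2 \<in> H3G}
   \<union> {fa_sub (Tw (mat 1)) fa_one}
   \<union> {fa_sub (fa_mult (Tw s) (Es s)) (Es s) | s. s \<in> H3R}
   \<union> {fa_sub (fa_mult (Es s) (Tw s)) (Es s) | s. s \<in> H3R}
   \<union> {fa_sub (fa_mult (Tw w) (Es s)) (Es s) | w s. w \<in> H3G \<and> s \<in> H3R \<and>
        (\<lambda>x. w *v x) ` hyp s = hyp s \<and> noncrossing_edge (hyp s \<inter> fixsp w)}
   \<union> {fa_sub (fa_mult (Es s) (Tw w)) (Es s) | w s. w \<in> H3G \<and> s \<in> H3R \<and>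
        (\<lambda>x. w *v x) ` hyp s = hyp s \<and> noncrossing_edge (hyp s \<inter> fixsp w)}
   \<union> {fa_sub (fa_mult (Es s) (Es s)) (fa_smult \<tau> (Es s)) | s. s \<in> H3R}
   \<union> {fa_sub (fa_mult (Tw w) (Es s)) (fa_mult (Es (conj w s)) (Tw w)) | w s. w \<in> H3G \<and> s \<in> H3R}
   \<union> {fa_sub (fa_mult (Es s) (Es s')) (fa_mult (Es s') (Es s)) | s s'.
        s \<in> H3R \<and> s' \<in> H3R \<and> transverse s s'}
   \<union> {fa_sub (fa_mult (Es s) (Es s')) (fa_mult (fa_setsum Tw (Rss s s')) (Es s')) | s s'.
        s \<in> H3R \<and> s' \<in> H3R \<and> s \<noteq> s' \<and> noncrossing_edge (hyp s \<inter> hyp s')}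
   \<union> {fa_sub (fa_mult (Es s) (Es s')) (fa_mult (Es s) (fa_setsum Tw (Rss s s'))) | s s'.
        s \<in> H3R \<and> s' \<in> H3R \<and> s \<noteq> s' \<and> noncrossing_edge (hyp s \<inter> hyp s')}"

inductive_set ideal_gen :: "fa set \<Rightarrow> fa set" for S :: "fa set" where
  base: "p \<in> S \<Longrightarrow> p \<in> ideal_gen S"
| zero: "fa_zero \<in> ideal_gen S"
| add: "p \<in> ideal_gen S \<Longrightarrow> q \<in> ideal_gen S \<Longrightarrow> fa_add p q \<in> ideal_gen S"
| smult: "p \<in> ideal_gen S \<Longrightarrow> fa_smult c p \<in> ideal_gen S"
| lmult: "p \<in> ideal_gen S \<Longrightarrow> a \<in> FA \<Longrightarrow> fa_mult a p \<in> ideal_gen S"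
| rmult: "p \<in> ideal_gen S \<Longrightarrow> a \<in> FA \<Longrightarrow> fa_mult p a \<in> ideal_gen S"

text \<open>B_G(Upsilon) = FA / BI tau.\<close>
definition BI :: "complex \<Rightarrow> fa set" where
  "BI \<tau> = ideal_gen (rels \<tau>)"

definition basis_mod :: "fa set \<Rightarrow> ('i \<Rightarrow> fa) \<Rightarrow> 'i set \<Rightarrow> bool" where
  "basis_mod I b A \<longleftrightarrow> finite A \<and> (\<forall>i\<in>A. b i \<in> FA)
     \<and> (\<forall>c. fa_setsum (\<lambda>i. fa_smult (c i) (b i)) A \<in> I \<longrightarrow> (\<forall>i\<in>A. c i = 0))
     \<and> (\<forall>p\<in>FA. \<exists>c. fa_sub p (fa_setsum (\<lambda>i. fa_smult (c i) (b i)) A) \<in> I)"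

definition has_dim_mod :: "fa set \<Rightarrow> nat \<Rightarrow> bool" where
  "has_dim_mod I n \<longleftrightarrow> (\<exists>b :: nat \<Rightarrow> fa. basis_mod I b {..<n})"

definition left_ideal :: "fa set \<Rightarrow> bool" where
  "left_ideal L \<longleftrightarrow> L \<subseteq> FA \<and> fa_zero \<in> L \<and> (\<forall>p\<in>L. \<forall>q\<in>L. fa_add p q \<in> L)
     \<and> (\<forall>c. \<forall>p\<in>L. fa_smult c p \<in> L) \<and> (\<forall>a\<in>FA. \<forall>p\<in>L. fa_mult a p \<in> L)"

text \<open>FA / I is semisimple: every left ideal of FA/I (= L/I with I \<subseteq> L a left ideal of FA)
  is a direct summand of the left regular module.\<close>
definition semisimple_mod :: "fa set \<Rightarrow> bool" where
  "semisimple_mod I \<longleftrightarrow> (\<forall>L. left_ideal L \<and> I \<subseteq> L \<longrightarrow>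
     (\<exists>L'. left_ideal L' \<and> I \<subseteq> L' \<and> L \<inter> L' = I \<and>
        (\<forall>p\<in>FA. \<exists>a\<in>L. \<exists>b\<in>L'. p = fa_add a b)))"

datatype lam_idx = LT mat3 | LE mat3 nat | LP nat nat

definition LamIdx :: "lam_idx set" where
  "LamIdx = LT ` H3G \<union> {LE s j | s j. s \<in> H3R \<and> j \<in> {1..60}}
            \<union> {LP \<alpha> \<beta> | \<alpha> \<beta>. \<alpha> \<in> {1..5} \<and> \<beta> \<in> {1..5}}"

fun Lam :: "(mat3 \<Rightarrow> nat \<Rightarrow> mat3) \<Rightarrow> (nat \<Rightarrow> mat3) \<Rightarrow> (nat \<Rightarrow> mat3)
            \<Rightarrow> (nat \<Rightarrow> nat \<Rightarrow> mat3) \<Rightarrow> lam_idx \<Rightarrow> fa" where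
  "Lam ws ia ja wa (LT w) = Tw w"
| "Lam ws ia ja wa (LE s j) = fa_word [GT (ws s j), GE s]"
| "Lam ws ia ja wa (LP \<alpha> \<beta>) = fa_word [GT (wa \<alpha> \<beta>), GE (ia \<alpha>), GE (ja \<alpha>)]"

end

(* The relations are monomial: up to a power of tau, every generator sends an element w, w e_s or
   w e_i e_j (s, i, j reflections, i and j commuting) to another such element. The 1045 classes of
   these elements therefore carry an explicit module, and the relations become statements about the
   reflections of H3: commuting is an equivalence relation with classes {i, j, k} whose roots form an
   orthonormal basis, non-commuting s, t are exchanged by exactly one reflection, and the centralizer of
   a reflection is generated by its class. Conversely every word reduces to such an element,
   because evaluating e_s e_i e_j = e_s e_j e_i in two ways forces the stabilizer of the class {i, j, k}
   to act trivially on e_i e_j. Hence the algebra is this module, for every tau.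

   For semisimplicity, a linear projection p onto a submodule is averaged over the group and then
   replaced by F B / tau on the ideal generated by the e_s, where F is the sum of the e_s p e_s, E is the sum
   of the e_s and B inverts E on that ideal; a preliminary step does the same with the products e_i e_j.
   On e_t, E acts as tau plus a group ring element not involving tau, up to a multiple of e_i e_j, and
   on e_i e_j as 3 tau plus such an element. A polynomial annihilating these group ring
   elements therefore shows that B exists for all but finitely many tau. *)

theory Submission
  imports Defs
begin

section \<open>Roots and reflections\<close>

text \<open>Averaging over the group makes a projection commute with the \<open>T_w\<close> only;
  there is no group of \<open>e_s\<close> to average over. Its substitute is the exchange rule
  \<open>e_s e_t p e_t = e_s p e_s e_t\<close>. For non-commuting s, t it follows from
  \<open>e_s e_t = r e_t = e_s r\<close> as soon as p commutes with r. For distinct commuting s, t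
  both sides reduce to \<tau> times \<open>e_s e_t p\<close> only if p commutes with
  \<open>e_s e_t\<close>. This forces the order of the corrections: products over a class come
  before single generators. The products obey the exchange rule already for a group-averaged p, with
  the square of \<tau> in the role of \<tau>. Inverting the sum of the \<open>e_s\<close> meets the
  same hierarchy: its action is triangular with respect to the ideal of class products, so an
  annihilating polynomial has to be used twice, once shifted by \<tau> and once by 3 \<tau>. All
  geometry is reduced to inner products of roots. The group is transitive on roots, so these need
  only be computed against one simple root, exactly, over the integers extended by the golden
  ratio.\<close>

definition golden :: real where "golden = 2 * cos (pi / 5)"

lemma golden_square: "golden * golden = golden + 1"
proof -
  define c where "c = cos (pi / 5 :: real)"
  have c: "c > 0" unfolding c_def by (rule cos_gt_zero) (auto simp: field_simps)
  \<comment> \<open>The angles 3 pi/5 and 2 pi/5 are supplementary, so the multiple angle formulas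
    give a cubic in \<open>c\<close>; its root -1 is excluded by \<open>c > 0\<close>.\<close>
  have "cos (3 * (pi / 5)) = - cos (2 * (pi / 5))"
    using cos_pi_minus[of "2 * (pi / 5)"] by (simp add: field_simps)
  then have "4 * c ^ 3 - 3 * c = - (2 * c ^ 2 - 1)"
    unfolding c_def using cos_treble_cos[of "pi / 5"] cos_double_cos[of "pi / 5"] by simp
  then have "(c + 1) * (4 * c ^ 2 - 2 * c - 1) = 0"
    by (simp add: algebra_simps power2_eq_square power3_eq_cube)
  with c have "4 * c ^ 2 = 2 * c + 1" by auto
  then show ?thesis by (simp add: golden_def c_def power2_eq_square)
qed

text \<open>Quotients of Fibonacci numbers; the square relation turns each bound into a rational
  inequality. They are sharp enough to separate the finitely many values of inner products, and of
  their squares, that are compared below.\<close>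

lemma golden_bounds: "8/5 < golden" "golden < 13/8"
proof -
  have p: "golden > 0" unfolding golden_def by (simp, rule cos_gt_zero) (auto simp: field_simps)
  show "8/5 < golden"
  proof (rule ccontr)
    assume "\<not> ?thesis"
    then have "0 \<le> (8/5 - golden) * (golden + 3/5)" using p by simp
    with golden_square show False by (simp add: algebra_simps)
  qed
  show "golden < 13/8"
  proof (rule ccontr)
    assume "\<not> ?thesis"
    then have "13/8 * (5/8) \<le> golden * (golden - 1)" by (intro mult_mono) auto
    with golden_square show False by (simp add: algebra_simps)
  qed
qed

section \<open>The invariant bilinear form in simple root coordinates\<close>

abbreviation cgolden :: complex ("\<phi>") where "\<phi> \<equiv> complex_of_real golden"

lemma cgolden_square: "\<phi> * \<phi> = \<phi> + 1"
  by (metis golden_square of_real_1 of_real_add of_real_mult)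

lemma cgolden_square_assoc: "\<phi> * (\<phi> * x) = (\<phi> + 1) * x"
  by (metis cgolden_square mult.assoc)

text \<open>Twice the Gram form, so that roots have norm 2, reflections need no division, and all
  coefficients lie in Z[\<phi>]. It is bilinear, not Hermitian, as the complexification of a real
  form has to be here.\<close>

definition bf :: "vec3 \<Rightarrow> vec3 \<Rightarrow> complex" where
  "bf x y = 2 * (x$1 * y$1 + x$2 * y$2 + x$3 * y$3)
     - \<phi> * (x$1 * y$2 + x$2 * y$1) - (x$2 * y$3 + x$3 * y$2)"

lemma bf_sym: "bf x y = bf y x" by (simp add: bf_def algebra_simps)
lemma bf_add: "bf x (y + z) = bf x y + bf x z" by (simp add: bf_def algebra_simps)
lemma bf_diff: "bf x (y - z) = bf x y - bf x z" by (simp add: bf_def algebra_simps)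
lemma bf_smult: "bf x (c *s y) = c * bf x y" by (simp add: bf_def algebra_simps)
lemma bf_minus: "bf x (- y) = - bf x y" by (simp add: bf_def algebra_simps)
lemma bf_add': "bf (y + z) x = bf y x + bf z x" by (simp add: bf_def algebra_simps)
lemma bf_diff': "bf (y - z) x = bf y x - bf z x" by (simp add: bf_def algebra_simps)
lemma bf_smult': "bf (c *s y) x = c * bf y x" by (simp add: bf_def algebra_simps)
lemma bf_minus': "bf (- y) x = - bf y x" by (simp add: bf_def algebra_simps)
lemmas bf_lin = bf_add bf_diff bf_smult bf_minus bf_add' bf_diff' bf_smult' bf_minus'

definition reflection :: "vec3 \<Rightarrow> mat3" where
  "reflection a = (\<chi> k l. (if k = l then 1 else 0) - a$k * bf a (axis l 1))"

lemma refl_apply: "reflection a *v y = y - bf a y *s a"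
  by (simp add: vec_eq_iff reflection_def matrix_vector_mult_def sum_3 bf_def axis_def forall_3 algebra_simps)

lemma sref_eq_refl: "sref i = reflection (axis i 1)"
proof -
  have "2 * complex_of_real (h3_gram i l) = bf (axis i 1) (axis l 1)" for l
  proof -
    have "\<forall>i l. 2 * complex_of_real (h3_gram i l) = bf (axis i 1) (axis l 1)"
      by (simp add: forall_3 h3_gram_def bf_def axis_def golden_def doubleton_eq_iff)
    then show ?thesis by blast
  qed
  then show ?thesis
    by (simp add: sref_def reflection_def vec_eq_iff axis_def)
qed

lemma bf_refl_invariant:
  assumes "bf a a = 2" shows "bf (reflection a *v x) (reflection a *v y) = bf x y"
  using assms by (simp add: refl_apply bf_lin bf_sym[of x a] algebra_simps)

lemma refl_involution:
  assumes "bf a a = 2" shows "reflection a ** reflection a = mat 1"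
proof -
  have "(reflection a ** reflection a) *v x = mat 1 *v x" for x
    unfolding matrix_vector_mul_assoc[symmetric]
    using assms by (simp add: refl_apply bf_lin vec_eq_iff algebra_simps)
  then show ?thesis by (simp add: matrix_eq)
qed

lemma refl_self: assumes "bf a a = 2" shows "reflection a *v a = - a"
  using assms by (simp add: refl_apply vec_eq_iff)

lemma refl_uminus: "reflection (- a) = reflection a"
  by (simp add: reflection_def bf_lin vec_eq_iff)

lemma bf_simple: "bf (axis i 1) (axis i 1) = 2"
proof -
  have "\<forall>i. bf (axis i 1) (axis i 1) = 2" by (simp add: forall_3 bf_def axis_def)
  then show ?thesis by blast
qed

lemma H3G_mult:
  assumes "a \<in> H3G" "b \<in> H3G" shows "a ** b \<in> H3G"
  using assms(2)
proof (induction b rule: H3G.induct)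
  case (step w i) then show ?case by (simp add: matrix_mul_assoc H3G.step)
qed (simp add: assms(1))

lemma sref_in_H3G: "sref i \<in> H3G" using H3G.step[OF H3G.one, of i] by simp

lemma H3G_right_inverse: "w \<in> H3G \<Longrightarrow> \<exists>v\<in>H3G. w ** v = mat 1 \<and> v ** w = mat 1"
proof (induction w rule: H3G.induct)
  case one then show ?case by (intro bexI[of _ "mat 1"]) (auto simp: H3G.one)
next
  case (step w i)
  then obtain v where v: "v \<in> H3G" "w ** v = mat 1" "v ** w = mat 1" by blast
  have s: "sref i ** sref i = mat 1" by (simp add: sref_eq_refl refl_involution bf_simple)
  have "(w ** sref i) ** (sref i ** v) = mat 1" "(sref i ** v) ** (w ** sref i) = mat 1"
    by (metis matrix_mul_assoc matrix_mul_rid s v)+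
  then show ?case using v sref_in_H3G H3G_mult by blast
qed

lemma matrix_inv_unique:
  fixes A B :: "complex^'n^'n"
  assumes "A ** B = mat 1" "B ** A = mat 1" shows "matrix_inv A = B"
proof -
  have "matrix_inv A ** A = mat 1"
    unfolding matrix_inv_def by (rule someI2[of _ B]) (use assms in auto)
  then show ?thesis by (metis assms(1) matrix_mul_assoc matrix_mul_lid matrix_mul_rid)
qed

lemma H3G_inv:
  assumes "w \<in> H3G"
  shows "matrix_inv w \<in> H3G" "w ** matrix_inv w = mat 1" "matrix_inv w ** w = mat 1"
  using H3G_right_inverse[OF assms] matrix_inv_unique by auto

lemma bf_H3G_invariant: "w \<in> H3G \<Longrightarrow> bf (w *v x) (w *v y) = bf x y"
proof (induction w arbitrary: x y rule: H3G.induct)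
  case (step w i)
  then show ?case
    by (simp add: matrix_vector_mul_assoc[symmetric] sref_eq_refl bf_refl_invariant bf_simple)
qed simp

lemma H3G_cancel:
  assumes "w \<in> H3G"
  shows "w ** (matrix_inv w ** x) = x" "matrix_inv w ** (w ** x) = x"
    "w *v (matrix_inv w *v y) = y" "matrix_inv w *v (w *v y) = y"
  using H3G_inv[OF assms] by (simp_all add: matrix_mul_assoc matrix_vector_mul_assoc)

text \<open>Invariance of \<open>bf\<close> moves \<open>w\<close> from the root to the argument.
  Conjugation of reflections thereby becomes the linear action on roots.\<close>

lemma conj_refl:
  assumes "w \<in> H3G" shows "conj w (reflection a) = reflection (w *v a)"
proof -
  have "conj w (reflection a) *v x = reflection (w *v a) *v x" for x
  proof -
    have "bf (w *v a) x = bf a (matrix_inv w *v x)"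
      using bf_H3G_invariant[OF assms, of a "matrix_inv w *v x"] H3G_cancel[OF assms] by simp
    then show ?thesis
      using H3G_cancel(3)[OF assms, of x]
      by (simp add: conj_def matrix_vector_mul_assoc[symmetric] refl_apply matrix_vector_mult_diff_distrib
          vector_scalar_commute)
  qed
  then show ?thesis by (simp add: matrix_eq)
qed

section \<open>The root system as a finite orbit\<close>

definition roots :: "vec3 set" where "roots = {w *v axis 1 1 | w. w \<in> H3G}"

text \<open>Coordinates in Z[\<phi>], a pair (a, b) standing for a + b \<phi>. The integer encoding
  makes the orbit of the first simple root computable; multiplication by \<phi> is the shift coming
  from the square relation.\<close>

type_synonym zvec = "(int \<times> int) \<times> (int \<times> int) \<times> (int \<times> int)"

fun zphi :: "int \<times> int \<Rightarrow> int \<times> int" where "zphi (a, b) = (b, a + b)"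
fun zadd :: "int \<times> int \<Rightarrow> int \<times> int \<Rightarrow> int \<times> int" where "zadd (a, b) (c, d) = (a + c, b + d)"
fun zneg :: "int \<times> int \<Rightarrow> int \<times> int" where "zneg (a, b) = (- a, - b)"
fun zval :: "int \<times> int \<Rightarrow> complex" where "zval (a, b) = of_int a + of_int b * \<phi>"

fun zr1 :: "zvec \<Rightarrow> zvec" where "zr1 (x, y, z) = (zadd (zphi y) (zneg x), y, z)"
fun zr2 :: "zvec \<Rightarrow> zvec" where "zr2 (x, y, z) = (x, zadd (zadd (zphi x) z) (zneg y), z)"
fun zr3 :: "zvec \<Rightarrow> zvec" where "zr3 (x, y, z) = (x, y, zadd y (zneg z))"
fun zbf1 :: "zvec \<Rightarrow> int \<times> int" where "zbf1 (x, y, z) = zadd (zadd x x) (zneg (zphi y))"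
fun zminus :: "zvec \<Rightarrow> zvec" where "zminus (x, y, z) = (zneg x, zneg y, zneg z)"
fun zemb :: "zvec \<Rightarrow> vec3" where "zemb (x, y, z) = vector [zval x, zval y, zval z]"

text \<open>The fifteen positive roots of H3 in simple root coordinates. Together with their
  negatives they are closed under the simple reflections, which bounds the orbit from above.\<close>

definition zpos :: "zvec list" where
  "zpos = [((1,0),(0,0),(0,0)), ((1,0),(0,1),(0,0)), ((0,1),(0,1),(0,0)), ((1,0),(0,1),(0,1)),
    ((0,1),(1,0),(0,0)), ((0,1),(0,1),(0,1)), ((0,0),(1,0),(0,0)), ((0,1),(1,0),(1,0)),
    ((0,1),(1,1),(0,1)), ((0,0),(1,0),(1,0)), ((0,1),(1,1),(1,0)), ((1,1),(1,1),(0,1)),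
    ((0,0),(0,0),(1,0)), ((1,1),(1,1),(1,0)), ((1,1),(0,2),(0,1))]"

definition zroots :: "zvec list" where "zroots = zpos @ map zminus zpos"

lemma zroots_closed: "\<forall>x\<in>set zroots. zr1 x \<in> set zroots \<and> zr2 x \<in> set zroots \<and> zr3 x \<in> set zroots"
  unfolding zroots_def zpos_def by code_simp

lemma zval_simps: "zval (zphi x) = \<phi> * zval x" "zval (zadd x y) = zval x + zval y" "zval (zneg x) = - zval x"
  by (cases x; cases y; simp add: algebra_simps cgolden_square)+

lemma zemb_refl:
  "zemb (zr1 x) = reflection (axis 1 1) *v zemb x"
  "zemb (zr2 x) = reflection (axis 2 1) *v zemb x"
  "zemb (zr3 x) = reflection (axis 3 1) *v zemb x"
  by (cases x; simp add: refl_apply vec_eq_iff forall_3 bf_def axis_def zval_simps)+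

lemma sref_zroots: "v \<in> zemb ` set zroots \<Longrightarrow> sref i *v v \<in> zemb ` set zroots"
proof -
  have "\<forall>i. \<forall>v \<in> zemb ` set zroots. sref i *v v \<in> zemb ` set zroots"
    unfolding forall_3 sref_eq_refl using zroots_closed by (auto simp: zemb_refl[symmetric])
  then show "v \<in> zemb ` set zroots \<Longrightarrow> sref i *v v \<in> zemb ` set zroots" by blast
qed

lemma H3G_zroots: "w \<in> H3G \<Longrightarrow> v \<in> zemb ` set zroots \<Longrightarrow> w *v v \<in> zemb ` set zroots"
  by (induction w arbitrary: v rule: H3G.induct)
    (simp_all add: matrix_vector_mul_assoc[symmetric] sref_zroots)

lemma axis1_zemb: "axis 1 1 = zemb ((1,0),(0,0),(0,0))"
  by (simp add: vec_eq_iff forall_3 axis_def)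

lemma roots_subset: "roots \<subseteq> zemb ` set zroots"
proof -
  have "axis 1 1 \<in> zemb ` set zroots" unfolding axis1_zemb by (rule imageI) (simp add: zroots_def zpos_def)
  then show ?thesis unfolding roots_def using H3G_zroots by blast
qed

lemma sref_roots: "v \<in> roots \<Longrightarrow> sref i *v v \<in> roots"
  unfolding roots_def using H3G_mult[OF sref_in_H3G] by (force simp: matrix_vector_mul_assoc)

lemma H3G_roots: "w \<in> H3G \<Longrightarrow> v \<in> roots \<Longrightarrow> w *v v \<in> roots"
  unfolding roots_def using H3G_mult by (force simp: matrix_vector_mul_assoc)

lemma zr_roots:
  assumes "zemb x \<in> roots"
  shows "zemb (zr1 x) \<in> roots" "zemb (zr2 x) \<in> roots" "zemb (zr3 x) \<in> roots"
  using sref_roots[OF assms] by (simp_all add: zemb_refl sref_eq_refl)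

lemma axis1_root: "axis 1 1 \<in> roots"
  unfolding roots_def using H3G.one by force

text \<open>Odd Coxeter exponents make the simple reflections conjugate: an alternating word of
  length 4 in the first two carries the first simple root to the second (exponent 5), and one of
  length 2 carries the second to the third (exponent 3).\<close>

lemma simple_roots: "axis i 1 \<in> roots"
proof -
  have 1: "zemb ((1,0),(0,0),(0,0)) \<in> roots" using axis1_root axis1_zemb by simp
  have 2: "zemb ((0,0),(1,0),(0,0)) \<in> roots"
    using zr_roots(1)[OF zr_roots(2)[OF zr_roots(1)[OF zr_roots(2)[OF 1]]]] by simp
  have 3: "zemb ((0,0),(0,0),(1,0)) \<in> roots"
    using zr_roots(2)[OF zr_roots(3)[OF 2]] by simp
  have "axis 2 1 = zemb ((0,0),(1,0),(0,0))" "axis 3 1 = zemb ((0,0),(0,0),(1,0))"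
    by (simp_all add: vec_eq_iff forall_3 axis_def)
  with 1 2 3 axis1_root have "\<forall>i. axis i 1 \<in> roots" by (simp add: forall_3)
  then show ?thesis by blast
qed

lemma H3R_eq: "H3R = reflection ` roots"
proof
  show "H3R \<subseteq> reflection ` roots"
    unfolding H3R_def by (auto simp: sref_eq_refl conj_refl intro!: imageI H3G_roots simple_roots)
  show "reflection ` roots \<subseteq> H3R"
    unfolding H3R_def roots_def by (force simp: sref_eq_refl conj_refl)
qed

lemma roots_cases:
  assumes "\<alpha> \<in> roots"
  obtains w where "w \<in> H3G" "\<alpha> = w *v axis 1 1"
  using assms unfolding roots_def by blast

lemma bf_root: "\<alpha> \<in> roots \<Longrightarrow> bf \<alpha> \<alpha> = 2"
  by (metis bf_H3G_invariant bf_simple roots_cases)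

lemma matrix_vector_uminus: "(A::complex^'n^'m) *v (- x) = - (A *v x)"
  by (simp add: matrix_vector_mult_def vec_eq_iff sum_negf)

section \<open>Inner products between roots\<close>

definition bfvals :: "real set" where
  "bfvals = {0, 1, -1, golden, - golden, golden - 1, 1 - golden, 2, -2}"

lemma zbf1_val: "bf (axis 1 1) (zemb x) = zval (zbf1 x)"
  by (cases x) (simp add: bf_def axis_def zval_simps)

text \<open>Only inner products with the first simple root are tabulated; transitivity transports
  them to every pair of roots. The extreme values single out the root and its negative, and 0
  singles out two lines.\<close>

lemma zbf1_cases:
  "\<forall>x\<in>set zroots. zbf1 x \<in> set [(0,0), (1,0), (-1,0), (0,1), (0,-1), (-1,1), (1,-1), (2,0), (-2,0)] \<and>
    (zbf1 x = (2,0) \<longrightarrow> x = ((1,0),(0,0),(0,0))) \<and>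
    (zbf1 x = (-2,0) \<longrightarrow> x = ((-1,0),(0,0),(0,0))) \<and>
    (zbf1 x = (0,0) \<longrightarrow> x \<in> set [((0,0),(0,0),(1,0)), ((0,0),(0,0),(-1,0)),
       ((1,1),(0,2),(0,1)), ((-1,-1),(0,-2),(0,-1))])"
  unfolding zroots_def zpos_def by code_simp

lemma bf_axis1:
  assumes "\<beta> \<in> roots"
  obtains r where "r \<in> bfvals" "bf (axis 1 1) \<beta> = of_real r"
    "r = 2 \<Longrightarrow> \<beta> = axis 1 1" "r = -2 \<Longrightarrow> \<beta> = - axis 1 1"
    "r = 0 \<Longrightarrow> \<beta> \<in> {axis 3 1, - axis 3 1, zemb ((1,1),(0,2),(0,1)), - zemb ((1,1),(0,2),(0,1))}"
proof -
  obtain x where x: "x \<in> set zroots" "\<beta> = zemb x" using assms roots_subset by blast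
  define p where "p = zbf1 x"
  define r where "r = of_int (fst p) + of_int (snd p) * golden"
  have bf: "bf (axis 1 1) \<beta> = of_real r"
    unfolding x zbf1_val r_def p_def[symmetric] by (cases p) simp
  note c = zbf1_cases[rule_format, OF x(1), folded p_def]
  have p: "p = (0,0) \<or> p = (1,0) \<or> p = (-1,0) \<or> p = (0,1) \<or> p = (0,-1) \<or> p = (-1,1) \<or> p = (1,-1)
      \<or> p = (2,0) \<or> p = (-2,0)"
    using conjunct1[OF c] by simp
  then have r: "r \<in> bfvals" unfolding bfvals_def r_def by (elim disjE) simp_all
  \<comment> \<open>The numerical bounds on \<open>golden\<close> rule out every other entry of the
    list; likewise for -2 and 0.\<close>
  have two: "p = (2,0)" if "r = 2"
    using p that golden_bounds unfolding r_def by (elim disjE) simp_all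
  have mtwo: "p = (-2,0)" if "r = -2"
    using p that golden_bounds unfolding r_def by (elim disjE) simp_all
  have zero: "p = (0,0)" if "r = 0"
    using p that golden_bounds unfolding r_def by (elim disjE) simp_all
  show ?thesis
  proof (rule that[OF r bf])
    assume "r = 2"
    with two c have "x = ((1,0),(0,0),(0,0))" by blast
    then show "\<beta> = axis 1 1" using x(2) axis1_zemb by simp
  next
    assume "r = -2"
    with mtwo c have "x = ((-1,0),(0,0),(0,0))" by blast
    then show "\<beta> = - axis 1 1" using x(2) axis1_zemb by (simp add: vec_eq_iff forall_3)
  next
    assume "r = 0"
    with zero c have "x \<in> set [((0,0),(0,0),(1,0)), ((0,0),(0,0),(-1,0)),
       ((1,1),(0,2),(0,1)), ((-1,-1),(0,-2),(0,-1))]" by blast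
    then have "x = ((0,0),(0,0),(1,0)) \<or> x = ((0,0),(0,0),(-1,0)) \<or>
       x = ((1,1),(0,2),(0,1)) \<or> x = ((-1,-1),(0,-2),(0,-1))" by simp
    then show "\<beta> \<in> {axis 3 1, - axis 3 1, zemb ((1,1),(0,2),(0,1)), - zemb ((1,1),(0,2),(0,1))}"
      using x(2) by (elim disjE) (simp_all add: vec_eq_iff forall_3 axis_def)
  qed
qed

lemma transport_root:
  assumes "w \<in> H3G" "\<beta> \<in> roots"
  obtains \<beta>' where "\<beta>' \<in> roots" "\<beta> = w *v \<beta>'"
  using assms H3G_roots H3G_inv H3G_cancel by metis

lemma bf_vals:
  assumes "\<alpha> \<in> roots" "\<beta> \<in> roots"
  obtains r where "r \<in> bfvals" "bf \<alpha> \<beta> = of_real r" "r = 2 \<Longrightarrow> \<beta> = \<alpha>" "r = -2 \<Longrightarrow> \<beta> = - \<alpha>"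
proof -
  obtain w where w: "w \<in> H3G" "\<alpha> = w *v axis 1 1" using assms(1) roots_cases by blast
  obtain \<beta>' where b: "\<beta>' \<in> roots" "\<beta> = w *v \<beta>'" using w assms(2) transport_root by blast
  show ?thesis using bf_axis1[OF b(1)] that bf_H3G_invariant[OF w(1)] w b
    by (metis matrix_vector_uminus)
qed

text \<open>The roots orthogonal to the first simple root lie on two perpendicular lines, spanned by
  \<open>axis 3 1\<close> and by the root with coordinates
  \<open>(1 + \<phi>, 2 \<phi>, \<phi>)\<close>. As all three roots have norm 2, the orthogonal
  expansion is that of 2 x.\<close>

lemma orthogonal_frame:
  assumes "\<alpha> \<in> roots"
  obtains \<beta> \<gamma> where "\<beta> \<in> roots" "\<gamma> \<in> roots" "bf \<alpha> \<beta> = 0" "bf \<alpha> \<gamma> = 0" "bf \<beta> \<gamma> = 0"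
    "\<And>\<delta>. \<delta> \<in> roots \<Longrightarrow> bf \<alpha> \<delta> = 0 \<Longrightarrow> \<delta> \<in> {\<beta>, - \<beta>, \<gamma>, - \<gamma>}"
    "\<And>x. 2 *s x = bf \<alpha> x *s \<alpha> + bf \<beta> x *s \<beta> + bf \<gamma> x *s \<gamma>"
proof -
  define \<rho> where "\<rho> = zemb ((1,1),(0,2),(0,1))"
  define e where "e = (axis 1 1 :: vec3)"
  define f where "f = (axis 3 1 :: vec3)"
  obtain w where w: "w \<in> H3G" "\<alpha> = w *v e" using assms roots_cases e_def by blast
  have 1: "zemb ((1,0),(0,0),(0,0)) \<in> roots" using axis1_root axis1_zemb by simp
  have \<rho>: "\<rho> \<in> roots"
    using zr_roots(2)[OF zr_roots(1)[OF zr_roots(2)[OF zr_roots(3)[OF zr_roots(1)[OF zr_roots(2)[OF 1]]]]]]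
    by (simp add: \<rho>_def)
  have bfs: "bf e f = 0" "bf e \<rho> = 0" "bf f \<rho> = 0"
    by (simp_all add: e_def f_def \<rho>_def bf_def axis_def algebra_simps cgolden_square
        cgolden_square_assoc)
  have exp: "2 *s x = bf e x *s e + bf f x *s f + bf \<rho> x *s \<rho>" for x
    by (simp add: e_def f_def \<rho>_def bf_def axis_def vec_eq_iff forall_3 algebra_simps cgolden_square
        cgolden_square_assoc)
  have cl: "\<delta> \<in> {w *v f, - (w *v f), w *v \<rho>, - (w *v \<rho>)}" if d0: "\<delta> \<in> roots" "bf \<alpha> \<delta> = 0" for \<delta>
  proof -
    obtain \<delta>' where d: "\<delta>' \<in> roots" "\<delta> = w *v \<delta>'" using transport_root[OF w(1) d0(1)] by blast
    have "bf e \<delta>' = 0" using d w that bf_H3G_invariant by metis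
    then have "\<delta>' \<in> {f, - f, \<rho>, - \<rho>}"
      using bf_axis1[OF d(1)] unfolding e_def f_def \<rho>_def by (metis of_real_eq_0_iff)
    then show ?thesis using d by (auto simp: matrix_vector_uminus)
  qed
  have exp': "2 *s x = bf \<alpha> x *s \<alpha> + bf (w *v f) x *s (w *v f) + bf (w *v \<rho>) x *s (w *v \<rho>)" for x
  proof -
    define y where "y = matrix_inv w *v x"
    have x: "x = w *v y" using H3G_cancel w y_def by simp
    have "2 *s x = w *v (2 *s y)" by (simp add: x vector_scalar_commute)
    also have "\<dots> = w *v (bf e y *s e + bf f y *s f + bf \<rho> y *s \<rho>)" using exp by simp
    finally show ?thesis
      by (simp add: x w bf_H3G_invariant matrix_vector_right_distrib vector_scalar_commute)
  qed
  show ?thesis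
    by (rule that[OF _ _ _ _ _ cl exp'])
      (use w bfs \<rho> simple_roots in \<open>auto simp: bf_H3G_invariant f_def intro!: H3G_roots\<close>)
qed

text \<open>A root at 60 degrees to the given one. It serves twice: to produce a non-commuting
  reflection, and to exclude swaps inside an orthogonal frame.\<close>

lemma root_bf_one:
  assumes "\<alpha> \<in> roots" obtains \<delta> where "\<delta> \<in> roots" "bf \<alpha> \<delta> = 1"
proof -
  obtain w where w: "w \<in> H3G" "\<alpha> = w *v axis 1 1" using assms roots_cases by blast
  have 1: "zemb ((1,0),(0,0),(0,0)) \<in> roots" using axis1_root axis1_zemb by simp
  have d: "zemb ((1,1),(1,1),(0,1)) \<in> roots"
    using zr_roots(1)[OF zr_roots(2)[OF zr_roots(3)[OF zr_roots(1)[OF zr_roots(2)[OF 1]]]]] by simp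
  have "bf (axis 1 1) (zemb ((1,1),(1,1),(0,1))) = 1" by (simp only: zbf1_val, simp)
  then show ?thesis using that[OF H3G_roots[OF w(1) d]] bf_H3G_invariant[OF w(1)] w(2) by simp
qed

text \<open>Applying both reflections to \<alpha> shows that the inner product has square 4; among
  root inner products this happens only at equal or opposite roots.\<close>

lemma refl_eq_iff:
  assumes "\<alpha> \<in> roots" "\<beta> \<in> roots" shows "reflection \<alpha> = reflection \<beta> \<longleftrightarrow> \<beta> = \<alpha> \<or> \<beta> = - \<alpha>"
proof
  assume "reflection \<alpha> = reflection \<beta>"
  then have "- \<alpha> = \<alpha> - bf \<beta> \<alpha> *s \<beta>"
    using refl_self[OF bf_root[OF assms(1)]] refl_apply[of \<beta> \<alpha>] by simp
  then have "bf \<alpha> (- \<alpha>) = bf \<alpha> (\<alpha> - bf \<beta> \<alpha> *s \<beta>)" by (rule arg_cong)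
  then have *: "bf \<alpha> \<beta> * bf \<alpha> \<beta> = 4" by (simp add: bf_lin bf_root assms bf_sym[of \<beta> \<alpha>] algebra_simps)
  obtain r where r: "bf \<alpha> \<beta> = of_real r" "r = 2 \<Longrightarrow> \<beta> = \<alpha>" "r = -2 \<Longrightarrow> \<beta> = - \<alpha>"
    using bf_vals[OF assms] by metis
  have "r * r = 4" using * unfolding r(1) of_real_mult[symmetric] by (metis of_real_eq_iff of_real_numeral)
  then have "(r - 2) * (r + 2) = 0" by (simp add: algebra_simps)
  then have "r = 2 \<or> r = -2" by auto
  then show "\<beta> = \<alpha> \<or> \<beta> = - \<alpha>" using r by blast
qed (auto simp: refl_uminus)

lemma refl_in_H3R: "\<alpha> \<in> roots \<Longrightarrow> reflection \<alpha> \<in> H3R" by (simp add: H3R_eq)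

lemma H3R_in_H3G: "s \<in> H3R \<Longrightarrow> s \<in> H3G"
  unfolding H3R_def conj_def by (auto intro!: H3G_mult H3G_inv sref_in_H3G)

lemma H3R_involution: "s \<in> H3R \<Longrightarrow> s ** s = mat 1"
  unfolding H3R_eq by (auto simp: refl_involution bf_root)

lemma H3R_inv: "s \<in> H3R \<Longrightarrow> matrix_inv s = s"
  using H3R_involution matrix_inv_unique by blast

lemma conj_H3R: "w \<in> H3G \<Longrightarrow> s \<in> H3R \<Longrightarrow> conj w s \<in> H3R"
  unfolding H3R_eq by (auto simp: conj_refl H3G_roots)

lemma conj_eq_iff:
  assumes "w \<in> H3G" shows "conj w s = t \<longleftrightarrow> w ** s = t ** w"
  unfolding conj_def using H3G_inv[OF assms] by (metis matrix_mul_assoc matrix_mul_rid)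

lemma conj_simps:
  assumes "v \<in> H3G" "w \<in> H3G"
  shows "conj v (conj w s) = conj (v ** w) s" "conj (mat 1) s = s"
    "conj w (matrix_inv w ** (s ** w)) = s"
proof -
  have "matrix_inv (v ** w) = matrix_inv w ** matrix_inv v"
    using H3G_inv[OF assms(1)] H3G_inv[OF assms(2)]
    by (intro matrix_inv_unique) (metis matrix_mul_assoc matrix_mul_rid)+
  then show "conj v (conj w s) = conj (v ** w) s" by (simp add: conj_def matrix_mul_assoc)
  have "matrix_inv (mat 1) = (mat 1 :: mat3)" by (rule matrix_inv_unique) auto
  then show "conj (mat 1) s = s" by (simp add: conj_def)
  show "conj w (matrix_inv w ** (s ** w)) = s"
    using H3G_inv[OF assms(2)] by (simp add: conj_def matrix_mul_assoc) (metis matrix_mul_assoc matrix_mul_rid)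
qed

text \<open>Commuting means that the reflection in \<alpha> maps \<beta> to \<beta> or to its
  negative. The first is orthogonality, the second forces proportional roots.\<close>

lemma refl_commute_iff:
  assumes "\<alpha> \<in> roots" "\<beta> \<in> roots"
  shows "reflection \<alpha> ** reflection \<beta> = reflection \<beta> ** reflection \<alpha> \<longleftrightarrow> bf \<alpha> \<beta> = 0 \<or> \<beta> = \<alpha> \<or> \<beta> = - \<alpha>"
proof -
  have G: "reflection \<alpha> \<in> H3G" using assms refl_in_H3R H3R_in_H3G by blast
  have r: "reflection \<alpha> *v \<beta> \<in> roots" using G assms H3G_roots by blast
  have "reflection \<alpha> ** reflection \<beta> = reflection \<beta> ** reflection \<alpha> \<longleftrightarrow> reflection (reflection \<alpha> *v \<beta>) = reflection \<beta>"
    using conj_eq_iff[OF G] conj_refl[OF G] by metis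
  also have "\<dots> \<longleftrightarrow> reflection \<alpha> *v \<beta> = \<beta> \<or> reflection \<alpha> *v \<beta> = - \<beta>"
    using refl_eq_iff[OF r assms(2)] by (metis minus_minus)
  also have "reflection \<alpha> *v \<beta> = \<beta> \<longleftrightarrow> bf \<alpha> \<beta> = 0"
  proof
    assume "reflection \<alpha> *v \<beta> = \<beta>"
    then have "bf \<alpha> \<beta> *s \<alpha> = 0" by (simp add: refl_apply vec_eq_iff)
    then have "bf \<alpha> (bf \<alpha> \<beta> *s \<alpha>) = 0" by (simp add: bf_def)
    then show "bf \<alpha> \<beta> = 0" by (simp add: bf_lin bf_root assms)
  qed (simp add: refl_apply vec_eq_iff)
  also have "reflection \<alpha> *v \<beta> = - \<beta> \<longleftrightarrow> \<beta> = \<alpha> \<or> \<beta> = - \<alpha>"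
  proof
    assume "reflection \<alpha> *v \<beta> = - \<beta>"
    then have eq: "2 *s \<beta> = bf \<alpha> \<beta> *s \<alpha>" by (simp add: refl_apply vec_eq_iff algebra_simps)
    then have "bf \<beta> (2 *s \<beta>) = bf \<beta> (bf \<alpha> \<beta> *s \<alpha>)" by (rule arg_cong)
    then have *: "bf \<alpha> \<beta> * bf \<alpha> \<beta> = 4" by (simp add: bf_lin bf_root assms bf_sym[of \<beta> \<alpha>])
    then have "(bf \<alpha> \<beta> - 2) * (bf \<alpha> \<beta> + 2) = 0" by (simp add: algebra_simps)
    then have "bf \<alpha> \<beta> = 2 \<or> bf \<alpha> \<beta> = -2" by (auto simp: eq_neg_iff_add_eq_0)
    then show "\<beta> = \<alpha> \<or> \<beta> = - \<alpha>" using eq by (auto simp: vec_eq_iff)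
  next
    assume "\<beta> = \<alpha> \<or> \<beta> = - \<alpha>"
    then show "reflection \<alpha> *v \<beta> = - \<beta>"
      using refl_self[OF bf_root[OF assms(1)]] by (auto simp: matrix_vector_uminus)
  qed
  finally show ?thesis by blast
qed

section \<open>Commuting triples, crossing edges and centralizers\<close>

lemma bfvals_square: "a \<in> bfvals \<Longrightarrow> a * a \<in> {0, 1, golden + 1, 2 - golden, 4}"
proof -
  have 1: "(golden - 1) * (golden - 1) = 2 - golden" "(1 - golden) * (1 - golden) = 2 - golden"
    "- golden * - golden = golden + 1"
    using golden_square by (simp_all add: left_diff_distrib right_diff_distrib)
  assume "a \<in> bfvals"
  then consider "a = 0" | "a = 1 \<or> a = -1" | "a = golden \<or> a = - golden"
    | "a = golden - 1 \<or> a = 1 - golden" | "a = 2 \<or> a = -2"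
    unfolding bfvals_def by blast
  then show ?thesis
  proof cases
    case 3 then show ?thesis using 1(3) golden_square by (metis insertCI)
  next
    case 4 then show ?thesis using 1(1,2) by (metis insertCI)
  qed auto
qed

text \<open>The possible squares are 0, 1, \<phi> + 1, 2 - \<phi> and 4, and two of these add up to
  4 only as 0 + 4.\<close>

lemma bfvals_square_sum_4:
  assumes "a \<in> bfvals" "b \<in> bfvals" "a * a + b * b = 4" shows "a = 0 \<or> b = 0"
proof -
  have "a * a = 0 \<or> b * b = 0"
    using bfvals_square[OF assms(1)] bfvals_square[OF assms(2)] assms(3) golden_bounds by auto
  then show ?thesis by simp
qed

text \<open>Two of the possible squares add up to 3 only as (\<phi> + 1) + (2 - \<phi>), and these
  two numbers are inverse to each other.\<close>

lemma bfvals_square_sum_3: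
  assumes "a \<in> bfvals" "b \<in> bfvals" "a * a + b * b = 3" shows "a * b = 1 \<or> a * b = -1"
proof -
  have "a * a = golden + 1 \<and> b * b = 2 - golden \<or> a * a = 2 - golden \<and> b * b = golden + 1"
    using bfvals_square[OF assms(1)] bfvals_square[OF assms(2)] assms(3) golden_bounds by auto
  moreover have "(golden + 1) * (2 - golden) = 1" by (simp add: algebra_simps golden_square)
  ultimately have "(a * a) * (b * b) = 1" by (metis mult.commute)
  then have "(a * b - 1) * (a * b + 1) = 0" by (simp add: algebra_simps)
  then show ?thesis by auto
qed

lemma bfvals_no_half: "1/2 \<notin> bfvals" "-1/2 \<notin> bfvals" "3/2 \<notin> bfvals" "-3/2 \<notin> bfvals"
  using golden_bounds by (simp_all add: bfvals_def)

lemma commclass_frame: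
  assumes "s \<in> H3R"
  obtains \<alpha> \<beta> \<gamma> where "\<alpha> \<in> roots" "\<beta> \<in> roots" "\<gamma> \<in> roots" "s = reflection \<alpha>"
    "bf \<alpha> \<beta> = 0" "bf \<alpha> \<gamma> = 0" "bf \<beta> \<gamma> = 0"
    "\<And>\<delta>. \<delta> \<in> roots \<Longrightarrow> bf \<alpha> \<delta> = 0 \<Longrightarrow> \<delta> \<in> {\<beta>, - \<beta>, \<gamma>, - \<gamma>}"
    "\<And>x. 2 *s x = bf \<alpha> x *s \<alpha> + bf \<beta> x *s \<beta> + bf \<gamma> x *s \<gamma>"
    "commclass s = {reflection \<alpha>, reflection \<beta>, reflection \<gamma>}"
proof -
  obtain \<alpha> where a: "\<alpha> \<in> roots" "s = reflection \<alpha>" using assms unfolding H3R_eq by blast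
  obtain \<beta> \<gamma> where bc: "\<beta> \<in> roots" "\<gamma> \<in> roots" "bf \<alpha> \<beta> = 0" "bf \<alpha> \<gamma> = 0" "bf \<beta> \<gamma> = 0"
    "\<And>\<delta>. \<delta> \<in> roots \<Longrightarrow> bf \<alpha> \<delta> = 0 \<Longrightarrow> \<delta> \<in> {\<beta>, - \<beta>, \<gamma>, - \<gamma>}"
    "\<And>x. 2 *s x = bf \<alpha> x *s \<alpha> + bf \<beta> x *s \<beta> + bf \<gamma> x *s \<gamma>"
    using orthogonal_frame[OF a(1)] by metis
  have "commclass s = {reflection \<alpha>, reflection \<beta>, reflection \<gamma>}"
  proof
    show "commclass s \<subseteq> {reflection \<alpha>, reflection \<beta>, reflection \<gamma>}"
    proof
      fix r assume "r \<in> commclass s"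
      then obtain \<delta> where d: "\<delta> \<in> roots" "r = reflection \<delta>" "reflection \<alpha> ** reflection \<delta> = reflection \<delta> ** reflection \<alpha>"
        unfolding commclass_def H3R_eq a by auto
      then have "bf \<alpha> \<delta> = 0 \<or> \<delta> = \<alpha> \<or> \<delta> = - \<alpha>" using refl_commute_iff[OF a(1)] by blast
      then show "r \<in> {reflection \<alpha>, reflection \<beta>, reflection \<gamma>}" using bc(6)[OF d(1)] d(2) by (auto simp: refl_uminus)
    qed
    show "{reflection \<alpha>, reflection \<beta>, reflection \<gamma>} \<subseteq> commclass s"
      using refl_commute_iff[OF a(1) bc(1)] refl_commute_iff[OF a(1) bc(2)] a bc(1-4) refl_in_H3R
      unfolding commclass_def by simp
  qed
  then show ?thesis using that a bc by blast
qed

lemma commclass_self: "s \<in> H3R \<Longrightarrow> s \<in> commclass s" by (simp add: commclass_def)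

text \<open>The class of \<open>t\<close> comes from an orthogonal frame, so any two of its members
  commute.\<close>

lemma com_trans:
  assumes "s \<in> H3R" "t \<in> H3R" "u \<in> H3R" "s ** t = t ** s" "t ** u = u ** t"
  shows "s ** u = u ** s"
proof -
  obtain \<alpha> \<beta> \<gamma> where f: "\<alpha> \<in> roots" "\<beta> \<in> roots" "\<gamma> \<in> roots" "t = reflection \<alpha>"
    "bf \<alpha> \<beta> = 0" "bf \<alpha> \<gamma> = 0" "bf \<beta> \<gamma> = 0" "commclass t = {reflection \<alpha>, reflection \<beta>, reflection \<gamma>}"
    using commclass_frame[OF assms(2)] by metis
  have "s \<in> commclass t" "u \<in> commclass t" using assms by (auto simp: commclass_def)
  moreover have "reflection \<alpha> ** reflection \<beta> = reflection \<beta> ** reflection \<alpha>" "reflection \<alpha> ** reflection \<gamma> = reflection \<gamma> ** reflection \<alpha>"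
    "reflection \<beta> ** reflection \<gamma> = reflection \<gamma> ** reflection \<beta>"
    using f refl_commute_iff by auto
  ultimately show ?thesis using f(8) by auto
qed

lemma commclass_eq_iff:
  assumes "s \<in> H3R" "t \<in> H3R"
  shows "commclass s = commclass t \<longleftrightarrow> s ** t = t ** s"
proof
  assume "commclass s = commclass t"
  then show "s ** t = t ** s" using commclass_self[OF assms(1)] by (auto simp: commclass_def)
next
  assume "s ** t = t ** s"
  then show "commclass s = commclass t"
    using assms com_trans unfolding commclass_def by (metis (no_types, lifting))
qed

lemma in_commclass_iff:
  assumes "s \<in> H3R" "t \<in> H3R"
  shows "s \<in> commclass t \<longleftrightarrow> commclass s = commclass t"
proof -
  have "s \<in> commclass t \<longleftrightarrow> s ** t = t ** s" using assms by (simp add: commclass_def)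
  then show ?thesis using commclass_eq_iff[OF assms] by blast
qed

lemma conj_commclass:
  assumes "w \<in> H3G" "s \<in> H3R" shows "conj w ` commclass s = commclass (conj w s)"
proof -
  have sub: "conj v ` commclass t \<subseteq> commclass (conj v t)" if v: "v \<in> H3G" "t \<in> H3R" for v t
  proof clarify
    fix r assume "r \<in> commclass t"
    then have r: "r \<in> H3R" "r ** t = t ** r" by (auto simp: commclass_def)
    have "conj v r ** conj v t = v ** (r ** t) ** matrix_inv v" for r t
      by (simp add: conj_def matrix_mul_assoc[symmetric] H3G_cancel[OF v(1)])
    then show "conj v r \<in> commclass (conj v t)"
      using r v conj_H3R by (simp add: commclass_def)
  qed
  have "r \<in> conj w ` commclass s" if r: "r \<in> commclass (conj w s)" for r
  proof -
    let ?i = "matrix_inv w"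
    have i: "?i \<in> H3G" "w ** ?i = mat 1" "?i ** w = mat 1" using H3G_inv assms by auto
    have "conj ?i r \<in> commclass (conj ?i (conj w s))"
      using sub[OF i(1) conj_H3R[OF assms]] r by blast
    then have "conj ?i r \<in> commclass s" using conj_simps[OF i(1) assms(1)] conj_simps(2)[OF assms(1) assms(1)] i by simp
    moreover have "r = conj w (conj ?i r)" using conj_simps[OF assms(1) i(1)] i conj_simps(2)[OF assms(1) assms(1)] by simp
    ultimately show ?thesis by blast
  qed
  then show ?thesis using sub[OF assms] by blast
qed

section \<open>Hyperplanes, transversality and noncrossing edges\<close>

lemma hyp_refl: "\<alpha> \<in> roots \<Longrightarrow> hyp (reflection \<alpha>) = {x. bf \<alpha> x = 0}"
proof -
  assume "\<alpha> \<in> roots"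
  then have "bf \<alpha> x = 0 \<longleftrightarrow> bf \<alpha> x *s \<alpha> = 0" for x
    by (metis bf_root bf_smult bf_smult' mult_eq_0_iff vector_smult_lzero zero_neq_numeral)
  then show ?thesis by (auto simp: fixsp_def refl_apply)
qed

lemma bf_square_4:
  assumes "\<alpha> \<in> roots" "\<beta> \<in> roots" "bf \<alpha> \<beta> * bf \<alpha> \<beta> = 4" shows "reflection \<alpha> = reflection \<beta>"
proof -
  obtain r where r: "bf \<alpha> \<beta> = of_real r" "r = 2 \<Longrightarrow> \<beta> = \<alpha>" "r = -2 \<Longrightarrow> \<beta> = - \<alpha>"
    using bf_vals[OF assms(1,2)] by metis
  have "r * r = 4" using assms(3) unfolding r(1) of_real_mult[symmetric] by (metis of_real_eq_iff of_real_numeral)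
  then have "(r - 2) * (r + 2) = 0" by (simp add: algebra_simps)
  then show ?thesis using r refl_eq_iff[OF assms(1,2)] by auto
qed

lemma hyp_inj:
  assumes "s \<in> H3R" "t \<in> H3R" "hyp s \<subseteq> hyp t" shows "s = t"
proof -
  obtain \<alpha> \<beta> where a: "\<alpha> \<in> roots" "s = reflection \<alpha>" "\<beta> \<in> roots" "t = reflection \<beta>" using assms unfolding H3R_eq by blast
  \<comment> \<open>Twice the projection of \<beta> to the hyperplane of \<alpha>.\<close>
  define x where "x = 2 *s \<beta> - bf \<alpha> \<beta> *s \<alpha>"
  have "bf \<alpha> x = 0" using a by (simp add: x_def bf_lin bf_root)
  then have "bf \<beta> x = 0" using assms(3) hyp_refl a by auto
  then have "bf \<alpha> \<beta> * bf \<alpha> \<beta> = 4" using a by (simp add: x_def bf_lin bf_root bf_sym[of \<beta> \<alpha>])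
  then show ?thesis using bf_square_4 a by blast
qed

text \<open>For orthogonal \<alpha> and \<beta>, a root \<gamma> vanishing on the edge also vanishes
  on its own projection off their span, so its two inner products have squares adding up to 4; one
  of them is 0 and \<gamma> is \<alpha> or \<beta> up to sign. Conversely, the hyperplane of
  \<open>conj s t\<close> contains the edge, so by transversality this reflection is
  \<open>s\<close> or \<open>t\<close>, and either outcome makes the two commute.\<close>

lemma transverse_iff:
  assumes "s \<in> H3R" "t \<in> H3R" "s \<noteq> t"
  shows "transverse s t \<longleftrightarrow> s ** t = t ** s"
proof
  assume com: "s ** t = t ** s"
  show "transverse s t" unfolding transverse_def
  proof (intro ballI impI)
    fix c assume c: "c \<in> H3R" "hyp s \<inter> hyp t \<subseteq> hyp c"
    obtain \<alpha> \<beta> \<gamma> where a: "\<alpha> \<in> roots" "s = reflection \<alpha>" "\<beta> \<in> roots" "t = reflection \<beta>" "\<gamma> \<in> roots" "c = reflection \<gamma>"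
      using assms c unfolding H3R_eq by blast
    have 0: "bf \<alpha> \<beta> = 0" using com a assms(3) refl_commute_iff[OF a(1,3)] by (auto simp: refl_uminus)
    define x where "x = 2 *s \<gamma> - bf \<alpha> \<gamma> *s \<alpha> - bf \<beta> \<gamma> *s \<beta>"
    have "bf \<alpha> x = 0" "bf \<beta> x = 0" using a 0 by (simp_all add: x_def bf_lin bf_root bf_sym[of \<beta> \<alpha>])
    then have "bf \<gamma> x = 0" using c(2) hyp_refl a by auto
    then have eq: "bf \<alpha> \<gamma> * bf \<alpha> \<gamma> + bf \<beta> \<gamma> * bf \<beta> \<gamma> = 4"
      using a by (simp add: x_def bf_lin bf_root bf_sym[of \<gamma> \<alpha>] bf_sym[of \<gamma> \<beta>] algebra_simps)
    obtain p where p: "p \<in> bfvals" "bf \<alpha> \<gamma> = of_real p" using bf_vals a by metis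
    obtain q where q: "q \<in> bfvals" "bf \<beta> \<gamma> = of_real q" using bf_vals a by metis
    have "p * p + q * q = 4" using eq unfolding p(2) q(2) of_real_mult[symmetric] of_real_add[symmetric]
      by (metis of_real_eq_iff of_real_numeral)
    then have "p = 0 \<or> q = 0" using bfvals_square_sum_4 p q by blast
    then have "bf \<alpha> \<gamma> * bf \<alpha> \<gamma> = 4 \<or> bf \<beta> \<gamma> * bf \<beta> \<gamma> = 4" using eq p q by auto
    then have "c = s \<or> c = t" using bf_square_4 a by metis
    then show "hyp c = hyp s \<or> hyp c = hyp t" by blast
  qed
next
  assume tr: "transverse s t"
  define c where "c = conj s t"
  have G: "s \<in> H3G" using assms H3R_in_H3G by blast
  have c: "c \<in> H3R" using c_def conj_H3R G assms by blast
  have cs: "c = s ** t ** s" by (simp add: c_def conj_def H3R_inv assms)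
  have "hyp s \<inter> hyp t \<subseteq> hyp c" by (auto simp: cs fixsp_def matrix_vector_mul_assoc[symmetric])
  then have "hyp c = hyp s \<or> hyp c = hyp t" using tr c unfolding transverse_def by blast
  then have "c = s \<or> c = t" using hyp_inj c assms by blast
  then show "s ** t = t ** s"
  proof
    assume "c = s"
    then have "t ** s = mat 1" using H3R_involution[OF assms(1)] cs by (metis matrix_mul_assoc matrix_mul_lid)
    then have "t = s" using H3R_involution[OF assms(1)] by (metis matrix_mul_assoc matrix_mul_lid matrix_mul_rid)
    then show ?thesis by simp
  next
    assume "c = t" then show ?thesis using conj_eq_iff[OF G, of t t] c_def by simp
  qed
qed

text \<open>A transverse pair cutting out the same edge would consist of the only reflections
  through it, hence contain \<open>s\<close> and \<open>t\<close>, and its members would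
  commute.\<close>

lemma noncrossing_iff:
  assumes "s \<in> H3R" "t \<in> H3R" "s \<noteq> t"
  shows "noncrossing_edge (hyp s \<inter> hyp t) \<longleftrightarrow> s ** t \<noteq> t ** s"
proof
  assume "noncrossing_edge (hyp s \<inter> hyp t)"
  then show "s ** t \<noteq> t ** s"
    using assms transverse_iff unfolding noncrossing_edge_def crossing_edge_def by blast
next
  assume nc: "s ** t \<noteq> t ** s"
  have "codim2_edge (hyp s \<inter> hyp t)" unfolding codim2_edge_def using assms hyp_inj by blast
  moreover have "\<not> crossing_edge (hyp s \<inter> hyp t)"
  proof
    assume "crossing_edge (hyp s \<inter> hyp t)"
    then obtain a b where ab: "a \<in> H3R" "b \<in> H3R" "transverse a b" "hyp s \<inter> hyp t = hyp a \<inter> hyp b"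
      unfolding crossing_edge_def by blast
    have "u = a \<or> u = b" if "u \<in> H3R" "hyp s \<inter> hyp t \<subseteq> hyp u" for u
      using ab that hyp_inj unfolding transverse_def by (metis order_refl)
    then have "s = a \<or> s = b" "t = a \<or> t = b" using assms by blast+
    then show False using nc ab transverse_iff assms by metis
  qed
  ultimately show "noncrossing_edge (hyp s \<inter> hyp t)" by (simp add: noncrossing_edge_def)
qed

text \<open>Two non-commuting reflections of H3 generate a dihedral group with odd exponent 3 or 5,
  in which some reflection carries one to the other. Which of the three candidate roots achieves
  this depends on whether the inner product is 1, \<phi> or \<phi> - 1 up to sign.\<close>

lemma swapping_root:
  assumes "\<alpha> \<in> roots" "\<beta> \<in> roots" "bf \<alpha> \<beta> \<noteq> 0" "\<beta> \<noteq> \<alpha>" "\<beta> \<noteq> - \<alpha>"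
  shows "\<exists>\<gamma>\<in>roots. reflection \<gamma> *v \<beta> = \<alpha> \<or> reflection \<gamma> *v \<beta> = - \<alpha>"
proof -
  obtain r where r: "r \<in> bfvals" "bf \<alpha> \<beta> = of_real r" "r \<noteq> 0" "r \<noteq> 2" "r \<noteq> -2"
    using bf_vals[OF assms(1,2)] assms by (metis of_real_0)
  have G: "reflection \<alpha> \<in> H3G" "reflection \<beta> \<in> H3G" using assms refl_in_H3R H3R_in_H3G by blast+
  have bfs: "bf \<alpha> \<alpha> = 2" "bf \<beta> \<beta> = 2" "bf \<alpha> \<beta> = of_real r" "bf \<beta> \<alpha> = of_real r"
    using assms bf_root r bf_sym by auto
  let ?A = "reflection \<alpha> *v \<beta>" and ?B = "reflection \<alpha> *v (reflection \<beta> *v \<alpha>)" and ?C = "reflection \<beta> *v (reflection \<alpha> *v \<beta>)"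
  have R: "?A \<in> roots" "?B \<in> roots" "?C \<in> roots" using G assms H3G_roots by blast+
  define k where "k = complex_of_real r"
  \<comment> \<open>The roots \<open>?A\<close>, \<open>?B\<close>, \<open>?C\<close> in terms of
    \<alpha> and \<beta>; with explicit coefficients each case becomes a polynomial identity in
    \<open>k\<close>.\<close>
  define A B C where "A = \<beta> - k *s \<alpha>" and "B = (k * k - 1) *s \<alpha> - k *s \<beta>"
    and "C = (k * k - 1) *s \<beta> - k *s \<alpha>"
  have "?A = A" "?B = B" "?C = C"
    by (simp_all only: refl_apply bf_lin bfs k_def A_def B_def C_def)
      (simp_all add: vec_eq_iff algebra_simps)
  with R have R: "A \<in> roots" "B \<in> roots" "C \<in> roots" by simp_all
  have "bf A \<beta> = 2 - k * k" "bf B \<beta> = (k * k - 1) * k - k * 2" "bf C \<beta> = (k * k - 1) * 2 - k * k"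
    unfolding A_def B_def C_def by (simp_all add: bf_lin bfs k_def algebra_simps)
  then have rA: "reflection A *v \<beta> = \<beta> - (2 - k * k) *s (\<beta> - k *s \<alpha>)"
    and rB: "reflection B *v \<beta> = \<beta> - ((k * k - 1) * k - k * 2) *s ((k * k - 1) *s \<alpha> - k *s \<beta>)"
    and rC: "reflection C *v \<beta> = \<beta> - ((k * k - 1) * 2 - k * k) *s ((k * k - 1) *s \<beta> - k *s \<alpha>)"
    unfolding refl_apply by (simp_all add: A_def B_def C_def)
  consider "r = 1 \<or> r = -1" | "r = golden \<or> r = - golden" | "r = golden - 1 \<or> r = 1 - golden"
    using r unfolding bfvals_def by blast
  then show ?thesis
  proof cases
    case 1
    then have "reflection A *v \<beta> = \<alpha> \<or> reflection A *v \<beta> = - \<alpha>"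
      unfolding rA by (elim disjE) (simp_all add: k_def vec_eq_iff)
    then show ?thesis using R by blast
  next
    case 2
    then have "reflection B *v \<beta> = \<alpha> \<or> reflection B *v \<beta> = - \<alpha>"
      unfolding rB
      by (elim disjE) (simp_all add: k_def vec_eq_iff algebra_simps cgolden_square cgolden_square_assoc)
    then show ?thesis using R by blast
  next
    case 3
    then have "reflection C *v \<beta> = \<alpha> \<or> reflection C *v \<beta> = - \<alpha>"
      unfolding rC k_def
      by (elim disjE; hypsubst; simp add: vec_eq_iff algebra_simps cgolden_square cgolden_square_assoc)
    then show ?thesis using R by blast
  qed
qed

text \<open>Each swapping root is proportional to \<beta> - \<alpha> or to \<beta> + \<alpha>. If
  one belonged to each, scaled copies would add up to 2 \<beta>, and the squares of their inner
  products with \<beta> would add up to 4. One inner product would then vanish, although swapping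
  requires both to be nonzero.\<close>

lemma swapping_root_unique:
  assumes "\<alpha> \<in> roots" "\<beta> \<in> roots" "bf \<alpha> \<beta> \<noteq> 0" "\<beta> \<noteq> \<alpha>" "\<beta> \<noteq> - \<alpha>"
    and "\<gamma> \<in> roots" "reflection \<gamma> *v \<beta> = \<alpha> \<or> reflection \<gamma> *v \<beta> = - \<alpha>"
    and "\<delta> \<in> roots" "reflection \<delta> *v \<beta> = \<alpha> \<or> reflection \<delta> *v \<beta> = - \<alpha>"
  shows "reflection \<gamma> = reflection \<delta>"
proof -
  define c d where "c = bf \<gamma> \<beta>" and "d = bf \<delta> \<beta>"
  have bfs: "bf \<alpha> \<alpha> = 2" "bf \<beta> \<beta> = 2" "bf \<gamma> \<gamma> = 2" "bf \<delta> \<delta> = 2" using assms bf_root by auto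
  have g: "c *s \<gamma> = \<beta> - \<alpha> \<or> c *s \<gamma> = \<beta> + \<alpha>"
    using assms(7) unfolding refl_apply c_def by (auto simp: algebra_simps)
  have d: "d *s \<delta> = \<beta> - \<alpha> \<or> d *s \<delta> = \<beta> + \<alpha>"
    using assms(9) unfolding refl_apply d_def by (auto simp: algebra_simps)
  have c0: "c \<noteq> 0" using g assms(4,5) by (auto simp: eq_neg_iff_add_eq_0)
  have d0: "d \<noteq> 0" using d assms(4,5) by (auto simp: eq_neg_iff_add_eq_0)
  show ?thesis
  proof (cases "c *s \<gamma> = d *s \<delta>")
    case True
    then have "bf \<gamma> (c *s \<gamma>) = bf \<gamma> (d *s \<delta>)" "bf \<delta> (c *s \<gamma>) = bf \<delta> (d *s \<delta>)" by (auto intro: arg_cong)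
    then have "c * 2 = d * bf \<gamma> \<delta>" "c * bf \<gamma> \<delta> = d * 2" by (simp_all add: bf_lin bfs bf_sym[of \<delta> \<gamma>])
    then have "d * (bf \<gamma> \<delta> * bf \<gamma> \<delta>) = d * 4" by (metis (no_types, lifting) mult.assoc mult.commute mult_2_right numeral_Bit0 distrib_left)
    then have "bf \<gamma> \<delta> * bf \<gamma> \<delta> = 4" using d0 by simp
    then show ?thesis using bf_square_4 assms by blast
  next
    case False
    then consider "c *s \<gamma> = \<beta> - \<alpha>" "d *s \<delta> = \<beta> + \<alpha>" | "c *s \<gamma> = \<beta> + \<alpha>" "d *s \<delta> = \<beta> - \<alpha>"
      using g d by auto
    then have "2 *s \<beta> = c *s \<gamma> + d *s \<delta>" by cases (simp_all add: vec_eq_iff)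
    then have "bf \<beta> (2 *s \<beta>) = bf \<beta> (c *s \<gamma> + d *s \<delta>)" by (rule arg_cong)
    then have eq: "c * c + d * d = 4" by (simp add: bf_lin bfs c_def d_def bf_sym[of \<beta> \<gamma>] bf_sym[of \<beta> \<delta>])
    obtain p where p: "p \<in> bfvals" "c = of_real p" unfolding c_def using bf_vals assms by metis
    obtain q where q: "q \<in> bfvals" "d = of_real q" unfolding d_def using bf_vals assms by metis
    have "p * p + q * q = 4" using eq unfolding p(2) q(2) of_real_mult[symmetric] of_real_add[symmetric]
      by (metis of_real_eq_iff of_real_numeral)
    then have "p = 0 \<or> q = 0" using bfvals_square_sum_4 p q by blast
    then show ?thesis using c0 d0 p q by auto
  qed
qed

text \<open>The source of monomiality: the sum over R(s, t) in the relation for a non-commuting pair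
  has exactly one term.\<close>

lemma Rss_singleton:
  assumes "s \<in> H3R" "t \<in> H3R" "s ** t \<noteq> t ** s"
  obtains r where "Rss s t = {r}" "r \<in> H3R" "conj r t = s"
proof -
  obtain \<alpha> \<beta> where a: "\<alpha> \<in> roots" "s = reflection \<alpha>" "\<beta> \<in> roots" "t = reflection \<beta>" using assms unfolding H3R_eq by blast
  have ne: "bf \<alpha> \<beta> \<noteq> 0" "\<beta> \<noteq> \<alpha>" "\<beta> \<noteq> - \<alpha>" using assms a refl_commute_iff[OF a(1,3)] by blast+
  have iff: "reflection \<gamma> \<in> Rss s t \<longleftrightarrow> reflection \<gamma> *v \<beta> = \<alpha> \<or> reflection \<gamma> *v \<beta> = - \<alpha>" if "\<gamma> \<in> roots" for \<gamma>
  proof -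
    have R: "reflection \<gamma> \<in> H3R" and G: "reflection \<gamma> \<in> H3G" using that refl_in_H3R H3R_in_H3G by blast+
    have "reflection \<gamma> \<in> Rss s t \<longleftrightarrow> conj (reflection \<gamma>) t = s"
      using R by (simp add: Rss_def conj_def H3R_inv)
    also have "\<dots> \<longleftrightarrow> reflection (reflection \<gamma> *v \<beta>) = reflection \<alpha>" using conj_refl[OF G] a by simp
    also have "\<dots> \<longleftrightarrow> reflection \<gamma> *v \<beta> = \<alpha> \<or> reflection \<gamma> *v \<beta> = - \<alpha>"
      using refl_eq_iff[OF a(1) H3G_roots[OF G a(3)]] by metis
    finally show ?thesis .
  qed
  obtain \<gamma> where g: "\<gamma> \<in> roots" "reflection \<gamma> *v \<beta> = \<alpha> \<or> reflection \<gamma> *v \<beta> = - \<alpha>"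
    using swapping_root[OF a(1,3) ne] by blast
  have "Rss s t = {reflection \<gamma>}"
  proof
    show "Rss s t \<subseteq> {reflection \<gamma>}"
    proof
      fix r assume r: "r \<in> Rss s t"
      then obtain \<delta> where d: "\<delta> \<in> roots" "r = reflection \<delta>" unfolding Rss_def H3R_eq by blast
      then have "reflection \<delta> *v \<beta> = \<alpha> \<or> reflection \<delta> *v \<beta> = - \<alpha>" using iff r by blast
      then show "r \<in> {reflection \<gamma>}" using swapping_root_unique[OF a(1,3) ne g d(1)] d(2) by simp
    qed
    show "{reflection \<gamma>} \<subseteq> Rss s t" using iff g by blast
  qed
  moreover have "reflection \<gamma> \<in> H3R" using g refl_in_H3R by blast
  moreover have "conj (reflection \<gamma>) t = s"
    using g a conj_refl[of "reflection \<gamma>" \<beta>] \<open>reflection \<gamma> \<in> H3R\<close> H3R_in_H3G refl_uminus by auto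
  ultimately show ?thesis using that by blast
qed

section \<open>Centralizers of reflections\<close>

lemma centralizer_signs:
  assumes w: "w \<in> H3G" and s: "w ** reflection \<alpha> = reflection \<alpha> ** w"
    and f: "\<alpha> \<in> roots" "\<beta> \<in> roots" "\<gamma> \<in> roots" "bf \<alpha> \<beta> = 0" "bf \<alpha> \<gamma> = 0" "bf \<beta> \<gamma> = 0"
    "\<And>\<delta>. \<delta> \<in> roots \<Longrightarrow> bf \<alpha> \<delta> = 0 \<Longrightarrow> \<delta> \<in> {\<beta>, - \<beta>, \<gamma>, - \<gamma>}"
    and expand: "\<And>x. 2 *s x = bf \<alpha> x *s \<alpha> + bf \<beta> x *s \<beta> + bf \<gamma> x *s \<gamma>"
  shows "w *v \<alpha> = \<alpha> \<or> w *v \<alpha> = - \<alpha>" "w *v \<beta> = \<beta> \<or> w *v \<beta> = - \<beta>" "w *v \<gamma> = \<gamma> \<or> w *v \<gamma> = - \<gamma>"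
proof -
  have "conj w (reflection \<alpha>) = reflection \<alpha>" using conj_eq_iff[OF w] s by blast
  then have "reflection (w *v \<alpha>) = reflection \<alpha>" using conj_refl[OF w] by simp
  then show wa: "w *v \<alpha> = \<alpha> \<or> w *v \<alpha> = - \<alpha>"
    using refl_eq_iff[OF f(1) H3G_roots[OF w f(1)]] by metis
  have orth: "bf \<alpha> (w *v x) = 0" if "bf \<alpha> x = 0" for x
    using bf_H3G_invariant[OF w, of \<alpha> x] wa that by (auto simp: bf_lin)
  have wb: "w *v \<beta> \<in> {\<beta>, - \<beta>, \<gamma>, - \<gamma>}" and wc: "w *v \<gamma> \<in> {\<beta>, - \<beta>, \<gamma>, - \<gamma>}"
    using f orth H3G_roots[OF w] by blast+
  have bfs: "bf \<alpha> \<alpha> = 2" "bf \<beta> \<beta> = 2" "bf \<gamma> \<gamma> = 2" using f bf_root by auto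
  have inv: "bf (w *v \<beta>) (w *v \<gamma>) = 0" using bf_H3G_invariant[OF w] f by simp
  (* Such a swap would make 2 * bf \<delta> (w *v \<delta>) equal to 1, -1, 3 or -3, so bf would take a value
     that does not occur between roots. *)
  have noswap: False if sw: "w *v \<beta> = \<gamma> \<or> w *v \<beta> = - \<gamma>" "w *v \<gamma> = \<beta> \<or> w *v \<gamma> = - \<beta>"
  proof -
    obtain \<delta> where d: "\<delta> \<in> roots" "bf \<alpha> \<delta> = 1" using root_bf_one[OF f(1)] by blast
    obtain y where y: "y \<in> bfvals" "bf \<beta> \<delta> = of_real y" using bf_vals[OF f(2) d(1)] by metis
    obtain z where z: "z \<in> bfvals" "bf \<gamma> \<delta> = of_real z" using bf_vals[OF f(3) d(1)] by metis
    have ex: "2 *s \<delta> = \<alpha> + of_real y *s \<beta> + of_real z *s \<gamma>" using expand[of \<delta>] d y z by simp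
    \<comment> \<open>Comparing norms gives \<open>y * y + z * z = 3\<close>, so
      \<open>y * z\<close> is 1 or -1.\<close>
    have "bf \<delta> (2 *s \<delta>) = bf \<delta> (\<alpha> + of_real y *s \<beta> + of_real z *s \<gamma>)" using ex by simp
    then have "complex_of_real (1 + y * y + z * z) = 4"
      using d y z by (simp add: bf_lin bf_root bf_sym[of \<delta> \<alpha>] bf_sym[of \<delta> \<beta>] bf_sym[of \<delta> \<gamma>])
    then have "1 + y * y + z * z = 4" by (metis of_real_eq_iff of_real_numeral)
    then have yz: "y * z = 1 \<or> y * z = -1" using bfvals_square_sum_3[OF y(1) z(1)] by simp
    have "w *v (2 *s \<delta>) = w *v \<alpha> + of_real y *s (w *v \<beta>) + of_real z *s (w *v \<gamma>)"
      unfolding ex by (simp add: matrix_vector_right_distrib vector_scalar_commute)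
    then have "bf \<delta> (w *v (2 *s \<delta>)) = bf \<delta> (w *v \<alpha> + of_real y *s (w *v \<beta>) + of_real z *s (w *v \<gamma>))"
      by (rule arg_cong)
    then have e: "2 * bf \<delta> (w *v \<delta>) = bf \<delta> (w *v \<alpha>) + of_real y * bf \<delta> (w *v \<beta>) + of_real z * bf \<delta> (w *v \<gamma>)"
      by (simp add: bf_lin vector_scalar_commute)
    obtain q where q: "q \<in> bfvals" "bf \<delta> (w *v \<delta>) = of_real q" using bf_vals[OF d(1) H3G_roots[OF w d(1)]] by metis
    obtain e1 where e1: "e1 = 1 \<or> e1 = (-1::real)" "bf \<delta> (w *v \<alpha>) = of_real e1"
      using wa d by (metis bf_minus bf_sym of_real_1 of_real_minus)
    obtain e2 where e2: "e2 = 1 \<or> e2 = (-1::real)" "bf \<delta> (w *v \<beta>) = of_real (e2 * z)"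
      using sw(1) z by (metis bf_minus bf_sym mult_1 mult_minus1 of_real_minus)
    obtain e3 where e3: "e3 = 1 \<or> e3 = (-1::real)" "bf \<delta> (w *v \<gamma>) = of_real (e3 * y)"
      using sw(2) y by (metis bf_minus bf_sym mult_1 mult_minus1 of_real_minus)
    have "complex_of_real (2 * q) = of_real (e1 + y * (e2 * z) + z * (e3 * y))"
      using e q e1 e2 e3 by simp
    then have "2 * q = e1 + y * (e2 * z) + z * (e3 * y)" by (metis of_real_eq_iff)
    then have "2 * q = e1 + e2 * (y * z) + e3 * (y * z)" by (simp add: algebra_simps)
    then have "q = 1/2 \<or> q = -1/2 \<or> q = 3/2 \<or> q = -3/2" using yz e1(1) e2(1) e3(1) by auto
    then show False using q(1) bfvals_no_half by metis
  qed
  show "w *v \<beta> = \<beta> \<or> w *v \<beta> = - \<beta>" using wb wc noswap inv bfs by (auto simp: bf_lin)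
  show "w *v \<gamma> = \<gamma> \<or> w *v \<gamma> = - \<gamma>" using wb wc noswap inv bfs by (auto simp: bf_lin)
qed

lemma frame_matrix_eq:
  fixes A B :: mat3
  assumes expand: "\<And>x. 2 *s x = bf \<alpha> x *s \<alpha> + bf \<beta> x *s \<beta> + bf \<gamma> x *s \<gamma>"
    and "A *v \<alpha> = B *v \<alpha>" "A *v \<beta> = B *v \<beta>" "A *v \<gamma> = B *v \<gamma>"
  shows "A = B"
proof -
  have "A *v x = B *v x" for x
  proof -
    have "A *v (2 *s x) = B *v (2 *s x)"
      unfolding expand using assms(2-) by (simp add: matrix_vector_right_distrib vector_scalar_commute)
    then show ?thesis by (simp add: vector_scalar_commute vec_eq_iff)
  qed
  then show ?thesis by (simp add: matrix_eq)
qed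

text \<open>An element commuting with the reflection in \<alpha> only changes signs of the three
  frame roots, and every choice of signs is realized by a product of the three frame
  reflections.\<close>

lemma centralizer_eq:
  assumes w: "w \<in> H3G" and s: "w ** reflection \<alpha> = reflection \<alpha> ** w"
    and f: "\<alpha> \<in> roots" "\<beta> \<in> roots" "\<gamma> \<in> roots" "bf \<alpha> \<beta> = 0" "bf \<alpha> \<gamma> = 0" "bf \<beta> \<gamma> = 0"
    "\<And>\<delta>. \<delta> \<in> roots \<Longrightarrow> bf \<alpha> \<delta> = 0 \<Longrightarrow> \<delta> \<in> {\<beta>, - \<beta>, \<gamma>, - \<gamma>}"
    and expand: "\<And>x. 2 *s x = bf \<alpha> x *s \<alpha> + bf \<beta> x *s \<beta> + bf \<gamma> x *s \<gamma>"
  shows "\<exists>a\<in>{mat 1, reflection \<alpha>}. \<exists>b\<in>{mat 1, reflection \<beta>}. \<exists>c\<in>{mat 1, reflection \<gamma>}. w = a ** (b ** c)"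
proof -
  have bfs: "bf \<alpha> \<alpha> = 2" "bf \<beta> \<beta> = 2" "bf \<gamma> \<gamma> = 2" "bf \<beta> \<alpha> = 0" "bf \<gamma> \<alpha> = 0" "bf \<gamma> \<beta> = 0"
    using f bf_root bf_sym by auto
  have act: "reflection \<alpha> *v \<alpha> = - \<alpha>" "reflection \<alpha> *v \<beta> = \<beta>" "reflection \<alpha> *v \<gamma> = \<gamma>"
    "reflection \<beta> *v \<alpha> = \<alpha>" "reflection \<beta> *v \<beta> = - \<beta>" "reflection \<beta> *v \<gamma> = \<gamma>"
    "reflection \<gamma> *v \<alpha> = \<alpha>" "reflection \<gamma> *v \<beta> = \<beta>" "reflection \<gamma> *v \<gamma> = - \<gamma>"
    by (simp_all add: refl_apply bfs f vec_eq_iff)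
  note signs = centralizer_signs[OF w s f expand]
  define a where "a = (if w *v \<alpha> = \<alpha> then mat 1 else reflection \<alpha>)"
  define b where "b = (if w *v \<beta> = \<beta> then mat 1 else reflection \<beta>)"
  define c where "c = (if w *v \<gamma> = \<gamma> then mat 1 else reflection \<gamma>)"
  have "w = a ** (b ** c)"
    by (rule frame_matrix_eq[OF expand])
      (use signs in \<open>auto simp: a_def b_def c_def matrix_vector_mul_assoc[symmetric] act matrix_vector_uminus\<close>)
  moreover have "a \<in> {mat 1, reflection \<alpha>}" "b \<in> {mat 1, reflection \<beta>}" "c \<in> {mat 1, reflection \<gamma>}"
    by (simp_all add: a_def b_def c_def)
  ultimately show ?thesis by blast
qed

lemma H3R_triple:
  assumes "s \<in> H3R"
  obtains j k where "j \<in> H3R" "k \<in> H3R" "commclass s = {s, j, k}" "s \<noteq> j" "s \<noteq> k" "j \<noteq> k"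
    "s ** j = j ** s" "s ** k = k ** s" "j ** k = k ** j"
    "\<And>w. w \<in> H3G \<Longrightarrow> w ** s = s ** w \<Longrightarrow>
       \<exists>a\<in>{mat 1, s}. \<exists>b\<in>{mat 1, j}. \<exists>c\<in>{mat 1, k}. w = a ** (b ** c)"
proof -
  obtain \<alpha> \<beta> \<gamma> where f: "\<alpha> \<in> roots" "\<beta> \<in> roots" "\<gamma> \<in> roots" "s = reflection \<alpha>"
    "bf \<alpha> \<beta> = 0" "bf \<alpha> \<gamma> = 0" "bf \<beta> \<gamma> = 0"
    "\<And>\<delta>. \<delta> \<in> roots \<Longrightarrow> bf \<alpha> \<delta> = 0 \<Longrightarrow> \<delta> \<in> {\<beta>, - \<beta>, \<gamma>, - \<gamma>}"
    "\<And>x. 2 *s x = bf \<alpha> x *s \<alpha> + bf \<beta> x *s \<beta> + bf \<gamma> x *s \<gamma>"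
    "commclass s = {reflection \<alpha>, reflection \<beta>, reflection \<gamma>}"
    using commclass_frame[OF assms] by metis
  have ne: "reflection x \<noteq> reflection y" if "x \<in> roots" "y \<in> roots" "bf x y = 0" for x y
    using refl_eq_iff[OF that(1,2)] that bf_root[OF that(1)] by (auto simp: bf_lin)
  have com: "reflection x ** reflection y = reflection y ** reflection x" if "x \<in> roots" "y \<in> roots" "bf x y = 0" for x y
    using refl_commute_iff[OF that(1,2)] that by blast
  show ?thesis
    using that[OF refl_in_H3R[OF f(2)] refl_in_H3R[OF f(3)] f(10)[folded f(4)]] f(4)
      ne[OF f(1,2,5)] ne[OF f(1,3,6)] ne[OF f(2,3,7)] com[OF f(1,2,5)] com[OF f(1,3,6)] com[OF f(2,3,7)]
      centralizer_eq[OF _ _ f(1,2,3,5,6,7,8,9)]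
    by simp
qed

text \<open>The centralizer of \<open>s\<close> consists of products of members of its class, and
  these commute with one another.\<close>

lemma centralizer_commclass:
  assumes "s \<in> H3R" "t \<in> commclass s" "w \<in> H3G" "w ** s = s ** w"
  shows "w ** t = t ** w"
proof -
  obtain j k where jk: "j \<in> H3R" "k \<in> H3R" "commclass s = {s, j, k}"
    "s ** j = j ** s" "s ** k = k ** s" "j ** k = k ** j"
    "\<And>w. w \<in> H3G \<Longrightarrow> w ** s = s ** w \<Longrightarrow>
       \<exists>a\<in>{mat 1, s}. \<exists>b\<in>{mat 1, j}. \<exists>c\<in>{mat 1, k}. w = a ** (b ** c)"
    using H3R_triple[OF assms(1)] by metis
  obtain a b c where abc: "a \<in> {mat 1, s}" "b \<in> {mat 1, j}" "c \<in> {mat 1, k}" "w = a ** (b ** c)"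
    using jk(7)[OF assms(3,4)] by blast
  have "a ** t = t ** a" "b ** t = t ** b" "c ** t = t ** c"
    using abc(1-3) assms(2) jk by auto
  then show ?thesis unfolding abc(4) by (metis matrix_mul_assoc)
qed

lemma not_codim2_edge_hyp: "s \<in> H3R \<Longrightarrow> \<not> codim2_edge (hyp s)"
  unfolding codim2_edge_def using hyp_inj by (metis inf_le1 inf_le2)

lemma not_codim2_edge_zero: "\<not> codim2_edge {0}"
proof
  assume "codim2_edge {0}"
  then obtain a b where ab: "a \<in> H3R" "b \<in> H3R" "hyp a \<noteq> hyp b" "hyp a \<inter> hyp b = {0}"
    unfolding codim2_edge_def by metis
  obtain \<alpha> \<beta> \<gamma> where f: "\<alpha> \<in> roots" "\<beta> \<in> roots" "\<gamma> \<in> roots" "a = reflection \<alpha>"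
    "bf \<alpha> \<beta> = 0" "bf \<alpha> \<gamma> = 0" "bf \<beta> \<gamma> = 0"
    "\<And>x. 2 *s x = bf \<alpha> x *s \<alpha> + bf \<beta> x *s \<beta> + bf \<gamma> x *s \<gamma>"
    using commclass_frame[OF ab(1)] by metis
  obtain \<delta> where d: "\<delta> \<in> roots" "b = reflection \<delta>" using ab unfolding H3R_eq by blast
  \<comment> \<open>The analogue of a cross product: a vector in the plane of \<beta> and \<gamma>
    orthogonal to \<delta>. If it vanishes, \<delta> is proportional to \<alpha>.\<close>
  define x where "x = bf \<delta> \<gamma> *s \<beta> - bf \<delta> \<beta> *s \<gamma>"
  have "bf \<alpha> x = 0" "bf \<delta> x = 0" using f by (simp_all add: x_def bf_lin)
  then have "x = 0" using ab(4) hyp_refl f d by auto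
  then have "bf \<beta> x = 0" "bf \<gamma> x = 0" by (simp_all add: bf_def)
  then have "bf \<beta> \<delta> = 0" "bf \<gamma> \<delta> = 0"
    using f by (simp_all add: x_def bf_lin bf_root bf_sym[of \<gamma> \<beta>] bf_sym[of \<delta> \<gamma>] bf_sym[of \<delta> \<beta>])
  then have "2 *s \<delta> = bf \<alpha> \<delta> *s \<alpha>" using f(8)[of \<delta>] by simp
  then have "bf \<delta> (2 *s \<delta>) = bf \<delta> (bf \<alpha> \<delta> *s \<alpha>)" by (rule arg_cong)
  then have "bf \<alpha> \<delta> * bf \<alpha> \<delta> = 4" using d by (simp add: bf_lin bf_root bf_sym[of \<delta> \<alpha>])
  then show False using bf_square_4[OF f(1) d(1)] ab f d by simp
qed

lemma centralizer_fixsp: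
  assumes f: "\<alpha> \<in> roots" "\<beta> \<in> roots" "\<gamma> \<in> roots" "bf \<alpha> \<beta> = 0" "bf \<alpha> \<gamma> = 0" "bf \<beta> \<gamma> = 0"
    and w: "w = a ** (b ** c)" "a = mat 1 \<or> a = reflection \<alpha>" "b = mat 1 \<or> b = reflection \<beta>" "c = mat 1 \<or> c = reflection \<gamma>"
  shows "hyp (reflection \<alpha>) \<inter> fixsp w = {x. bf \<alpha> x = 0 \<and> (b = mat 1 \<or> bf \<beta> x = 0) \<and> (c = mat 1 \<or> bf \<gamma> x = 0)}"
proof -
  have bfs: "bf \<beta> \<beta> = 2" "bf \<gamma> \<gamma> = 2" "bf \<gamma> \<beta> = 0" using f bf_root bf_sym by auto
  have "w *v x = x \<longleftrightarrow> (b = mat 1 \<or> bf \<beta> x = 0) \<and> (c = mat 1 \<or> bf \<gamma> x = 0)" if x: "bf \<alpha> x = 0" for x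
  proof -
    \<comment> \<open>\<open>p\<close> and \<open>q\<close> are the multiples of \<beta> and
      \<gamma> that \<open>w\<close> subtracts from \<open>x\<close>; by orthogonality
      \<open>x\<close> is fixed exactly when both are 0.\<close>
    define p where "p = (if b = mat 1 then 0 else bf \<beta> x)"
    define q where "q = (if c = mat 1 then 0 else bf \<gamma> x)"
    have c: "c *v x = x - q *s \<gamma>" using w(4) by (auto simp: q_def refl_apply)
    have b: "b *v (x - q *s \<gamma>) = x - q *s \<gamma> - p *s \<beta>"
      using w(3) by (auto simp: p_def refl_apply bf_lin f)
    have a: "a *v (x - q *s \<gamma> - p *s \<beta>) = x - q *s \<gamma> - p *s \<beta>"
      using w(2) by (auto simp: refl_apply bf_lin f x)
    have "w *v x = x \<longleftrightarrow> q *s \<gamma> + p *s \<beta> = 0"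
      unfolding w(1) matrix_vector_mul_assoc[symmetric] c b a by (auto simp: algebra_simps)
    also have "\<dots> \<longleftrightarrow> p = 0 \<and> q = 0"
    proof
      assume "q *s \<gamma> + p *s \<beta> = 0"
      then have "bf \<beta> (q *s \<gamma> + p *s \<beta>) = 0" "bf \<gamma> (q *s \<gamma> + p *s \<beta>) = 0" by (simp_all add: bf_def)
      then show "p = 0 \<and> q = 0" by (simp add: bf_lin bfs f)
    qed simp
    finally show ?thesis by (auto simp: p_def q_def)
  qed
  then show ?thesis using hyp_refl[OF f(1)] by (auto simp: fixsp_def)
qed

text \<open>The relations \<open>T\<^sub>w e\<^sub>s = e\<^sub>s\<close> for \<open>w\<close> fixing a noncrossing edge are void: an element centralizing a reflection is a product of
  reflections in its commuting triple, and such products never fix a noncrossing edge.\<close>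

lemma no_noncrossing_fixed_edge:
  assumes w: "w \<in> H3G" and s: "s \<in> H3R" and img: "(\<lambda>x. w *v x) ` hyp s = hyp s"
  shows "\<not> noncrossing_edge (hyp s \<inter> fixsp w)"
proof -
  obtain \<alpha> \<beta> \<gamma> where f: "\<alpha> \<in> roots" "\<beta> \<in> roots" "\<gamma> \<in> roots" "s = reflection \<alpha>"
    "bf \<alpha> \<beta> = 0" "bf \<alpha> \<gamma> = 0" "bf \<beta> \<gamma> = 0"
    "\<And>\<delta>. \<delta> \<in> roots \<Longrightarrow> bf \<alpha> \<delta> = 0 \<Longrightarrow> \<delta> \<in> {\<beta>, - \<beta>, \<gamma>, - \<gamma>}"
    "\<And>x. 2 *s x = bf \<alpha> x *s \<alpha> + bf \<beta> x *s \<beta> + bf \<gamma> x *s \<gamma>"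
    using commclass_frame[OF s] by metis
  have "hyp s \<subseteq> hyp (conj w s)"
  proof
    fix x assume "x \<in> hyp s"
    then obtain y where y: "y \<in> hyp s" "x = w *v y" using img by blast
    then show "x \<in> hyp (conj w s)"
      using hyp_refl[OF f(1)] hyp_refl[OF H3G_roots[OF w f(1)]] conj_refl[OF w] f(4) bf_H3G_invariant[OF w]
      by simp
  qed
  then have "s = conj w s" using hyp_inj s conj_H3R w by blast
  then have com: "w ** reflection \<alpha> = reflection \<alpha> ** w" using conj_eq_iff[OF w] f(4) by metis
  obtain a b c where abc: "a = mat 1 \<or> a = reflection \<alpha>" "b = mat 1 \<or> b = reflection \<beta>" "c = mat 1 \<or> c = reflection \<gamma>"
    "w = a ** (b ** c)"
    using centralizer_eq[OF w com f(1-3) f(5-9)] by blast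
  have E: "hyp s \<inter> fixsp w = {x. bf \<alpha> x = 0 \<and> (b = mat 1 \<or> bf \<beta> x = 0) \<and> (c = mat 1 \<or> bf \<gamma> x = 0)}"
    unfolding f(4) by (rule centralizer_fixsp[OF f(1-3) f(5-7) abc(4) abc(1-3)])
  have nc: "\<not> noncrossing_edge (hyp (reflection \<alpha>) \<inter> hyp (reflection \<delta>))" if "\<delta> \<in> roots" "bf \<alpha> \<delta> = 0" for \<delta>
  proof -
    have "reflection \<alpha> \<noteq> reflection \<delta>"
      using refl_eq_iff[OF f(1) that(1)] that bf_root[OF f(1)] by (auto simp: bf_lin)
    moreover have "reflection \<alpha> ** reflection \<delta> = reflection \<delta> ** reflection \<alpha>"
      using refl_commute_iff[OF f(1) that(1)] that by blast
    ultimately show ?thesis using noncrossing_iff refl_in_H3R f(1) that by blast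
  qed
  show ?thesis
  proof (cases "b = mat 1"; cases "c = mat 1")
    assume "b = mat 1" "c = mat 1"
    then have "hyp s \<inter> fixsp w = hyp s" unfolding E using f(4) hyp_refl[OF f(1)] by simp
    then show ?thesis using not_codim2_edge_hyp[OF s] by (simp add: noncrossing_edge_def)
  next
    assume "b = mat 1" "c \<noteq> mat 1"
    then have "hyp s \<inter> fixsp w = hyp (reflection \<alpha>) \<inter> hyp (reflection \<gamma>)"
      unfolding E hyp_refl[OF f(1)] hyp_refl[OF f(3)] by auto
    then show ?thesis using nc[OF f(3,6)] by simp
  next
    assume "b \<noteq> mat 1" "c = mat 1"
    then have "hyp s \<inter> fixsp w = hyp (reflection \<alpha>) \<inter> hyp (reflection \<beta>)"
      unfolding E hyp_refl[OF f(1)] hyp_refl[OF f(2)] by auto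
    then show ?thesis using nc[OF f(2,5)] by simp
  next
    assume "b \<noteq> mat 1" "c \<noteq> mat 1"
    then have "hyp s \<inter> fixsp w = {x. bf \<alpha> x = 0 \<and> bf \<beta> x = 0 \<and> bf \<gamma> x = 0}" unfolding E by simp
    also have "\<dots> = {0}"
    proof -
      have "x = 0" if "bf \<alpha> x = 0" "bf \<beta> x = 0" "bf \<gamma> x = 0" for x
      proof -
        have "2 *s x = 0" using f(9)[of x] that by simp
        then show ?thesis by (simp add: vec_eq_iff)
      qed
      moreover have "bf x 0 = 0" for x by (simp add: bf_def)
      ultimately show ?thesis by auto
    qed
    finally show ?thesis using not_codim2_edge_zero by (simp add: noncrossing_edge_def)
  qed
qed

text \<open>The columns of a group element are the images of the simple roots, and there are only
  finitely many roots.\<close>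

lemma finite_H3G: "finite H3G"
proof -
  have "finite roots" using roots_subset by (rule finite_subset) simp
  then have "finite {f :: 3 \<Rightarrow> vec3. \<forall>i. f i \<in> roots}"
    using finite_set_of_finite_funs[of "UNIV :: 3 set" roots undefined] by simp
  moreover have "inj_on (\<lambda>w i. w *v axis i 1) H3G"
  proof (rule inj_onI)
    fix v w :: mat3 assume "(\<lambda>i. v *v axis i 1) = (\<lambda>i. w *v axis i 1)"
    then have "v *v axis i 1 = w *v axis i 1" for i by metis
    moreover have "(x *v axis i 1) $ k = x $ k $ i" for x :: mat3 and i k
      by (simp add: matrix_vector_mult_def axis_def if_distrib cong: if_cong)
    ultimately show "v = w" by (metis vec_eq_iff)
  qed
  moreover have "(\<lambda>w i. w *v axis i 1) ` H3G \<subseteq> {f. \<forall>i. f i \<in> roots}"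
    by (auto intro: H3G_roots simple_roots)
  ultimately show ?thesis using finite_imageD finite_subset by blast
qed

lemma finite_H3R: "finite H3R" using finite_subset[OF _ finite_H3G] H3R_in_H3G by blast

section \<open>The free algebra and its matrix representations\<close>

lemma fa_zero_FA: "fa_zero \<in> FA" by (simp add: FA_def fa_zero_def)

lemma fa_smult_FA: "p \<in> FA \<Longrightarrow> fa_smult c p \<in> FA"
proof -
  assume p: "p \<in> FA"
  then have "finite {w. p w \<noteq> 0}" by (simp add: FA_def)
  then have "finite {w. c * p w \<noteq> 0}" by (rule rev_finite_subset) auto
  then show ?thesis using p unfolding FA_def fa_smult_def by simp
qed

lemma fa_add_FA: assumes "p \<in> FA" "q \<in> FA" shows "fa_add p q \<in> FA"
proof -
  have "{w. p w + q w \<noteq> 0} \<subseteq> {w. p w \<noteq> 0} \<union> {w. q w \<noteq> 0}" by auto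
  moreover have "finite ({w. p w \<noteq> 0} \<union> {w. q w \<noteq> 0})" using assms by (simp add: FA_def)
  ultimately have "finite {w. p w + q w \<noteq> 0}" by (rule finite_subset)
  moreover have "p w \<noteq> 0 \<or> q w \<noteq> 0" if "p w + q w \<noteq> 0" for w using that by auto
  ultimately show ?thesis using assms unfolding FA_def fa_add_def by blast
qed

lemma fa_sub_eq: "fa_sub p q = fa_add p (fa_smult (-1) q)"
  by (simp add: fa_sub_def fa_add_def fa_smult_def)

lemma fa_sub_FA: "p \<in> FA \<Longrightarrow> q \<in> FA \<Longrightarrow> fa_sub p q \<in> FA"
  by (simp add: fa_sub_eq fa_add_FA fa_smult_FA)

lemma fa_word_FA: "set u \<subseteq> Gens \<Longrightarrow> fa_word u \<in> FA"
  by (auto simp: FA_def fa_word_def)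

lemma fa_setsum_FA: "finite A \<Longrightarrow> (\<And>i. i \<in> A \<Longrightarrow> f i \<in> FA) \<Longrightarrow> fa_setsum f A \<in> FA"
proof (induction A rule: finite_induct)
  case empty then show ?case using fa_zero_FA by (simp add: fa_setsum_def fa_zero_def)
next
  case (insert x A)
  then have "fa_setsum f (insert x A) = fa_add (f x) (fa_setsum f A)" by (simp add: fa_setsum_def fa_add_def)
  then show ?case using insert by (simp add: fa_add_FA)
qed

text \<open>Induction on the support, splitting off one word at a time; bilinear statements are
  thereby reduced to words.\<close>

lemma FA_induct [consumes 1, case_names zero add]:
  assumes "p \<in> FA" and "P fa_zero"
    and "\<And>c u q. set u \<subseteq> Gens \<Longrightarrow> q \<in> FA \<Longrightarrow> P q \<Longrightarrow> P (fa_add (fa_smult c (fa_word u)) q)"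
  shows "P p"
proof -
  have "\<forall>p. p \<in> FA \<longrightarrow> {w. p w \<noteq> 0} = S \<longrightarrow> P p" if "finite S" for S
    using that
  proof (induction S rule: finite_induct)
    case empty
    have "p = fa_zero" if "{w. p w \<noteq> 0} = {}" for p using that by (auto simp: fa_zero_def)
    then show ?case using assms(2) by blast
  next
    case (insert u S)
    show ?case
    proof (intro allI impI)
      fix p assume p: "p \<in> FA" "{w. p w \<noteq> 0} = insert u S"
      define q where "q = p(u := 0)"
      have s: "{w. q w \<noteq> 0} = S" using p insert(2) unfolding q_def by auto
      then have q: "q \<in> FA" using p insert(1) unfolding FA_def q_def by auto
      have "set u \<subseteq> Gens" using p unfolding FA_def by blast
      moreover have "P q" using insert q s by blast
      moreover have "p = fa_add (fa_smult (p u) (fa_word u)) q"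
        by (auto simp: fa_add_def fa_smult_def fa_word_def q_def)
      ultimately show "P p" using assms(3) q by metis
    qed
  qed
  then show ?thesis using assms(1) unfolding FA_def by blast
qed

lemma fa_mult_add_left: "fa_mult (fa_add p q) r = fa_add (fa_mult p r) (fa_mult q r)"
  by (simp add: fa_mult_def fa_add_def algebra_simps sum.distrib)

lemma fa_mult_add_right: "fa_mult r (fa_add p q) = fa_add (fa_mult r p) (fa_mult r q)"
  by (simp add: fa_mult_def fa_add_def algebra_simps sum.distrib)

lemma fa_mult_smult: "fa_mult (fa_smult c p) r = fa_smult c (fa_mult p r)" "fa_mult p (fa_smult c r) = fa_smult c (fa_mult p r)"
  by (simp_all add: fa_mult_def fa_smult_def algebra_simps sum_distrib_left)

lemma fa_mult_zero: "fa_mult fa_zero p = fa_zero" "fa_mult p fa_zero = fa_zero"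
  by (simp_all add: fa_mult_def fa_zero_def)

lemma fa_mult_word: "fa_mult (fa_word u) (fa_word v) = fa_word (u @ v)"
proof
  fix w
  have "take i w = u \<and> drop i w = v \<longleftrightarrow> i = length u \<and> w = u @ v" if "i \<le> length w" for i
    using that append_take_drop_id[of i w] by auto
  then have "fa_mult (fa_word u) (fa_word v) w = (\<Sum>i\<le>length w. if i = length u \<and> w = u @ v then 1 else 0)"
    unfolding fa_mult_def fa_word_def
    unfolding fa_mult_def fa_word_def by (intro sum.cong refl) auto
  also have "\<dots> = fa_word (u @ v) w" by (auto simp: fa_word_def)
  finally show "fa_mult (fa_word u) (fa_word v) w = fa_word (u @ v) w" .
qed

lemma fa_mult_FA: assumes "p \<in> FA" "q \<in> FA" shows "fa_mult p q \<in> FA"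
  using assms(1)
proof (induction p rule: FA_induct)
  case zero then show ?case by (simp add: fa_mult_zero fa_zero_FA)
next
  case (add c u p)
  have "fa_mult (fa_word u) q \<in> FA"
    using assms(2)
  proof (induction q rule: FA_induct)
    case zero then show ?case by (simp add: fa_mult_zero fa_zero_FA)
  next
    case (add d v q)
    then show ?case using \<open>set u \<subseteq> Gens\<close>
      by (simp add: fa_mult_add_right fa_mult_smult fa_mult_word fa_add_FA fa_smult_FA fa_word_FA)
  qed
  then show ?case using add by (simp add: fa_mult_add_left fa_mult_smult fa_add_FA fa_smult_FA)
qed

lemma matrix_add_mult_distrib: "((A + B) :: complex^'n^'m) ** C = A ** C + B ** C"
  by (simp add: matrix_matrix_mult_def vec_eq_iff distrib_right sum.distrib)

lemma delta_mult:
  fixes c y :: "'a::semiring_0"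
  shows "(if i = k then c else 0) * y = (if k = i then c * y else 0)"
    "y * (if k = j then c else 0) = (if k = j then y * c else 0)"
  by simp_all

lemma mat_mult_left: "mat c ** (A :: 'a::comm_semiring_1^'n^'n) = (\<chi> i j. c * A $ i $ j)"
  by (simp add: matrix_matrix_mult_def mat_def vec_eq_iff delta_mult)

lemma mat_mult_right: "(A :: 'a::comm_semiring_1^'n^'n) ** mat c = (\<chi> i j. c * A $ i $ j)"
  by (simp add: matrix_matrix_mult_def mat_def vec_eq_iff delta_mult mult.commute)

lemma mat_mult_vec: "mat c *v (v :: 'a::comm_semiring_1^'n) = c *s v"
  by (simp add: matrix_vector_mult_def mat_def vec_eq_iff delta_mult)

text \<open>On \<open>complex^'n^'n\<close> the operation \<open>*\<close> is entrywise. A copy of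
  the type makes the matrix product the ring multiplication, so that \<open>prod_list\<close>,
  powers and finite sums apply directly.\<close>

typedef 'n sqm = "UNIV :: (complex^'n^'n) set" by simp

setup_lifting type_definition_sqm

instantiation sqm :: (finite) ring_1
begin
lift_definition zero_sqm :: "'a sqm" is 0 .
lift_definition one_sqm :: "'a sqm" is "mat 1" .
lift_definition plus_sqm :: "'a sqm \<Rightarrow> 'a sqm \<Rightarrow> 'a sqm" is "(+)" .
lift_definition minus_sqm :: "'a sqm \<Rightarrow> 'a sqm \<Rightarrow> 'a sqm" is "(-)" .
lift_definition uminus_sqm :: "'a sqm \<Rightarrow> 'a sqm" is "uminus" .
lift_definition times_sqm :: "'a sqm \<Rightarrow> 'a sqm \<Rightarrow> 'a sqm" is "\<lambda>A B. A ** B" .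
instance
proof
  show "(0::'a sqm) \<noteq> 1"
    by transfer (auto simp: vec_eq_iff mat_def)
qed (transfer; simp add: matrix_mul_assoc matrix_add_ldistrib matrix_add_mult_distrib)+
end

lift_definition scalar :: "complex \<Rightarrow> ('n::finite) sqm" is "mat" .
lift_definition app :: "'n::finite sqm \<Rightarrow> complex^'n \<Rightarrow> complex^'n" is "(*v)" .

lemma scalar_add: "scalar (a + b) = scalar a + scalar b"
  by transfer (simp add: mat_def vec_eq_iff)
lemma scalar_mult: "scalar (a * b) = scalar a * scalar b"
  by transfer (simp add: mat_mult_left, simp add: mat_def vec_eq_iff)
lemma scalar_0: "scalar 0 = 0" by transfer (simp add: mat_def vec_eq_iff)
lemma scalar_1: "scalar 1 = 1" by transfer simp
lemma scalar_minus: "scalar (- a) = - scalar a"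
  by transfer (simp add: mat_def vec_eq_iff)
lemma scalar_comm: "scalar a * x = x * scalar a"
  by transfer (simp add: mat_mult_left mat_mult_right)
lemma scalar_left_comm: "x * (scalar a * y) = scalar a * (x * y)"
  by (metis scalar_comm mult.assoc)

lemma app_mult: "app (A * B) v = app A (app B v)" by transfer (simp add: matrix_vector_mul_assoc)
lemma app_add: "app (A + B) v = app A v + app B v" by transfer (simp add: matrix_vector_mult_add_rdistrib)
lemma app_1: "app 1 v = v" by transfer simp
lemma app_0: "app 0 v = 0" by transfer simp
lemma app_scalar: "app (scalar c) v = c *s v"
  by transfer (simp add: mat_mult_vec)
lemma app_vadd: "app A (v + w) = app A v + app A w" by transfer (simp add: matrix_vector_right_distrib)
lemma app_vsmult: "app A (c *s v) = c *s app A v" by transfer (simp add: vector_scalar_commute)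
lemma sqm_eqI: "(\<And>i. app A (axis i 1) = app B (axis i 1)) \<Longrightarrow> A = B"
proof transfer
  fix A B :: "complex^'a^'a"
  assume a: "\<And>i. A *v axis i 1 = B *v axis i 1"
  have "(x *v axis i 1) $ k = x $ k $ i" for x :: "complex^'a^'a" and i k
    by (simp add: matrix_vector_mult_def axis_def if_distrib cong: if_cong)
  then show "A = B" using a by (metis vec_eq_iff)
qed

section \<open>Evaluating the free algebra in matrices\<close>

definition ev :: "(gen \<Rightarrow> 'n::finite sqm) \<Rightarrow> fa \<Rightarrow> 'n sqm" where
  "ev \<rho> p = (\<Sum>w | p w \<noteq> 0. scalar (p w) * prod_list (map \<rho> w))"

text \<open>A common index set makes the evaluations of two elements and of their sum comparable
  even when coefficients cancel.\<close>

lemma ev_superset: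
  assumes "finite S" "{w. p w \<noteq> 0} \<subseteq> S"
  shows "ev \<rho> p = (\<Sum>w\<in>S. scalar (p w) * prod_list (map \<rho> w))"
  unfolding ev_def by (rule sum.mono_neutral_left) (use assms in \<open>auto simp: scalar_0\<close>)

lemma ev_add: assumes "p \<in> FA" "q \<in> FA" shows "ev \<rho> (fa_add p q) = ev \<rho> p + ev \<rho> q"
proof -
  let ?S = "{w. p w \<noteq> 0} \<union> {w. q w \<noteq> 0}"
  have f: "finite ?S" using assms by (simp add: FA_def)
  show ?thesis
    by (subst (1 2 3) ev_superset[OF f]) (auto simp: fa_add_def scalar_add algebra_simps sum.distrib)
qed

lemma ev_smult: "ev \<rho> (fa_smult c p) = scalar c * ev \<rho> p"
proof (cases "c = 0")
  case True then show ?thesis by (simp add: ev_def fa_smult_def scalar_0)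
next
  case False then show ?thesis by (simp add: ev_def fa_smult_def scalar_mult sum_distrib_left mult.assoc)
qed

lemma ev_zero: "ev \<rho> fa_zero = 0" by (simp add: ev_def fa_zero_def)

lemma ev_sub: "p \<in> FA \<Longrightarrow> q \<in> FA \<Longrightarrow> ev \<rho> (fa_sub p q) = ev \<rho> p - ev \<rho> q"
  by (simp add: fa_sub_eq ev_add ev_smult fa_smult_FA scalar_minus scalar_1)

lemma ev_word: "ev \<rho> (fa_word u) = prod_list (map \<rho> u)"
  by (subst ev_superset[of "{u}"]) (auto simp: fa_word_def scalar_1)

lemma ev_mult: assumes "p \<in> FA" "q \<in> FA" shows "ev \<rho> (fa_mult p q) = ev \<rho> p * ev \<rho> q"
  using assms(1)
proof (induction p rule: FA_induct)
  case zero then show ?case by (simp add: fa_mult_zero ev_zero)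
next
  case (add c u p)
  have "ev \<rho> (fa_mult (fa_word u) q) = prod_list (map \<rho> u) * ev \<rho> q"
    using assms(2)
  proof (induction q rule: FA_induct)
    case zero then show ?case by (simp add: fa_mult_zero ev_zero)
  next
    case (add d v q)
    then show ?case using \<open>set u \<subseteq> Gens\<close>
      by (simp add: fa_mult_add_right fa_mult_smult fa_mult_word fa_smult_FA fa_word_FA fa_mult_FA
          ev_add ev_smult ev_word algebra_simps scalar_left_comm)
  qed
  then show ?case using add assms(2)
    by (simp add: fa_mult_add_left fa_mult_smult fa_smult_FA fa_mult_FA fa_word_FA ev_add ev_smult ev_word
        algebra_simps)
qed

lemma ev_ideal:
  assumes "S \<subseteq> FA" "\<And>p. p \<in> S \<Longrightarrow> ev \<rho> p = 0" "p \<in> ideal_gen S"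
  shows "ev \<rho> p = 0 \<and> p \<in> FA"
  using assms(3)
proof (induction rule: ideal_gen.induct)
  case (base p) then show ?case using assms(1,2) by blast
qed (simp_all add: ev_zero ev_add ev_smult ev_mult fa_zero_FA fa_add_FA fa_smult_FA fa_mult_FA)

section \<open>The regular module\<close>

definition com :: "mat3 \<Rightarrow> mat3 \<Rightarrow> bool" where "com s t \<longleftrightarrow> s ** t = t ** s"

lemma com_sym: "com s t \<Longrightarrow> com t s" by (simp add: com_def)

lemma com_refl: "com s s" by (simp add: com_def)

lemma com_trans': "s \<in> H3R \<Longrightarrow> t \<in> H3R \<Longrightarrow> u \<in> H3R \<Longrightarrow> com s t \<Longrightarrow> com t u \<Longrightarrow> com s u"
  unfolding com_def by (rule com_trans)

lemma commclass_eq_com: "s \<in> H3R \<Longrightarrow> t \<in> H3R \<Longrightarrow> commclass s = commclass t \<longleftrightarrow> com s t"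
  unfolding com_def by (rule commclass_eq_iff)

lemma in_commclass_com: "s \<in> H3R \<Longrightarrow> s \<in> commclass t \<longleftrightarrow> com s t"
  by (simp add: com_def commclass_def)

text \<open>The group element r in \<open>e_s e_t = r e_t = e_s r\<close> for non-commuting s and
  t.\<close>

definition swapper :: "mat3 \<Rightarrow> mat3 \<Rightarrow> mat3" where "swapper s t = (THE r. r \<in> H3R \<and> conj r t = s)"

lemma swapper:
  assumes "s \<in> H3R" "t \<in> H3R" "\<not> com s t"
  shows "Rss s t = {swapper s t}" "swapper s t \<in> H3R" "swapper s t \<in> H3G" "conj (swapper s t) t = s"
    "\<And>r. r \<in> H3R \<Longrightarrow> conj r t = s \<Longrightarrow> r = swapper s t"
proof -
  obtain r where r: "Rss s t = {r}" "r \<in> H3R" "conj r t = s" using Rss_singleton[OF assms(1,2)] assms(3) unfolding com_def by blast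
  have uniq: "q = r" if "q \<in> H3R" "conj q t = s" for q
  proof -
    have "q \<in> Rss s t" using that by (simp add: Rss_def conj_def H3R_inv)
    then show ?thesis using r by simp
  qed
  have e: "swapper s t = r" unfolding swapper_def by (rule the_equality) (use r uniq in \<open>blast+\<close>)
  show "Rss s t = {swapper s t}" "swapper s t \<in> H3R" "swapper s t \<in> H3G" "conj (swapper s t) t = s"
    using r e H3R_in_H3G by simp_all
  show "\<And>r. r \<in> H3R \<Longrightarrow> conj r t = s \<Longrightarrow> r = swapper s t" using uniq e by simp
qed

lemma conj_mult:
  assumes "w \<in> H3G" shows "conj w s ** conj w t = conj w (s ** t)"
  by (simp add: conj_def matrix_mul_assoc[symmetric] H3G_cancel[OF assms])

lemma conj_inj: "w \<in> H3G \<Longrightarrow> conj w s = conj w t \<longleftrightarrow> s = t"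
  by (metis conj_simps(1,2) H3G_inv(1,3))

lemma conj_com_iff: "w \<in> H3G \<Longrightarrow> com (conj w s) (conj w t) \<longleftrightarrow> com s t"
  by (simp add: com_def conj_mult conj_inj)

lemma conj_inv: "w \<in> H3G \<Longrightarrow> conj w (conj (matrix_inv w) s) = s" "w \<in> H3G \<Longrightarrow> conj (matrix_inv w) (conj w s) = s"
  by (metis conj_simps(1,2) H3G_inv)+

lemma conj_self: "s \<in> H3R \<Longrightarrow> conj s s = s"
  by (simp add: conj_def H3R_inv H3R_involution)

lemma conj_commutes: "w \<in> H3G \<Longrightarrow> w ** s = conj w s ** w"
  by (metis conj_eq_iff)

text \<open>Basis of the regular module: \<open>BT w\<close> stands for \<open>w\<close>, \<open>BE {w, w t} t\<close> for \<open>w e\<^sub>t\<close>, and \<open>BP b a\<close>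
  for the common value of \<open>w e\<^sub>i e\<^sub>j\<close> with \<open>i, j\<close> distinct in the class \<open>a\<close> and \<open>w a w\<^sup>-\<^sup>1 = b\<close>.\<close>

datatype bas = BT mat3 | BE "mat3 set" mat3 | BP "mat3 set" "mat3 set"

definition bases :: "bas set" where
  "bases = BT ` H3G \<union> {BE {w, w ** t} t | w t. w \<in> H3G \<and> t \<in> H3R}
     \<union> {BP (commclass s) (commclass t) | s t. s \<in> H3R \<and> t \<in> H3R}"

lemma bases_cases:
  assumes "x \<in> bases"
  obtains (T) w where "w \<in> H3G" "x = BT w"
  | (E) w t where "w \<in> H3G" "t \<in> H3R" "x = BE {w, w ** t} t"
  | (P) b a where "b \<in> H3R" "a \<in> H3R" "x = BP (commclass b) (commclass a)"
  using assms unfolding bases_def by (elim UnE imageE CollectE exE conjE) simp_all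

lemma bases_intros:
  "w \<in> H3G \<Longrightarrow> BT w \<in> bases"
  "w \<in> H3G \<Longrightarrow> t \<in> H3R \<Longrightarrow> BE {w, w ** t} t \<in> bases"
  "s \<in> H3R \<Longrightarrow> t \<in> H3R \<Longrightarrow> BP (commclass s) (commclass t) \<in> bases"
  unfolding bases_def by blast+

lemma finite_bases: "finite bases"
proof -
  have "bases \<subseteq> BT ` H3G \<union> (\<lambda>(w, t). BE {w, w ** t} t) ` (H3G \<times> H3R)
     \<union> (\<lambda>(s, t). BP (commclass s) (commclass t)) ` (H3R \<times> H3R)"
    unfolding bases_def by force
  moreover have "finite \<dots>" using finite_H3G finite_H3R by blast
  ultimately show ?thesis by (rule finite_subset)
qed

text \<open>Since \<open>w e_t = e_u w\<close> with \<open>u = w t w^-1\<close>, this u is the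
  reflection whose generator splits off on the left of \<open>w e_t\<close>. Both elements of the
  coset give the same u, so the choice is harmless.\<close>

definition coset_conj :: "mat3 set \<Rightarrow> mat3 \<Rightarrow> mat3" where
  "coset_conj C t = conj (SOME w. w \<in> C) t"

lemma coset_conj:
  assumes "w \<in> H3G" "t \<in> H3R" shows "coset_conj {w, w ** t} t = conj w t"
proof -
  have "conj (w ** t) t = conj w t"
    using conj_simps(1)[OF assms(1) H3R_in_H3G[OF assms(2)], of t] conj_self[OF assms(2)] by simp
  moreover have "(SOME v. v \<in> {w, w ** t}) \<in> {w, w ** t}" by (rule someI[of _ w]) simp
  ultimately show ?thesis unfolding coset_conj_def by auto
qed

fun tact :: "mat3 \<Rightarrow> bas \<Rightarrow> bas" where
  "tact g (BT w) = BT (g ** w)"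
| "tact g (BE C t) = BE ((\<lambda>v. g ** v) ` C) t"
| "tact g (BP b a) = BP (conj g ` b) a"

text \<open>Left multiplication by \<open>e_s\<close>. On w it gives \<open>w e_t\<close> with
  \<open>t = w^-1 s w\<close>. On \<open>w e_t = e_u w\<close> there are three cases:
  \<open>u = s\<close> leaves the element in place, distinct commuting s and u give a class product,
  and otherwise \<open>e_s e_u = r e_u\<close>. On a class product, either \<open>e_s\<close> is
  already a left factor or a swapper moves the left class to that of s. The scalar \<tau> arises
  exactly when \<open>e_s\<close> meets itself.\<close>

fun eact :: "mat3 \<Rightarrow> bas \<Rightarrow> bas" where
  "eact s (BT w) = BE {w, s ** w} (conj (matrix_inv w) s)"
| "eact s (BE C t) = (if coset_conj C t = s then BE C t
     else if com s (coset_conj C t) then BP (commclass s) (commclass t)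
     else BE ((\<lambda>v. swapper s (coset_conj C t) ** v) ` C) t)"
| "eact s (BP b a) = (if s \<in> b then BP b a else BP (commclass s) a)"

fun ecoef :: "complex \<Rightarrow> mat3 \<Rightarrow> bas \<Rightarrow> complex" where
  "ecoef \<tau> s (BT w) = 1"
| "ecoef \<tau> s (BE C t) = (if coset_conj C t = s then \<tau> else 1)"
| "ecoef \<tau> s (BP b a) = (if s \<in> b then \<tau> else 1)"

lemma tact_BE: "tact g (BE {w, w ** t} t) = BE {g ** w, g ** w ** t} t"
  by (simp add: matrix_mul_assoc)

lemma tact_BP: "g \<in> H3G \<Longrightarrow> b \<in> H3R \<Longrightarrow> tact g (BP (commclass b) a) = BP (commclass (conj g b)) a"
  by (simp add: conj_commclass)

lemma eact_BT: "w \<in> H3G \<Longrightarrow> eact s (BT w) = BE {w, w ** conj (matrix_inv w) s} (conj (matrix_inv w) s)"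
  using conj_commutes[of w "conj (matrix_inv w) s"] by (simp add: conj_inv)

lemma conj_inv_H3R: "w \<in> H3G \<Longrightarrow> s \<in> H3R \<Longrightarrow> conj (matrix_inv w) s \<in> H3R"
  by (simp add: conj_H3R H3G_inv)

text \<open>The basis elements on which \<open>e_s\<close> is already a left factor. They contain
  the image of \<open>eact s\<close>, so an operator identity with right factor \<open>e_s\<close>
  need only be tested on them.\<close>

definition dominated :: "mat3 \<Rightarrow> bas \<Rightarrow> bool" where
  "dominated s y \<longleftrightarrow> (\<exists>w\<in>H3G. \<exists>t\<in>H3R. y = BE {w, w ** t} t \<and> conj w t = s)
     \<or> (\<exists>a\<in>H3R. y = BP (commclass s) (commclass a))"

lemma tact_bases: "g \<in> H3G \<Longrightarrow> x \<in> bases \<Longrightarrow> tact g x \<in> bases"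
  by (erule bases_cases)
    (simp_all add: bases_intros H3G_mult conj_H3R tact_BP tact_BE del: tact.simps(2,3))

lemma eact_dominated:
  assumes s: "s \<in> H3R" and x: "x \<in> bases" shows "dominated s (eact s x)"
  using x
proof (cases rule: bases_cases)
  case (T w)
  then show ?thesis using s conj_inv_H3R[of w s] conj_inv(1)[of w s] eact_BT[of w s] dominated_def by auto
next
  case (E w t)
  note c = coset_conj[OF E(1,2)]
  show ?thesis
  proof (cases "conj w t = s \<or> com s (conj w t)")
    case True
    then show ?thesis using E c s unfolding dominated_def by auto
  next
    case False
    define r where "r = swapper s (conj w t)"
    have "\<not> com s (conj w t)" using False by blast
    then have r: "r \<in> H3G" "conj r (conj w t) = s"
      using swapper(3,4)[OF s conj_H3R[OF E(1,2)]] unfolding r_def by blast+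
    have "eact s x = tact r (BE {w, w ** t} t)" using E c False by (simp add: r_def)
    then have "eact s x = BE {r ** w, r ** w ** t} t" by (simp only: tact_BE)
    moreover have "conj (r ** w) t = s" using r conj_simps(1)[OF r(1) E(1)] by simp
    ultimately show ?thesis using E r H3G_mult unfolding dominated_def by blast
  qed
next
  case (P b a)
  then show ?thesis using in_commclass_iff[OF s P(1)] unfolding dominated_def
    by (cases "s \<in> commclass b") auto
qed

lemma dominated_bases: "s \<in> H3R \<Longrightarrow> dominated s y \<Longrightarrow> y \<in> bases"
  unfolding dominated_def using bases_intros by blast

lemma eact_bases: "s \<in> H3R \<Longrightarrow> x \<in> bases \<Longrightarrow> eact s x \<in> bases"
  using eact_dominated dominated_bases by blast

lemma dominated_fixed:
  assumes "s \<in> H3R" "dominated s y"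
  shows "eact s y = y" "ecoef \<tau> s y = \<tau>" "tact s y = y"
proof -
  consider (E) w t where "w \<in> H3G" "t \<in> H3R" "y = BE {w, w ** t} t" "conj w t = s"
    | (P) a where "a \<in> H3R" "y = BP (commclass s) (commclass a)"
    using assms unfolding dominated_def by blast
  then have "eact s y = y \<and> ecoef \<tau> s y = \<tau> \<and> tact s y = y"
  proof cases
    case E
    have "s ** w = w ** t" using conj_commutes[OF E(1), of t] E(4) by simp
    moreover have "s ** w ** t = w"
      using calculation H3R_involution[OF E(2)] by (metis matrix_mul_assoc matrix_mul_rid)
    ultimately have "tact s y = y" unfolding E(3) tact_BE by (auto simp: insert_commute)
    then show ?thesis using coset_conj[OF E(1,2)] E(3,4) by simp
  next
    case P
    then show ?thesis using assms commclass_self tact_BP[OF H3R_in_H3G[OF assms(1)] assms(1)] conj_self by simp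
  qed
  then show "eact s y = y" "ecoef \<tau> s y = \<tau>" "tact s y = y" by auto
qed

lemma dominated_noncom:
  assumes "s \<in> H3R" "t \<in> H3R" "\<not> com s t" "dominated t y"
  shows "eact s y = tact (swapper s t) y" "ecoef \<tau> s y = 1"
proof -
  have ne: "s \<noteq> t" using assms(3) com_refl by blast
  consider (E) w u where "w \<in> H3G" "u \<in> H3R" "y = BE {w, w ** u} u" "conj w u = t"
    | (P) a where "a \<in> H3R" "y = BP (commclass t) (commclass a)"
    using assms unfolding dominated_def by blast
  then have "eact s y = tact (swapper s t) y \<and> ecoef \<tau> s y = 1"
  proof cases
    case E
    then show ?thesis using coset_conj[OF E(1,2)] assms(3) ne by auto
  next
    case P
    have "s \<notin> commclass t" using assms in_commclass_com by blast
    then show ?thesis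
      unfolding P(2) tact_BP[OF swapper(3)[OF assms(1-3)] assms(2)] swapper(4)[OF assms(1-3)] by simp
  qed
  then show "eact s y = tact (swapper s t) y" "ecoef \<tau> s y = 1" by auto
qed

lemma tact_mult: "g \<in> H3G \<Longrightarrow> h \<in> H3G \<Longrightarrow> tact g (tact h x) = tact (g ** h) x"
  by (cases x) (simp_all add: image_image matrix_mul_assoc conj_simps)

lemma tact_one: "tact (mat 1) x = x"
  using conj_simps(2)[OF H3G.one H3G.one] by (cases x) simp_all

lemma eact_equivariant:
  assumes g: "g \<in> H3G" and s: "s \<in> H3R" and x: "x \<in> bases"
  shows "tact g (eact s x) = eact (conj g s) (tact g x)" "ecoef \<tau> (conj g s) (tact g x) = ecoef \<tau> s x"
proof -
  note gs = conj_H3R[OF g s]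
  have "tact g (eact s x) = eact (conj g s) (tact g x) \<and> ecoef \<tau> (conj g s) (tact g x) = ecoef \<tau> s x"
    using x
  proof (cases rule: bases_cases)
    case (T w)
    have "conj (matrix_inv (g ** w)) (conj g s) = conj (matrix_inv w) s"
      by (metis T(1) conj_inv conj_simps(1) g H3G_mult)
    moreover have "conj g s ** (g ** w) = g ** (s ** w)"
      using conj_commutes[OF g, of s] by (simp add: matrix_mul_assoc)
    ultimately show ?thesis using T by simp
  next
    case (E w t)
    let ?u = "conj w t"
    have u: "?u \<in> H3R" using E conj_H3R by blast
    note c = coset_conj[OF E(1,2)] coset_conj[OF H3G_mult[OF g E(1)] E(2)]
    have gu: "conj (g ** w) t = conj g ?u" using conj_simps(1)[OF g E(1)] by simp
    have "tact g (eact s x) = eact (conj g s) (tact g x)"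
    proof (cases "?u = s \<or> com s ?u")
      case True
      show ?thesis
      proof (cases "?u = s")
        case True then show ?thesis using c gu unfolding E(3) tact_BE by (simp add: matrix_mul_assoc)
      next
        case False
        then have "com s ?u" using True by blast
        then show ?thesis using False c gu conj_com_iff[OF g] conj_inj[OF g] conj_commclass[OF g s]
          unfolding E(3) tact_BE by simp
      qed
    next
      case False
      let ?r = "swapper s ?u"
      have nc: "\<not> com s ?u" using False by blast
      then have r: "?r \<in> H3R" "?r \<in> H3G" "conj ?r ?u = s" using swapper(2-4)[OF s u] by blast+
      \<comment> \<open>Conjugation by \<open>g\<close> transports the swapping reflection;
        uniqueness then identifies it with the swapper of the transported pair.\<close>
      have "conj (conj g ?r) (conj g ?u) = conj g (conj ?r ?u)"
      proof -
        have "conj g ?r ** g = g ** ?r" using conj_commutes[OF g] by metis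
        then show ?thesis
          using conj_simps(1)[OF H3R_in_H3G[OF conj_H3R[OF g r(1)]] g] conj_simps(1)[OF g r(2)] by simp
      qed
      then have "conj g ?r = swapper (conj g s) (conj g ?u)"
        using swapper(5)[OF gs conj_H3R[OF g u] _ conj_H3R[OF g r(1)]] nc conj_com_iff[OF g] r(3) by simp
      then have sw: "swapper (conj g s) (conj g ?u) ** (g ** v) = g ** (?r ** v)" for v :: mat3
        using conj_commutes[OF g, of ?r] by (simp add: matrix_mul_assoc)
      have "conj g ?u \<noteq> conj g s" "\<not> com (conj g s) (conj g ?u)"
        using False conj_com_iff[OF g] conj_inj[OF g] by blast+
      then show ?thesis using False c gu sw unfolding E(3) tact_BE
        by (simp add: matrix_mul_assoc[symmetric])
    qed
    moreover have "ecoef \<tau> (conj g s) (tact g x) = ecoef \<tau> s x"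
      using c gu conj_inj[OF g] unfolding E(3) tact_BE by simp
    ultimately show ?thesis by blast
  next
    case (P b a)
    have "conj g s \<in> conj g ` commclass b \<longleftrightarrow> s \<in> commclass b" using conj_inj[OF g] by auto
    then show ?thesis using P conj_commclass[OF g s] by simp
  qed
  then show "tact g (eact s x) = eact (conj g s) (tact g x)" "ecoef \<tau> (conj g s) (tact g x) = ecoef \<tau> s x"
    by auto
qed

text \<open>Distinct commuting s and t share their class, so both orders end in the same class
  product. The remaining question is whether \<tau> appears equally often.\<close>

lemma eact_commute:
  assumes s: "s \<in> H3R" and t: "t \<in> H3R" and ne: "s \<noteq> t" and st: "com s t" and x: "x \<in> bases"
  shows "eact s (eact t x) = eact t (eact s x) \<and>
    ecoef \<tau> s (eact t x) * ecoef \<tau> t x = ecoef \<tau> t (eact s x) * ecoef \<tau> s x"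
proof -
  have cl: "commclass s = commclass t" using commclass_eq_com s t st by blast
  have mem: "s \<in> commclass s" "t \<in> commclass s" using commclass_self s t cl by auto
  have ts: "com t s" using st by (rule com_sym)
  show ?thesis
    using x
  proof (cases rule: bases_cases)
    case (T w)
    let ?i = "matrix_inv w"
    have i: "?i \<in> H3G" using T H3G_inv by blast
    have "com (conj ?i s) (conj ?i t)" using conj_com_iff[OF i] st by blast
    then have "commclass (conj ?i s) = commclass (conj ?i t)"
      using commclass_eq_com conj_H3R[OF i] s t by blast
    then show ?thesis
      using T eact_BT[OF T(1)] coset_conj[OF T(1) conj_H3R[OF i]] s t ne st ts cl conj_inv(1)[OF T(1)]
      by simp
  next
    case (E w u)
    let ?v = "conj w u"
    have v: "?v \<in> H3R" using E conj_H3R by blast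
    note c = coset_conj[OF E(1,2)]
    show ?thesis
    proof (cases "com s ?v")
      case True
      then have "com t ?v" using com_trans'[OF t s v ts] by blast
      then show ?thesis using True c E cl mem ne st by auto
    next
      case False
      then have F: "\<not> com t ?v" using com_trans'[OF s t v st] by blast
            \<comment> \<open>The inner generator acts through a swapper that turns
              \<open>?v\<close> into \<open>b\<close>; the outer one then meets the commuting
              reflection \<open>b\<close> and creates the class product, with no factor
              \<tau>.\<close>
            have "eact a (eact b x) = BP (commclass a) (commclass u) \<and> ecoef \<tau> a (eact b x) = 1 \<and> ecoef \<tau> b x = 1"
        if ab: "a \<in> H3R" "b \<in> H3R" "a \<noteq> b" "com a b" "\<not> com b ?v" for a b
      proof -
        let ?r = "swapper b ?v"
        have r: "?r \<in> H3G" "conj ?r ?v = b" using swapper(3,4)[OF ab(2) v ab(5)] by blast+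
        have "?v \<noteq> b" using ab(5) com_refl by blast
        then have e: "eact b x = tact ?r x" "ecoef \<tau> b x = 1" using ab c E by simp_all
        have "eact b x = BE {?r ** w, ?r ** w ** u} u"
          using e(1) unfolding E(3) tact_BE .
        moreover have "coset_conj {?r ** w, ?r ** w ** u} u = b"
          using coset_conj[OF H3G_mult[OF r(1) E(1)] E(2)] conj_simps(1)[OF r(1) E(1)] r(2) by simp
        ultimately show ?thesis using ab e by simp
      qed
      from this[OF s t ne st F] this[OF t s ne[symmetric] ts False] show ?thesis using cl by simp
    qed
  next
    case (P b a)
    have "s \<in> commclass b \<longleftrightarrow> t \<in> commclass b"
      using in_commclass_iff[OF s P(1)] in_commclass_iff[OF t P(1)] cl by simp
    then show ?thesis using P cl mem by auto
  qed
qed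

section \<open>Monomial matrices on the module\<close>

typedef bt = bases
  by (rule exI[of _ "BT (mat 1)"]) (rule bases_intros(1)[OF H3G.one])

instance bt :: finite
proof
  have "(UNIV :: bt set) = Abs_bt ` bases" using Abs_bt_cases by auto
  then show "finite (UNIV :: bt set)" using finite_imageI[OF finite_bases, of Abs_bt] by metis
qed

lift_definition monomial :: "('n::finite \<Rightarrow> 'n) \<Rightarrow> ('n \<Rightarrow> complex) \<Rightarrow> 'n sqm" is
  "\<lambda>f c. \<chi> i j. if i = f j then c j else 0" .

lemma app_monomial: "app (monomial f c) (axis j 1) = c j *s axis (f j) 1"
proof transfer
  fix f :: "'a \<Rightarrow> 'a" and c :: "'a \<Rightarrow> complex" and j
  have "(\<Sum>k\<in>UNIV. (if i = f k then c k else 0) * (if k = j then 1 else 0)) = (if i = f j then c j else 0)" for i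
    by (simp add: delta_mult(2))
  then show "(\<chi> i j. if i = f j then c j else 0) *v axis j 1 = c j *s axis (f j) 1"
    by (simp add: matrix_vector_mult_def axis_def vec_eq_iff)
qed

lemma monomial_mult: "monomial f c * monomial g d = monomial (f \<circ> g) (\<lambda>x. c (g x) * d x)"
  by (rule sqm_eqI) (simp add: app_mult app_monomial app_vsmult vec_eq_iff mult.commute)

lemma monomial_scalar: "scalar k * monomial f c = monomial f (\<lambda>x. k * c x)"
  by (rule sqm_eqI) (simp add: app_mult app_monomial app_scalar vec_eq_iff)

text \<open>Maps on \<open>bas\<close> are carried to the index type. Composition is respected when
  the inner map preserves \<open>bases\<close>, the hypothesis of \<open>bmon_mult\<close>.\<close>

definition bmon :: "(bas \<Rightarrow> bas) \<Rightarrow> (bas \<Rightarrow> complex) \<Rightarrow> bt sqm" where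
  "bmon f c = monomial (\<lambda>x. Abs_bt (f (Rep_bt x))) (\<lambda>x. c (Rep_bt x))"

lemma bmon_mult:
  assumes "\<And>x. x \<in> bases \<Longrightarrow> g x \<in> bases"
  shows "bmon f c * bmon g d = bmon (\<lambda>x. f (g x)) (\<lambda>x. c (g x) * d x)"
proof -
  have "Rep_bt (Abs_bt (g (Rep_bt x))) = g (Rep_bt x)" for x
    by (rule Abs_bt_inverse) (rule assms[OF Rep_bt])
  then show ?thesis unfolding bmon_def monomial_mult by (simp add: comp_def)
qed

lemma bmon_cong:
  assumes "\<And>x. x \<in> bases \<Longrightarrow> f x = g x" "\<And>x. x \<in> bases \<Longrightarrow> c x = d x"
  shows "bmon f c = bmon g d"
  unfolding bmon_def by (simp add: assms[OF Rep_bt])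

lemma bmon_id: "bmon (\<lambda>x. x) (\<lambda>_. 1) = 1"
  by (rule sqm_eqI) (simp add: bmon_def app_monomial app_1 Rep_bt_inverse vec_eq_iff)

definition Tm :: "mat3 \<Rightarrow> bt sqm" where "Tm g = bmon (tact g) (\<lambda>_. 1)"
definition Em :: "complex \<Rightarrow> mat3 \<Rightarrow> bt sqm" where "Em \<tau> s = bmon (eact s) (ecoef \<tau> s)"

lemma Tm_mult: "g \<in> H3G \<Longrightarrow> h \<in> H3G \<Longrightarrow> Tm g * Tm h = Tm (g ** h)"
  unfolding Tm_def by (subst bmon_mult, erule (1) tact_bases) (simp add: tact_mult)

lemma Tm_one: "Tm (mat 1) = 1"
proof -
  have "Tm (mat 1) = bmon (\<lambda>x. x) (\<lambda>_. 1)" unfolding Tm_def by (rule bmon_cong) (simp_all add: tact_one)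
  then show ?thesis by (simp add: bmon_id)
qed

lemma Tm_Em:
  assumes "g \<in> H3G" "s \<in> H3R" shows "Tm g * Em \<tau> s = Em \<tau> (conj g s) * Tm g"
proof -
  have "Tm g * Em \<tau> s = bmon (\<lambda>x. tact g (eact s x)) (\<lambda>x. 1 * ecoef \<tau> s x)"
    unfolding Tm_def Em_def by (rule bmon_mult[OF eact_bases[OF assms(2)]])
  also have "\<dots> = bmon (\<lambda>x. eact (conj g s) (tact g x)) (\<lambda>x. ecoef \<tau> (conj g s) (tact g x) * 1)"
    by (rule bmon_cong) (simp_all add: eact_equivariant[OF assms])
  also have "\<dots> = Em \<tau> (conj g s) * Tm g"
    unfolding Tm_def Em_def by (rule bmon_mult[OF tact_bases[OF assms(1)], symmetric])
  finally show ?thesis .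
qed

lemma Tm_Em_self: assumes "s \<in> H3R" shows "Tm s * Em \<tau> s = Em \<tau> s"
proof -
  have "Tm s * Em \<tau> s = bmon (\<lambda>x. tact s (eact s x)) (\<lambda>x. 1 * ecoef \<tau> s x)"
    unfolding Tm_def Em_def by (rule bmon_mult) (rule eact_bases[OF assms])
  also have "\<dots> = Em \<tau> s"
    unfolding Em_def by (rule bmon_cong) (simp_all add: dominated_fixed(3)[OF assms eact_dominated[OF assms]])
  finally show ?thesis .
qed

lemma Em_Tm_self: assumes "s \<in> H3R" shows "Em \<tau> s * Tm s = Em \<tau> s"
  using Tm_Em[OF H3R_in_H3G[OF assms] assms, of \<tau>] unfolding Tm_Em_self[OF assms] conj_self[OF assms] ..

lemma Em_square: assumes "s \<in> H3R" shows "Em \<tau> s * Em \<tau> s = scalar \<tau> * Em \<tau> s"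
proof -
  have "Em \<tau> s * Em \<tau> s = bmon (\<lambda>x. eact s (eact s x)) (\<lambda>x. ecoef \<tau> s (eact s x) * ecoef \<tau> s x)"
    unfolding Em_def by (rule bmon_mult[OF eact_bases[OF assms]])
  also have "\<dots> = bmon (eact s) (\<lambda>x. \<tau> * ecoef \<tau> s x)"
    by (rule bmon_cong) (simp_all add: dominated_fixed[OF assms eact_dominated[OF assms]])
  finally show ?thesis by (simp add: Em_def bmon_def monomial_scalar)
qed

lemma Em_mult: "t \<in> H3R \<Longrightarrow>
    Em \<tau> s * Em \<tau> t = bmon (\<lambda>x. eact s (eact t x)) (\<lambda>x. ecoef \<tau> s (eact t x) * ecoef \<tau> t x)"
  unfolding Em_def by (rule bmon_mult) (rule eact_bases)

lemma Em_commute: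
  assumes "s \<in> H3R" "t \<in> H3R" "com s t" shows "Em \<tau> s * Em \<tau> t = Em \<tau> t * Em \<tau> s"
proof (cases "s = t")
  case False
  show ?thesis unfolding Em_mult[OF assms(1)] Em_mult[OF assms(2)]
    by (rule bmon_cong) (simp_all only: eact_commute[OF assms(1,2) False assms(3)])
qed simp

text \<open>The first identity is tested on the image of \<open>e_t\<close>; the second follows
  because the swapper conjugates \<open>e_t\<close> into \<open>e_s\<close>.\<close>

lemma Em_noncom:
  assumes "s \<in> H3R" "t \<in> H3R" "\<not> com s t"
  shows "Em \<tau> s * Em \<tau> t = Tm (swapper s t) * Em \<tau> t" "Em \<tau> s * Em \<tau> t = Em \<tau> s * Tm (swapper s t)"
proof -
  note r = swapper(2,3,4)[OF assms]
  show 1: "Em \<tau> s * Em \<tau> t = Tm (swapper s t) * Em \<tau> t"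
  proof -
    note d = dominated_noncom[OF assms eact_dominated[OF assms(2)]]
    have "Em \<tau> s * Em \<tau> t = bmon (\<lambda>x. eact s (eact t x)) (\<lambda>x. ecoef \<tau> s (eact t x) * ecoef \<tau> t x)"
      by (rule Em_mult[OF assms(2)])
    also have "\<dots> = bmon (\<lambda>x. tact (swapper s t) (eact t x)) (\<lambda>x. 1 * ecoef \<tau> t x)"
      by (rule bmon_cong) (simp_all only: d)
    also have "\<dots> = Tm (swapper s t) * Em \<tau> t"
      unfolding Em_def Tm_def by (rule bmon_mult[symmetric]) (rule eact_bases[OF assms(2)])
    finally show ?thesis .
  qed
  show "Em \<tau> s * Em \<tau> t = Em \<tau> s * Tm (swapper s t)"
    unfolding 1 Tm_Em[OF r(2) assms(2)] r(3) ..
qed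

fun rho :: "complex \<Rightarrow> gen \<Rightarrow> bt sqm" where
  "rho \<tau> (GT g) = Tm g"
| "rho \<tau> (GE s) = Em \<tau> s"

lemma Gens_simps: "GT g \<in> Gens \<longleftrightarrow> g \<in> H3G" "GE s \<in> Gens \<longleftrightarrow> s \<in> H3R"
  unfolding Gens_def by auto

lemma Tw_FA: "w \<in> H3G \<Longrightarrow> Tw w \<in> FA" and Es_FA: "s \<in> H3R \<Longrightarrow> Es s \<in> FA" and fa_one_FA: "fa_one \<in> FA"
  unfolding fa_one_def by (simp_all add: fa_word_FA Gens_simps)

lemma Rss_H3R: "r \<in> Rss s t \<Longrightarrow> r \<in> H3R" by (simp add: Rss_def)

lemma finite_Rss: "finite (Rss s t)"
  using finite_H3R by (rule rev_finite_subset) (simp add: Rss_def subset_iff)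

lemma setsum_Tw_FA: "fa_setsum Tw (Rss s t) \<in> FA"
  using finite_Rss by (rule fa_setsum_FA) (simp add: Tw_FA Rss_H3R H3R_in_H3G)

lemma fa_setsum_singleton: "fa_setsum f {a} = f a"
  by (simp add: fa_setsum_def)

lemma rels_FA: "rels \<tau> \<subseteq> FA"
proof
  fix p assume "p \<in> rels \<tau>"
  then show "p \<in> FA"
    unfolding rels_def
    by (elim UnE CollectE exE conjE singletonE)
      (simp_all add: fa_sub_FA fa_mult_FA fa_smult_FA Tw_FA Es_FA fa_one_FA setsum_Tw_FA
        H3G_mult H3R_in_H3G conj_H3R H3G.one)
qed

lemma ev_Tw: "ev (rho \<tau>) (Tw w) = Tm w" and ev_Es: "ev (rho \<tau>) (Es s) = Em \<tau> s" and ev_one: "ev (rho \<tau>) fa_one = 1"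
  by (simp_all add: ev_word fa_one_def)

lemma ev_rels:
  assumes "p \<in> rels \<tau>" shows "ev (rho \<tau>) p = 0"
proof -
  note FAs = fa_mult_FA fa_smult_FA Tw_FA Es_FA fa_one_FA H3G_mult H3R_in_H3G conj_H3R H3G.one
  note evs = ev_sub ev_mult ev_smult ev_Tw ev_Es ev_one
  have swap: "\<not> com s t" if "s \<in> H3R" "t \<in> H3R" "s \<noteq> t" "noncrossing_edge (hyp s \<inter> hyp t)" for s t
    using noncrossing_iff[OF that(1-3)] that(4) by (simp add: com_def)
  have tr: "com s t" if "s \<in> H3R" "t \<in> H3R" "transverse s t" for s t
  proof (cases "s = t")
    case False then show ?thesis using transverse_iff[OF that(1,2)] that(3) unfolding com_def by blast
  qed (simp add: com_refl)
  show ?thesis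
    using assms unfolding rels_def
    apply (elim UnE CollectE exE conjE singletonE)
    subgoal by (simp add: evs FAs Tm_mult)
    subgoal by (simp add: evs FAs Tm_one)
    subgoal by (simp add: evs FAs Tm_Em_self)
    subgoal by (simp add: evs FAs Em_Tm_self)
    subgoal using no_noncrossing_fixed_edge by blast
    subgoal using no_noncrossing_fixed_edge by blast
    subgoal by (simp add: evs FAs Em_square)
    subgoal by (simp add: evs FAs Tm_Em)
    subgoal by (simp add: evs FAs Em_commute tr)
    subgoal for s t
      using swapper(1-3)[OF _ _ swap] by (simp add: fa_setsum_singleton evs FAs Em_noncom(1) swap)
    subgoal for s t
      using swapper(1-3)[OF _ _ swap] by (simp add: fa_setsum_singleton evs FAs Em_noncom(2)[symmetric] swap)
    done
qed

lemma ev_BI: "p \<in> BI \<tau> \<Longrightarrow> ev (rho \<tau>) p = 0" and BI_FA: "p \<in> BI \<tau> \<Longrightarrow> p \<in> FA"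
  using ev_ideal[OF rels_FA ev_rels] unfolding BI_def by blast+

section \<open>Rewriting words modulo the relations\<close>

text \<open>The scalar is carried along because reducing a word can produce powers of
  \<tau>.\<close>

definition meq :: "complex \<Rightarrow> gen list \<Rightarrow> complex \<Rightarrow> gen list \<Rightarrow> bool" where
  "meq \<tau> u c v \<longleftrightarrow> fa_sub (fa_word u) (fa_smult c (fa_word v)) \<in> BI \<tau>"

lemma BI_intros:
  "fa_zero \<in> BI \<tau>"
  "p \<in> BI \<tau> \<Longrightarrow> q \<in> BI \<tau> \<Longrightarrow> fa_add p q \<in> BI \<tau>"
  "p \<in> BI \<tau> \<Longrightarrow> fa_smult c p \<in> BI \<tau>"
  "p \<in> BI \<tau> \<Longrightarrow> a \<in> FA \<Longrightarrow> fa_mult a p \<in> BI \<tau>"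
  "p \<in> BI \<tau> \<Longrightarrow> a \<in> FA \<Longrightarrow> fa_mult p a \<in> BI \<tau>"
  unfolding BI_def by (fact ideal_gen.intros)+

lemma meq_refl: "meq \<tau> u 1 u"
proof -
  have "fa_sub (fa_word u) (fa_smult 1 (fa_word u)) = fa_zero" by (simp add: fa_sub_def fa_smult_def fa_zero_def)
  then show ?thesis unfolding meq_def using BI_intros(1) by simp
qed

lemma meq_trans: assumes "meq \<tau> u c v" "meq \<tau> v d w" shows "meq \<tau> u (c * d) w"
proof -
  have "fa_sub (fa_word u) (fa_smult (c * d) (fa_word w)) =
      fa_add (fa_sub (fa_word u) (fa_smult c (fa_word v))) (fa_smult c (fa_sub (fa_word v) (fa_smult d (fa_word w))))"
    by (simp add: fa_sub_def fa_smult_def fa_add_def algebra_simps)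
  then show ?thesis using assms BI_intros(2,3) unfolding meq_def by simp
qed

lemma meq_ctx:
  assumes "meq \<tau> u c v" "set a \<subseteq> Gens" "set b \<subseteq> Gens" shows "meq \<tau> (a @ u @ b) c (a @ v @ b)"
proof -
  have "fa_sub (fa_word (a @ u @ b)) (fa_smult c (fa_word (a @ v @ b))) =
      fa_mult (fa_word a) (fa_mult (fa_sub (fa_word u) (fa_smult c (fa_word v))) (fa_word b))"
    by (simp add: fa_sub_eq fa_mult_add_left fa_mult_add_right fa_mult_smult fa_mult_word)
  then show ?thesis using assms BI_intros(4,5) fa_word_FA unfolding meq_def by simp
qed

abbreviation weq :: "complex \<Rightarrow> gen list \<Rightarrow> gen list \<Rightarrow> bool" where "weq \<tau> u v \<equiv> meq \<tau> u 1 v"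

lemma weq_sym: assumes "weq \<tau> u v" shows "weq \<tau> v u"
proof -
  have "fa_sub (fa_word v) (fa_smult 1 (fa_word u)) = fa_smult (-1) (fa_sub (fa_word u) (fa_smult 1 (fa_word v)))"
    by (simp add: fa_sub_def fa_smult_def)
  then show ?thesis using assms BI_intros(3) unfolding meq_def by simp
qed

lemma weq_trans [trans]: "weq \<tau> u v \<Longrightarrow> weq \<tau> v w \<Longrightarrow> weq \<tau> u w"
  using meq_trans[of \<tau> u 1 v 1 w] by simp

lemma weq_meq_trans [trans]: "weq \<tau> u v \<Longrightarrow> meq \<tau> v c w \<Longrightarrow> meq \<tau> u c w"
  using meq_trans[of \<tau> u 1 v c w] by simp

lemma meq_weq_trans [trans]: "meq \<tau> u c v \<Longrightarrow> weq \<tau> v w \<Longrightarrow> meq \<tau> u c w"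
  using meq_trans[of \<tau> u c v 1 w] by simp

lemma meq_Cons: "meq \<tau> u c v \<Longrightarrow> g \<in> Gens \<Longrightarrow> meq \<tau> (g # u) c (g # v)"
  using meq_ctx[of \<tau> u c v "[g]" "[]"] by simp

lemma meq_append: "meq \<tau> u c v \<Longrightarrow> set b \<subseteq> Gens \<Longrightarrow> meq \<tau> (u @ b) c (v @ b)"
  using meq_ctx[of \<tau> u c v "[]" b] by simp

lemma rel_meq: "fa_sub (fa_word u) (fa_smult c (fa_word v)) \<in> rels \<tau> \<Longrightarrow> meq \<tau> u c v"
  unfolding meq_def BI_def by (rule ideal_gen.base)

lemma fa_smult_1: "fa_smult 1 p = p" by (simp add: fa_smult_def)

lemma word2: "fa_mult (fa_word [a]) (fa_word [b]) = fa_word [a, b]" by (simp add: fa_mult_word)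

text \<open>The relations are a left-nested union of eleven families; here and below, each chain of
  injections selects one of them.\<close>

lemma weq_TT: "g \<in> H3G \<Longrightarrow> h \<in> H3G \<Longrightarrow> weq \<tau> [GT g, GT h] [GT (g ** h)]"
  by (rule rel_meq, unfold fa_smult_1 word2[symmetric] rels_def, rule UnI1, rule UnI1, rule UnI1, rule UnI1, rule UnI1, rule UnI1, rule UnI1, rule UnI1, rule UnI1, rule UnI1) blast

lemma weq_T1: "weq \<tau> [GT (mat 1)] []"
  by (rule rel_meq, unfold fa_smult_1 fa_one_def[symmetric] rels_def, rule UnI1, rule UnI1, rule UnI1, rule UnI1, rule UnI1, rule UnI1, rule UnI1, rule UnI1, rule UnI1, rule UnI2) blast

lemma weq_TE_self: "s \<in> H3R \<Longrightarrow> weq \<tau> [GT s, GE s] [GE s]"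
  by (rule rel_meq, unfold fa_smult_1 word2[symmetric] rels_def, rule UnI1, rule UnI1, rule UnI1, rule UnI1, rule UnI1, rule UnI1, rule UnI1, rule UnI1, rule UnI2) blast

lemma meq_EE: "s \<in> H3R \<Longrightarrow> meq \<tau> [GE s, GE s] \<tau> [GE s]"
  by (rule rel_meq, unfold fa_smult_1 word2[symmetric] rels_def, rule UnI1, rule UnI1, rule UnI1, rule UnI1, rule UnI2) blast

lemma weq_TE: "w \<in> H3G \<Longrightarrow> s \<in> H3R \<Longrightarrow> weq \<tau> [GT w, GE s] [GE (conj w s), GT w]"
  by (rule rel_meq, unfold fa_smult_1 word2[symmetric] rels_def, rule UnI1, rule UnI1, rule UnI1, rule UnI2) blast

lemma weq_ET: assumes "w \<in> H3G" "s \<in> H3R" shows "weq \<tau> [GE s, GT w] [GT w, GE (conj (matrix_inv w) s)]"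
  using weq_sym[OF weq_TE[OF assms(1) conj_inv_H3R[OF assms]]] conj_inv(1)[OF assms(1)] by simp

lemma weq_EE_com:
  assumes "s \<in> H3R" "t \<in> H3R" "com s t" shows "weq \<tau> [GE s, GE t] [GE t, GE s]"
proof (cases "s = t")
  case True then show ?thesis using meq_refl by simp
next
  case False
  then have tr: "transverse s t" using transverse_iff assms unfolding com_def by blast
  show ?thesis
    by (rule rel_meq, unfold fa_smult_1 word2[symmetric] rels_def, rule UnI1, rule UnI1, rule UnI2, use assms tr in blast)
qed

lemma weq_EE_noncom:
  assumes "s \<in> H3R" "t \<in> H3R" "\<not> com s t"
  shows "weq \<tau> [GE s, GE t] [GT (swapper s t), GE t]" "weq \<tau> [GE s, GE t] [GE s, GT (swapper s t)]"
proof -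
  have ne: "s \<noteq> t" using assms(3) com_refl by blast
  then have nc: "noncrossing_edge (hyp s \<inter> hyp t)" using noncrossing_iff assms unfolding com_def by blast
  have sum: "fa_setsum Tw (Rss s t) = Tw (swapper s t)"
    unfolding swapper(1)[OF assms] by (rule fa_setsum_singleton)
  have "fa_sub (fa_mult (Es s) (Es t)) (fa_mult (fa_setsum Tw (Rss s t)) (Es t)) \<in> rels \<tau>"
    "fa_sub (fa_mult (Es s) (Es t)) (fa_mult (Es s) (fa_setsum Tw (Rss s t))) \<in> rels \<tau>"
    unfolding rels_def
    by (rule UnI1, rule UnI2, use assms ne nc in blast, rule UnI2, use assms ne nc in blast)
  then show "weq \<tau> [GE s, GE t] [GT (swapper s t), GE t]" "weq \<tau> [GE s, GE t] [GE s, GT (swapper s t)]"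
    unfolding sum by (auto intro!: rel_meq simp: fa_smult_1 word2)
qed

lemma weq_TT_list: "g \<in> H3G \<Longrightarrow> h \<in> H3G \<Longrightarrow> set u \<subseteq> Gens \<Longrightarrow> weq \<tau> (GT g # GT h # u) (GT (g ** h) # u)"
  using meq_append[OF weq_TT] by fastforce

lemma weq_T1_list: "set u \<subseteq> Gens \<Longrightarrow> weq \<tau> (GT (mat 1) # u) u"
  using meq_append[OF weq_T1] by fastforce

text \<open>For \<open>s\<close> outside the class of \<open>i, j\<close>, evaluating \<open>e\<^sub>s e\<^sub>i e\<^sub>j = e\<^sub>s e\<^sub>j e\<^sub>i\<close> in two ways shows that
  \<open>swapper s i\<close> and \<open>swapper s j\<close> act equally on \<open>e\<^sub>i e\<^sub>j\<close>.\<close>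

context
  fixes \<tau> :: complex and i j s :: mat3
  assumes R: "i \<in> H3R" "j \<in> H3R" "s \<in> H3R" and ij: "com i j" and si: "\<not> com s i"
begin

lemma sj: "\<not> com s j"
  using com_trans'[OF R(3,2,1) _ com_sym[OF ij]] si by blast

lemma swappers_act_equally:
  "weq \<tau> [GT (swapper s i), GE i, GE j] [GT (swapper s j), GE i, GE j]"
proof -
  note g = Gens_simps R
  have "weq \<tau> [GT (swapper s i), GE i, GE j] [GE s, GE i, GE j]"
    using meq_append[OF weq_sym[OF weq_EE_noncom(1)[OF R(3,1) si]], of "[GE j]"] g by simp
  also have "weq \<tau> \<dots> [GE s, GE j, GE i]"
    using meq_Cons[OF weq_EE_com[OF R(1,2) ij]] g by simp
  also have "weq \<tau> \<dots> [GT (swapper s j), GE j, GE i]"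
    using meq_append[OF weq_EE_noncom(1)[OF R(3,2) sj], of "[GE i]"] g by simp
  also have "weq \<tau> \<dots> [GT (swapper s j), GE i, GE j]"
    using meq_Cons[OF weq_sym[OF weq_EE_com[OF R(1,2) ij]]] swapper(3)[OF R(3,2) sj] g by simp
  finally show ?thesis .
qed

lemma swapper_sym: "\<not> com s t \<Longrightarrow> t \<in> H3R \<Longrightarrow> swapper t s = swapper s t"
proof -
  assume t: "\<not> com s t" "t \<in> H3R"
  note r = swapper(2,3,4)[OF R(3) t(2,1)]
  have "conj (swapper s t) s = t"
    using conj_inv(2)[OF r(2), of t] H3R_inv[OF r(1)] r(3) by simp
  then show ?thesis using swapper(5)[OF t(2) R(3) _ r(1)] t(1) com_sym by metis
qed

text \<open>Mirror image of \<open>swappers_act_equally\<close>: the relation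
  \<open>e_i e_s = e_i r\<close> is used on the right, and one swapper serves both orders of its
  arguments.\<close>

lemma swappers_act_equally_right:
  "weq \<tau> [GE i, GE j, GT (swapper s j)] [GE i, GE j, GT (swapper s i)]"
proof -
  note g = Gens_simps R
  have si': "\<not> com i s" and sj': "\<not> com j s" using si sj com_sym by blast+
  have "weq \<tau> [GE i, GE j, GT (swapper s j)] [GE i, GE j, GE s]"
    using meq_Cons[OF weq_sym[OF weq_EE_noncom(2)[OF R(2,3) sj']]] swapper_sym[OF sj R(2)] g by simp
  also have "weq \<tau> \<dots> [GE j, GE i, GE s]"
    using meq_append[OF weq_EE_com[OF R(1,2) ij], of "[GE s]"] g by simp
  also have "weq \<tau> \<dots> [GE j, GE i, GT (swapper s i)]"
    using meq_Cons[OF weq_EE_noncom(2)[OF R(1,3) si']] swapper_sym[OF si R(1)] g by simp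
  also have "weq \<tau> \<dots> [GE i, GE j, GT (swapper s i)]"
    using meq_append[OF weq_sym[OF weq_EE_com[OF R(1,2) ij]], of "[GT (swapper s i)]"]
      swapper(3)[OF R(3,1) si] g by simp
  finally show ?thesis .
qed

text \<open>The swapper of s and j carries j to s, and that of s and i carries s to i, so the
  product carries j to i. Since the two involutions act alike on \<open>e_i e_j\<close>, their
  product acts trivially there.\<close>

definition "rot = swapper s i ** swapper s j"

lemma rot: "rot \<in> H3G" "conj rot j = i" "matrix_inv rot = swapper s j ** swapper s i"
proof -
  note a = swapper(2,3,4)[OF R(3,1) si] and b = swapper(2,3,4)[OF R(3,2) sj]
  show "rot \<in> H3G" using a b H3G_mult rot_def by simp
  have ai: "conj (swapper s i) s = i"
    using conj_inv(2)[OF a(2), of i] H3R_inv[OF a(1)] a(3) by simp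
  show "conj rot j = i"
    unfolding rot_def using conj_simps(1)[OF a(2) b(2), of j] ai b(3) by simp
  show "matrix_inv rot = swapper s j ** swapper s i"
    unfolding rot_def
  proof (rule matrix_inv_unique)
    have "swapper s i ** swapper s j ** (swapper s j ** swapper s i)
        = swapper s i ** (swapper s j ** swapper s j) ** swapper s i" by (simp add: matrix_mul_assoc)
    then show "swapper s i ** swapper s j ** (swapper s j ** swapper s i) = mat 1"
      by (simp add: H3R_involution[OF a(1)] H3R_involution[OF b(1)])
    have "swapper s j ** swapper s i ** (swapper s i ** swapper s j)
        = swapper s j ** (swapper s i ** swapper s i) ** swapper s j" by (simp add: matrix_mul_assoc)
    then show "swapper s j ** swapper s i ** (swapper s i ** swapper s j) = mat 1"
      by (simp add: H3R_involution[OF a(1)] H3R_involution[OF b(1)])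
  qed
qed

lemma rot_fixes: "weq \<tau> [GT rot, GE i, GE j] [GE i, GE j]"
proof -
  note a = swapper(2,3)[OF R(3,1) si] and b = swapper(2,3)[OF R(3,2) sj]
  note g = Gens_simps R a b rot(1)
  have "weq \<tau> [GT rot, GE i, GE j] [GT (swapper s i), GT (swapper s j), GE i, GE j]"
    using weq_sym[OF weq_TT_list[OF a(2) b(2), of "[GE i, GE j]"]] rot_def g by simp
  also have "weq \<tau> \<dots> [GT (swapper s i), GT (swapper s i), GE i, GE j]"
    using meq_Cons[OF weq_sym[OF swappers_act_equally]] g by simp
  also have "weq \<tau> \<dots> [GT (mat 1), GE i, GE j]"
    using weq_TT_list[OF a(2) a(2), of "[GE i, GE j]"] H3R_involution[OF a(1)] g by simp
  also have "weq \<tau> \<dots> [GE i, GE j]"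
    using weq_T1_list[of "[GE i, GE j]"] g by simp
  finally show ?thesis .
qed

lemma rot_fixes_right: "weq \<tau> [GE i, GE j, GT (matrix_inv rot)] [GE i, GE j]"
proof -
  note a = swapper(2,3)[OF R(3,1) si] and b = swapper(2,3)[OF R(3,2) sj]
  note g = Gens_simps R a b
  have "weq \<tau> [GE i, GE j, GT (matrix_inv rot)] [GE i, GE j, GT (swapper s j), GT (swapper s i)]"
    using meq_ctx[OF weq_sym[OF weq_TT[OF b(2) a(2)]], of "[GE i, GE j]" "[]"] rot(3) g by simp
  also have "weq \<tau> \<dots> [GE i, GE j, GT (swapper s i), GT (swapper s i)]"
    using meq_append[OF swappers_act_equally_right, of "[GT (swapper s i)]"] g by simp
  also have "weq \<tau> \<dots> [GE i, GE j, GT (mat 1)]"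
    using meq_ctx[OF weq_TT[OF a(2) a(2)], of "[GE i, GE j]" "[]"] H3R_involution[OF a(1)] g by simp
  also have "weq \<tau> \<dots> [GE i, GE j]"
    using meq_ctx[OF weq_T1, of "[GE i, GE j]" "[]"] g by simp
  finally show ?thesis .
qed

text \<open>Inserting \<open>rot\<close> on the left and its inverse on the right changes nothing,
  while conjugation renames the two reflections.\<close>

lemma rot_conjugates: "weq \<tau> [GE i, GE j] [GE (conj rot i), GE i]"
proof -
  note g = Gens_simps R rot(1) conj_H3R[OF rot(1)] H3G_inv(1)[OF rot(1)]
  have "weq \<tau> [GE i, GE j] [GE i, GE j, GT (matrix_inv rot)]" by (rule weq_sym[OF rot_fixes_right])
  also have "weq \<tau> \<dots> [GT rot, GE i, GE j, GT (matrix_inv rot)]"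
    using meq_append[OF weq_sym[OF rot_fixes], of "[GT (matrix_inv rot)]"] g by simp
  also have "weq \<tau> \<dots> [GE (conj rot i), GT rot, GE j, GT (matrix_inv rot)]"
    using meq_append[OF weq_TE[OF rot(1) R(1)], of "[GE j, GT (matrix_inv rot)]"] g by simp
  also have "weq \<tau> \<dots> [GE (conj rot i), GE i, GT rot, GT (matrix_inv rot)]"
    using meq_ctx[OF weq_TE[OF rot(1) R(2)], of "[GE (conj rot i)]" "[GT (matrix_inv rot)]"] rot(2) g by simp
  also have "weq \<tau> \<dots> [GE (conj rot i), GE i, GT (mat 1)]"
    using meq_ctx[OF weq_TT[OF rot(1) H3G_inv(1)[OF rot(1)]], of "[GE (conj rot i), GE i]" "[]"]
      H3G_inv(2)[OF rot(1)] g by simp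
  also have "weq \<tau> \<dots> [GE (conj rot i), GE i]"
    using meq_ctx[OF weq_T1, of "[GE (conj rot i), GE i]" "[]"] g by simp
  finally show ?thesis .
qed

end

lemma exists_noncom:
  assumes "i \<in> H3R" obtains s where "s \<in> H3R" "\<not> com s i"
proof -
  obtain \<alpha> where a: "\<alpha> \<in> roots" "i = reflection \<alpha>" using assms unfolding H3R_eq by blast
  obtain \<delta> where d: "\<delta> \<in> roots" "bf \<alpha> \<delta> = 1" using root_bf_one[OF a(1)] by blast
  have "\<delta> \<noteq> \<alpha>" "\<delta> \<noteq> - \<alpha>" using d bf_root[OF a(1)] by (auto simp: bf_lin)
  then have "\<not> com i (reflection \<delta>)" unfolding com_def a(2) using refl_commute_iff[OF a(1) d(1)] d(2) by auto
  then show ?thesis using that refl_in_H3R[OF d(1)] com_sym by blast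
qed

lemma com_iff_class: "i \<in> H3R \<Longrightarrow> commclass i = {i, j, k} \<Longrightarrow> com i j \<and> com i k \<and> j \<in> H3R \<and> k \<in> H3R"
proof -
  assume i: "i \<in> H3R" and cl: "commclass i = {i, j, k}"
  have "x \<in> H3R \<and> com i x" if "x \<in> commclass i" for x
    using that by (simp add: commclass_def com_def)
  then show ?thesis using cl by blast
qed

text \<open>The element \<open>rot\<close> permutes the triple cyclically: if it exchanged \<open>i\<close> and \<open>j\<close>, it would centralize
  the third reflection and hence the whole triple.\<close>

lemma conj_rot_third:
  assumes R: "i \<in> H3R" "s \<in> H3R" and si: "\<not> com s i"
    and cl: "commclass i = {i, j, k}" and d: "i \<noteq> j" "i \<noteq> k" "j \<noteq> k"
  shows "conj (rot i j s) i = k \<and> conj (rot i j s) k = j"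
proof -
  have c: "com i j" "com i k" "j \<in> H3R" "k \<in> H3R" using com_iff_class[OF R(1) cl] by auto
  define u where "u = rot i j s"
  note u = rot(1,2)[OF R(1) c(3) R(2) c(1) si, folded u_def]
  have img: "conj u ` {i, j, k} = {i, j, k}"
  proof -
    have "commclass j = commclass i" using commclass_eq_com[OF c(3) R(1)] com_sym[OF c(1)] by blast
    then have "conj u ` commclass i = commclass i"
      using conj_commclass[OF u(1) c(3)] u(2) by simp
    then show ?thesis using cl by simp
  qed
  have i: "conj u i \<in> {i, j, k}" and k: "conj u k \<in> {i, j, k}" using img by blast+
  have ni: "conj u i \<noteq> i" using conj_inj[OF u(1), of i j] u(2) d by auto
  have nk: "conj u k \<noteq> i" using conj_inj[OF u(1), of k j] u(2) d by auto
  have nik: "conj u i \<noteq> conj u k" using conj_inj[OF u(1), of i k] d by auto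
  have "conj u k \<noteq> k"
  proof
    assume "conj u k = k"
    then have "u ** k = k ** u" using conj_eq_iff[OF u(1)] by blast
    moreover have "i \<in> commclass k" using in_commclass_com[OF R(1)] c by blast
    ultimately have "u ** i = i ** u" using centralizer_commclass[OF c(4) _ u(1)] by blast
    then have "conj u i = i" using conj_eq_iff[OF u(1)] by blast
    then show False using ni by blast
  qed
  then have "conj u k = j" using k nk by blast
  moreover from this have "conj u i = k" using i ni nik by auto
  ultimately show ?thesis by (simp add: u_def)
qed

lemma triple_third:
  assumes "i \<in> H3R" "j \<in> H3R" "com i j" "i \<noteq> j"
  obtains k where "commclass i = {i, j, k}" "i \<noteq> k" "j \<noteq> k" "com i k" "k \<in> H3R"
proof -
  obtain p q where pq: "commclass i = {i, p, q}" "i \<noteq> p" "i \<noteq> q" "p \<noteq> q" using H3R_triple[OF assms(1)] by metis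
  have "j \<in> commclass i" using in_commclass_com[OF assms(2)] com_sym[OF assms(3)] by blast
  then have "j = p \<or> j = q" using pq assms(4) by auto
  then have "\<exists>k. commclass i = {i, j, k} \<and> i \<noteq> k \<and> j \<noteq> k"
    using pq by (elim disjE) (auto simp: insert_commute)
  then show ?thesis using that com_iff_class[OF assms(1)] by metis
qed

text \<open>As \<open>rot\<close> sends i, j to k, i, conjugation reads
  \<open>e_i e_j = e_k e_i\<close>.\<close>

lemma weq_pair_next:
  assumes "i \<in> H3R" "commclass i = {i, j, k}" "i \<noteq> j" "i \<noteq> k" "j \<noteq> k"
  shows "weq \<tau> [GE i, GE j] [GE i, GE k]"
proof -
  have c: "com i j" "com i k" "j \<in> H3R" "k \<in> H3R" using com_iff_class[OF assms(1,2)] by auto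
  obtain s where s: "s \<in> H3R" "\<not> com s i" using exists_noncom[OF assms(1)] by blast
  have "conj (rot i j s) i = k" using conj_rot_third[OF assms(1) s assms(2-5)] by simp
  then have "weq \<tau> [GE i, GE j] [GE k, GE i]"
    using rot_conjugates[OF assms(1) c(3) s(1) c(1) s(2)] by simp
  also have "weq \<tau> \<dots> [GE i, GE k]" by (rule weq_EE_com[OF c(4) assms(1) com_sym[OF c(2)]])
  finally show ?thesis .
qed

text \<open>Replacing the second index by the third member, at i and at j, combined with
  commutation, reaches all six ordered pairs of the class.\<close>

lemma weq_pair:
  assumes "i \<in> H3R" "j \<in> commclass i" "i' \<in> commclass i" "j' \<in> commclass i" "i \<noteq> j" "i' \<noteq> j'"
  shows "weq \<tau> [GE i, GE j] [GE i', GE j']"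
proof -
  have R: "j \<in> H3R" "i' \<in> H3R" "j' \<in> H3R" using assms by (auto simp: commclass_def)
  have ij: "com i j" using assms in_commclass_com[OF R(1)] com_sym by blast
  obtain k where k: "commclass i = {i, j, k}" "i \<noteq> k" "j \<noteq> k" "com i k" "k \<in> H3R"
    using triple_third[OF assms(1) R(1) ij assms(5)] by metis
  have cj: "commclass j = {j, i, k}" "commclass j = {j, k, i}"
    and ck: "commclass k = {k, i, j}" "commclass k = {k, j, i}" "commclass i = {i, k, j}"
    using commclass_eq_com[OF R(1) assms(1)] commclass_eq_com[OF k(5) assms(1)] k(1) ij k(4) com_sym
    by (auto simp: insert_commute)
  note n = assms(5) k(2,3) assms(5)[symmetric] k(2,3)[symmetric]
  have sw: "weq \<tau> [GE a, GE b] [GE b, GE a]" if "a \<in> {i, j, k}" "b \<in> {i, j, k}" for a b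
  proof -
    have "a \<in> H3R" "b \<in> H3R" "com a b"
      using that assms(1) R(1) k(4,5) ij com_refl com_sym com_trans'[OF R(1) assms(1) k(5)] by auto
    then show ?thesis by (rule weq_EE_com)
  qed
  have ik: "weq \<tau> [GE i, GE j] [GE i, GE k]" by (rule weq_pair_next[OF assms(1) k(1) n(1,2,3)])
  have ji: "weq \<tau> [GE i, GE j] [GE j, GE i]" by (rule sw) auto
  have ki: "weq \<tau> [GE i, GE j] [GE k, GE i]" by (rule weq_trans[OF ik]) (rule sw, auto)
  have jk: "weq \<tau> [GE i, GE j] [GE j, GE k]"
    by (rule weq_trans[OF ji weq_pair_next[OF R(1) cj(1)]]) (use n in auto)
  have kj: "weq \<tau> [GE i, GE j] [GE k, GE j]" by (rule weq_trans[OF jk]) (rule sw, auto)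
  show ?thesis
    using assms(3,4,6) meq_refl[of \<tau> "[GE i, GE j]"] ik ji ki jk kj unfolding k(1) by auto
qed

definition fixes_pair :: "complex \<Rightarrow> mat3 \<Rightarrow> mat3 \<Rightarrow> mat3 \<Rightarrow> bool" where
  "fixes_pair \<tau> i j w \<longleftrightarrow> w \<in> H3G \<and> weq \<tau> [GT w, GE i, GE j] [GE i, GE j]"

lemma fixes_pair_mult:
  assumes "i \<in> H3R" "j \<in> H3R" "fixes_pair \<tau> i j v" "fixes_pair \<tau> i j w"
  shows "fixes_pair \<tau> i j (v ** w)"
proof -
  have g: "v \<in> H3G" "w \<in> H3G" "set [GE i, GE j] \<subseteq> Gens" using assms unfolding fixes_pair_def by (auto simp: Gens_simps)
  have "weq \<tau> (GT (v ** w) # [GE i, GE j]) (GT v # GT w # [GE i, GE j])"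
    by (rule weq_sym[OF weq_TT_list[OF g]])
  also have "weq \<tau> \<dots> (GT v # [GE i, GE j])"
    using meq_Cons assms(4) g(1) unfolding fixes_pair_def by (simp add: Gens_simps)
  also have "weq \<tau> \<dots> [GE i, GE j]" using assms(3) unfolding fixes_pair_def by simp
  finally show ?thesis using g H3G_mult unfolding fixes_pair_def by blast
qed

lemma fixes_pair_one: "i \<in> H3R \<Longrightarrow> j \<in> H3R \<Longrightarrow> fixes_pair \<tau> i j (mat 1)"
  unfolding fixes_pair_def using weq_T1_list[of "[GE i, GE j]"] H3G.one by (simp add: Gens_simps)

lemma fixes_pair_inv:
  assumes "i \<in> H3R" "j \<in> H3R" "fixes_pair \<tau> i j w"
  shows "fixes_pair \<tau> i j (matrix_inv w)"
proof -
  have g: "w \<in> H3G" "matrix_inv w \<in> H3G" "set [GE i, GE j] \<subseteq> Gens"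
    using assms H3G_inv unfolding fixes_pair_def by (auto simp: Gens_simps)
  have "weq \<tau> (GT (matrix_inv w) # [GE i, GE j]) (GT (matrix_inv w) # GT w # [GE i, GE j])"
    using meq_Cons[OF weq_sym] assms(3) g(2) unfolding fixes_pair_def by (simp add: Gens_simps)
  also have "weq \<tau> \<dots> (GT (mat 1) # [GE i, GE j])"
    using weq_TT_list[OF g(2,1,3)] H3G_inv(3)[OF g(1)] by simp
  also have "weq \<tau> \<dots> [GE i, GE j]" by (rule weq_T1_list[OF g(3)])
  finally show ?thesis using g unfolding fixes_pair_def by simp
qed

text \<open>\<open>rot\<close> and i generate the stabilizer. Conjugating i by \<open>rot\<close>
  gives k and then j, hence the whole centralizer of i; a general stabilizing element falls into
  that centralizer after multiplication by \<open>rot\<close> or its inverse, according to the image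
  of i.\<close>

lemma stab_fixes_pair:
  assumes R: "i \<in> H3R" "j \<in> H3R" and ij: "com i j" "i \<noteq> j"
    and w: "w \<in> H3G" "conj w ` commclass i = commclass i"
  shows "fixes_pair \<tau> i j w"
proof -
  obtain k where k: "commclass i = {i, j, k}" "i \<noteq> k" "j \<noteq> k" "com i k" "k \<in> H3R"
    using triple_third[OF R ij] by metis
  obtain s where s: "s \<in> H3R" "\<not> com s i" using exists_noncom[OF R(1)] by blast
  define u where "u = rot i j s"
  note u = rot(1,2)[OF R s(1) ij(1) s(2), folded u_def]
  have uc: "conj u i = k" "conj u k = j"
    using conj_rot_third[OF R(1) s k(1) ij(2) k(2,3)] by (simp_all add: u_def)
  have fu: "fixes_pair \<tau> i j u"
    using rot_fixes[OF R s(1) ij(1) s(2)] u(1) unfolding fixes_pair_def u_def by blast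
  have fi: "fixes_pair \<tau> i j i"
    using meq_append[OF weq_TE_self[OF R(1)], of "[GE j]"] R H3R_in_H3G unfolding fixes_pair_def
    by (simp add: Gens_simps)
  have fui: "fixes_pair \<tau> i j (matrix_inv u)" by (rule fixes_pair_inv[OF R fu])
  have fk: "fixes_pair \<tau> i j k"
    using fixes_pair_mult[OF R fixes_pair_mult[OF R fu fi] fui] uc(1) unfolding conj_def by simp
  have fj: "fixes_pair \<tau> i j j"
    using fixes_pair_mult[OF R fixes_pair_mult[OF R fu fk] fui] uc(2) unfolding conj_def by simp
  have cent: "fixes_pair \<tau> i j v" if v: "v \<in> H3G" "conj v i = i" for v
  proof -
    obtain p q where pq: "commclass i = {i, p, q}"
      "\<And>w. w \<in> H3G \<Longrightarrow> w ** i = i ** w \<Longrightarrow> \<exists>a\<in>{mat 1, i}. \<exists>b\<in>{mat 1, p}. \<exists>c\<in>{mat 1, q}. w = a ** (b ** c)"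
      using H3R_triple[OF R(1)] by metis
    have "v ** i = i ** v" using conj_eq_iff[OF v(1)] v(2) by blast
    then obtain a b c where abc: "a \<in> {mat 1, i}" "b \<in> {mat 1, p}" "c \<in> {mat 1, q}" "v = a ** (b ** c)"
      using pq(2)[OF v(1)] by blast
    have "p \<in> {i, j, k}" "q \<in> {i, j, k}" using pq(1) k(1) by blast+
    then have "fixes_pair \<tau> i j a" "fixes_pair \<tau> i j b" "fixes_pair \<tau> i j c"
      using abc(1-3) fi fj fk fixes_pair_one[OF R] by auto
    then show ?thesis using fixes_pair_mult[OF R] abc(4) by simp
  qed
  have "conj w i \<in> {i, j, k}" using w(2) k(1) by blast
  then consider "conj w i = i" | "conj w i = j" | "conj w i = k" by blast
  then show ?thesis
  proof cases
    case 1 then show ?thesis using cent w(1) by blast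
  next
    case 2
    then have "conj (u ** w) i = i" using conj_simps(1)[OF u(1) w(1), of i] u(2) by simp
    then have "fixes_pair \<tau> i j (u ** w)" using cent H3G_mult u(1) w(1) by blast
    then show ?thesis using fixes_pair_mult[OF R fui] H3G_cancel(2)[OF u(1)] by metis
  next
    case 3
    have ui: "matrix_inv u \<in> H3G" using H3G_inv u(1) by blast
    have "conj (matrix_inv u) k = i" using conj_inv(2)[OF u(1), of i] uc(1) by simp
    then have "conj (matrix_inv u ** w) i = i" using conj_simps(1)[OF ui w(1), of i] 3 by simp
    then have "fixes_pair \<tau> i j (matrix_inv u ** w)" using cent H3G_mult ui w(1) by blast
    then show ?thesis using fixes_pair_mult[OF R fu] H3G_cancel(1)[OF u(1)] by metis
  qed
qed

lemma conj_one: "conj (mat 1) s = s" by (rule conj_simps(2)[OF H3G.one H3G.one])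

section \<open>Normal words and left multiplication\<close>

inductive represents :: "gen list \<Rightarrow> bas \<Rightarrow> bool" where
  T: "w \<in> H3G \<Longrightarrow> represents [GT w] (BT w)"
| E: "w \<in> H3G \<Longrightarrow> t \<in> H3R \<Longrightarrow> represents [GT w, GE t] (BE {w, w ** t} t)"
| P: "w \<in> H3G \<Longrightarrow> i \<in> H3R \<Longrightarrow> j \<in> H3R \<Longrightarrow> com i j \<Longrightarrow> i \<noteq> j \<Longrightarrow>
    represents [GT w, GE i, GE j] (BP (commclass (conj w i)) (commclass i))"

lemma represents_Gens: "represents u x \<Longrightarrow> set u \<subseteq> Gens"
  by (erule represents.cases) (simp_all add: Gens_simps)

text \<open>For \<open>w e_t\<close> the ambiguity is \<open>w t e_t = w e_t\<close>. For a class
  product, two words differ by an element stabilizing the class and by the choice of pair, which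
  \<open>stab_fixes_pair\<close> and \<open>weq_pair\<close> absorb.\<close>

lemma represents_unique:
  assumes "represents u x" "represents v x" shows "weq \<tau> u v"
  using assms(1)
proof cases
  case (T w)
  have "v = u" using assms(2) unfolding T(2) by cases (simp_all add: T(1))
  then show ?thesis using meq_refl by simp
next
  case (E w t)
  have "\<exists>w'. w' \<in> H3G \<and> v = [GT w', GE t] \<and> {w, w ** t} = {w', w' ** t}"
    using assms(2) unfolding E(2) by cases blast
  then obtain w' where v: "w' \<in> H3G" "v = [GT w', GE t]" "{w, w ** t} = {w', w' ** t}" by blast
  then have "w' = w \<or> w' = w ** t" by blast
  then show ?thesis
  proof
    assume "w' = w" then show ?thesis using E(1) v(2) meq_refl by simp
  next
    assume w': "w' = w ** t"
    have "weq \<tau> [GT (w ** t), GE t] [GT w, GT t, GE t]"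
      by (rule weq_sym[OF weq_TT_list]) (use E H3R_in_H3G in \<open>simp_all add: Gens_simps\<close>)
    also have "weq \<tau> \<dots> [GT w, GE t]"
      using meq_Cons[OF weq_TE_self[OF E(4)], of "GT w"] E(3) by (simp add: Gens_simps)
    finally show ?thesis unfolding E(1) v(2) w' by (rule weq_sym)
  qed
next
  case (P w i j)
  have "\<exists>w' i' j'. w' \<in> H3G \<and> i' \<in> H3R \<and> j' \<in> H3R \<and> com i' j' \<and> i' \<noteq> j' \<and> v = [GT w', GE i', GE j'] \<and>
      commclass (conj w i) = commclass (conj w' i') \<and> commclass i = commclass i'"
    using assms(2) unfolding P(2)
  proof cases
    case (P w' i' j')
    then show ?thesis by (intro exI[of _ w'] exI[of _ i'] exI[of _ j'] conjI)
  qed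
  then obtain w' i' j' where v: "w' \<in> H3G" "i' \<in> H3R" "j' \<in> H3R" "com i' j'" "i' \<noteq> j'"
    "v = [GT w', GE i', GE j']" "commclass (conj w i) = commclass (conj w' i')" "commclass i = commclass i'"
    by blast
  have "i' \<in> commclass i" using v(8) commclass_self[OF v(2)] by simp
  moreover have "j' \<in> commclass i" using v(8) in_commclass_com[OF v(3)] com_sym[OF v(4)] by simp
  moreover have "j \<in> commclass i" using in_commclass_com[OF P(5)] com_sym[OF P(6)] by simp
  ultimately have in': "i' \<in> commclass i" "j' \<in> commclass i" "j \<in> commclass i" by blast+
  \<comment> \<open>Both group elements carry the class of \<open>i\<close> to the same class, so
    their quotient stabilizes it.\<close>
  define g where "g = matrix_inv w' ** w"
  have wi: "matrix_inv w' \<in> H3G" using v H3G_inv by blast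
  have g: "g \<in> H3G" "w' ** g = w" using H3G_mult[OF wi P(3)] H3G_cancel(1)[OF v(1)] by (simp_all add: g_def)
  have "conj g ` commclass i = commclass i"
  proof -
    have "conj g ` commclass i = commclass (conj (matrix_inv w') (conj w i))"
      unfolding conj_commclass[OF g(1) P(4)] unfolding conj_simps(1)[OF wi P(3)] g_def ..
    also have "\<dots> = conj (matrix_inv w') ` commclass (conj w' i')"
      unfolding v(7)[symmetric] by (rule conj_commclass[OF wi conj_H3R[OF P(3,4)], symmetric])
    also have "\<dots> = commclass i'"
      using conj_commclass[OF wi conj_H3R[OF v(1,2)]] conj_inv(2)[OF v(1)] by simp
    finally show ?thesis using v(8) by simp
  qed
  then have "fixes_pair \<tau> i j g" using stab_fixes_pair[OF P(4-7) g(1)] by blast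
  then have fx: "weq \<tau> [GT g, GE i, GE j] [GE i, GE j]" unfolding fixes_pair_def by blast
  have "weq \<tau> [GT w, GE i, GE j] [GT w', GT g, GE i, GE j]"
    using weq_sym[OF weq_TT_list[OF v(1) g(1), of "[GE i, GE j]"]] g(2) P by (simp add: Gens_simps)
  also have "weq \<tau> \<dots> [GT w', GE i, GE j]"
    using meq_Cons[OF fx] v(1) by (simp add: Gens_simps)
  also have "weq \<tau> \<dots> [GT w', GE i', GE j']"
    using meq_Cons[OF weq_pair[OF P(4) in'(3) in'(1,2) P(7) v(5)]] v(1) by (simp add: Gens_simps)
  finally show ?thesis using P(1) v(6) by simp
qed

lemma class_transitive:
  assumes "s \<in> H3R" "t \<in> H3R"
  obtains w where "w \<in> H3G" "commclass (conj w t) = commclass s"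
proof (cases "com s t")
  case True
  then show ?thesis using that[OF H3G.one] conj_one commclass_eq_com[OF assms] by simp
next
  case False
  then show ?thesis using that swapper(3,4)[OF assms False] by metis
qed

lemma represents_exists: assumes "x \<in> bases" obtains u where "represents u x"
  using assms
proof (cases rule: bases_cases)
  case (T w) then show ?thesis using that represents.T by blast
next
  case (E w t) then show ?thesis using that represents.E by blast
next
  case (P b a)
  obtain j k where j: "j \<in> H3R" "a \<noteq> j" "a ** j = j ** a" using H3R_triple[OF P(2)] by metis
  obtain w where w: "w \<in> H3G" "commclass (conj w a) = commclass b" using class_transitive[OF P(1,2)] by blast
  have "represents [GT w, GE a, GE j] (BP (commclass (conj w a)) (commclass a))"
    by (rule represents.P) (use w j P in \<open>auto simp: com_def\<close>)
  then show ?thesis using that w P by simp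
qed

lemma represents_bases: "represents u x \<Longrightarrow> x \<in> bases"
  by (erule represents.cases) (simp_all add: bases_intros conj_H3R)

lemma represents_T_step:
  assumes "represents u x" "g \<in> H3G"
  obtains v where "weq \<tau> (GT g # u) v" "represents v (tact g x)"
  using assms(1)
proof cases
  case (T w)
  have "represents [GT (g ** w)] (tact g x)"
    using represents.T[OF H3G_mult[OF assms(2) T(3)]] T(2) by simp
  then show ?thesis using that weq_TT[OF assms(2) T(3)] T(1) by blast
next
  case (E w t)
  have "weq \<tau> (GT g # u) [GT (g ** w), GE t]"
    unfolding E(1) by (rule weq_TT_list) (use E assms in \<open>simp_all add: Gens_simps\<close>)
  moreover have "represents [GT (g ** w), GE t] (tact g x)"
    unfolding E(2) tact_BE by (rule represents.E) (use E assms H3G_mult in auto)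
  ultimately show ?thesis using that by blast
next
  case (P w i j)
  have "weq \<tau> (GT g # u) [GT (g ** w), GE i, GE j]"
    unfolding P(1) by (rule weq_TT_list) (use P assms in \<open>simp_all add: Gens_simps\<close>)
  moreover have "tact g x = BP (commclass (conj (g ** w) i)) (commclass i)"
    unfolding P(2) tact_BP[OF assms(2) conj_H3R[OF P(3,4)]] conj_simps(1)[OF assms(2) P(3)] ..
  then have "represents [GT (g ** w), GE i, GE j] (tact g x)"
    using represents.P[OF H3G_mult[OF assms(2) P(3)] P(4-7)] by simp
  ultimately show ?thesis using that by blast
qed

text \<open>Words with trivial group part suffice, because \<open>e_s w = w e_t\<close> with
  \<open>t = w^-1 s w\<close> moves the group element out of the way.\<close>

lemma represents_E_step_identity:
  assumes "represents (GT (mat 1) # u) x" "s \<in> H3R" "set u \<subseteq> Gens"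
  obtains v where "meq \<tau> (GE s # u) (ecoef \<tau> s x) v" "represents v (eact s x)"
  using assms(1)
proof (cases (no_simp))
  case (T w)
  then have u: "u = []" "x = BT (mat 1)" by auto
  have "eact s x = BE {mat 1, mat 1 ** s} s" "ecoef \<tau> s x = 1"
    using u conj_inv(1)[OF H3G.one, of s] conj_one by auto
  moreover have "weq \<tau> [GE s] [GT (mat 1), GE s]"
    using weq_sym[OF weq_T1_list[of "[GE s]"]] assms(2) by (simp add: Gens_simps)
  ultimately show ?thesis using that[of "[GT (mat 1), GE s]"] represents.E[OF H3G.one assms(2)] u by simp
next
  case (E w t)
  then have u: "u = [GE t]" "x = BE {mat 1, mat 1 ** t} t" by auto
  have c: "coset_conj {mat 1, mat 1 ** t} t = t"
    using coset_conj[OF H3G.one E(4)] conj_one by simp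
  have pre: "weq \<tau> v (GT (mat 1) # v)" if "set v \<subseteq> Gens" for v using weq_sym[OF weq_T1_list[OF that]] .
  consider "s = t" | "s \<noteq> t" "com s t" | "\<not> com s t" by blast
  then show ?thesis
  proof cases
    case 1
    have "meq \<tau> (GE s # u) (ecoef \<tau> s x) (GT (mat 1) # u)"
      using meq_weq_trans[OF meq_EE[OF assms(2)] pre[of "[GE s]"]] 1 u c E by (simp add: Gens_simps)
    moreover have "eact s x = x" using u c 1 by simp
    ultimately show ?thesis using that assms(1) by simp
  next
    case 2
    have "represents [GT (mat 1), GE s, GE t] (BP (commclass (conj (mat 1) s)) (commclass s))"
      by (rule represents.P[OF H3G.one assms(2) E(4) 2(2,1)])
    moreover have "eact s x = BP (commclass s) (commclass s)" "ecoef \<tau> s x = 1"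
      using 2 c u commclass_eq_com[OF assms(2) E(4)] by auto
    moreover have "weq \<tau> (GE s # u) [GT (mat 1), GE s, GE t]"
      using pre[of "[GE s, GE t]"] u assms(2) E by (simp add: Gens_simps)
    ultimately show ?thesis using that conj_one by simp
  next
    case 3
    let ?r = "swapper s t"
    have r: "?r \<in> H3G" using swapper(3)[OF assms(2) E(4) 3] .
    have "s \<noteq> t" using 3 com_refl by blast
    then have "eact s x = BE {?r, ?r ** t} t" "ecoef \<tau> s x = 1" using 3 u c by auto
    moreover have "weq \<tau> (GE s # u) [GT ?r, GE t]"
      using weq_EE_noncom(1)[OF assms(2) E(4) 3] u by simp
    ultimately show ?thesis using that represents.E[OF r E(4)] by simp
  qed
next
  case (P w i j)
  then have u: "u = [GE i, GE j]" "x = BP (commclass i) (commclass i)"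
    using conj_one by auto
  have pre: "weq \<tau> v (GT (mat 1) # v)" if "set v \<subseteq> Gens" for v using weq_sym[OF weq_T1_list[OF that]] .
  note g = Gens_simps P assms(2)
  show ?thesis
  proof (cases "com s i")
    case True
    then have sc: "s \<in> commclass i" using in_commclass_com assms(2) by blast
    then have "s \<in> commclass i" "i \<in> commclass i" "j \<in> commclass i"
      using commclass_self in_commclass_com P com_sym by blast+
    \<comment> \<open>Rewriting the pair so that it starts with \<open>s\<close> brings out the
      square of \<open>e_s\<close>.\<close>
    then obtain y where y: "y \<in> commclass i" "s \<noteq> y" using P by metis
    have yR: "y \<in> H3R" using y by (simp add: commclass_def)
    have pw: "weq \<tau> [GE i, GE j] [GE s, GE y]"
      by (rule weq_pair) (use P y sc commclass_self in_commclass_com com_sym in blast)+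
    have "weq \<tau> (GE s # u) [GE s, GE s, GE y]" using meq_Cons[OF pw] u g by simp
    also have "meq \<tau> \<dots> \<tau> [GE s, GE y]" using meq_append[OF meq_EE[OF assms(2)], of "[GE y]"] yR g by simp
    also have "weq \<tau> \<dots> [GE i, GE j]" by (rule weq_sym[OF pw])
    also have "weq \<tau> \<dots> (GT (mat 1) # u)" using pre[of "[GE i, GE j]"] g u by simp
    finally have "meq \<tau> (GE s # u) \<tau> (GT (mat 1) # u)" .
    moreover have "eact s x = x" "ecoef \<tau> s x = \<tau>" using sc u by auto
    ultimately show ?thesis using that assms(1) by simp
  next
    case False
    let ?r = "swapper s i"
    have r: "?r \<in> H3G" "conj ?r i = s" using swapper(3,4)[OF assms(2) P(4) False] .
    have "s \<notin> commclass i" using False in_commclass_com assms(2) by blast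
    then have "eact s x = BP (commclass (conj ?r i)) (commclass i)" "ecoef \<tau> s x = 1" using u r by auto
    moreover have "weq \<tau> (GE s # u) [GT ?r, GE i, GE j]"
      using meq_append[OF weq_EE_noncom(1)[OF assms(2) P(4) False], of "[GE j]"] u g by simp
    ultimately show ?thesis using that represents.P[OF r(1) P(4-7)] by simp
  qed
qed

lemma represents_shift:
  assumes "represents u x"
  obtains w v y where "w \<in> H3G" "u = GT w # v" "represents (GT (mat 1) # v) y" "x = tact w y" "set v \<subseteq> Gens"
  using assms
proof cases
  case (T w)
  then show ?thesis using that[of w "[]" "BT (mat 1)"] represents.T[OF H3G.one] by simp
next
  case (E w t)
  have "x = tact w (BE {mat 1, mat 1 ** t} t)" unfolding tact_BE E(2) by simp
  then show ?thesis using that[of w "[GE t]"] represents.E[OF H3G.one E(4)] E by (simp add: Gens_simps)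
next
  case (P w i j)
  have "x = tact w (BP (commclass (conj (mat 1) i)) (commclass i))"
    using conj_one[of i] tact_BP[OF P(3,4)] P(2) by simp
  then show ?thesis using that[of w "[GE i, GE j]"] represents.P[OF H3G.one P(4-7)] P by (simp add: Gens_simps)
qed

lemma represents_E_step:
  assumes "represents u x" "s \<in> H3R"
  obtains v where "meq \<tau> (GE s # u) (ecoef \<tau> s x) v" "represents v (eact s x)"
proof -
  obtain w v y where w: "w \<in> H3G" "u = GT w # v" "represents (GT (mat 1) # v) y" "x = tact w y" "set v \<subseteq> Gens"
    using represents_shift[OF assms(1)] by metis
  define s' where "s' = conj (matrix_inv w) s"
  have s': "s' \<in> H3R" "conj w s' = s" using conj_inv_H3R[OF w(1) assms(2)] conj_inv(1)[OF w(1)] by (simp_all add: s'_def)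
  have y: "y \<in> bases" using represents_bases w(3) by blast
  note eq = eact_equivariant[OF w(1) s'(1) y, unfolded s'(2), folded w(4)]
  obtain z where z: "meq \<tau> (GE s' # v) (ecoef \<tau> s' y) z" "represents z (eact s' y)"
    using represents_E_step_identity[OF w(3) s'(1) w(5)] by metis
  obtain v' where v': "weq \<tau> (GT w # z) v'" "represents v' (tact w (eact s' y))"
    using represents_T_step[OF z(2) w(1)] by metis
  have "weq \<tau> (GE s # u) (GT w # GE s' # v)"
    using meq_append[OF weq_ET[OF w(1) assms(2)] w(5)] w(2) by (simp add: s'_def)
  also have "meq \<tau> \<dots> (ecoef \<tau> s x) (GT w # z)"
    using meq_Cons[OF z(1), of "GT w"] w(1) eq(2) by (simp add: Gens_simps)
  also have "weq \<tau> \<dots> v'" by (rule v'(1))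
  finally show ?thesis using that v'(2) eq(1) by simp
qed

section \<open>Evaluation at the identity vector\<close>

definition bvec :: "bas \<Rightarrow> complex^bt" where "bvec x = axis (Abs_bt x) 1"

text \<open>The image of the identity vector under p. Its kernel turns out to be exactly the ideal,
  which identifies the algebra with the module.\<close>

definition cyc :: "complex \<Rightarrow> fa \<Rightarrow> complex^bt" where
  "cyc \<tau> p = app (ev (rho \<tau>) p) (bvec (BT (mat 1)))"

lemma app_bmon: "x \<in> bases \<Longrightarrow> app (bmon f c) (bvec x) = c x *s bvec (f x)"
  by (simp add: bmon_def bvec_def app_monomial Abs_bt_inverse)

lemma app_Tm: "x \<in> bases \<Longrightarrow> app (Tm g) (bvec x) = bvec (tact g x)"
  by (simp add: Tm_def app_bmon)

lemma app_Em: "x \<in> bases \<Longrightarrow> app (Em \<tau> s) (bvec x) = ecoef \<tau> s x *s bvec (eact s x)"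
  by (simp add: Em_def app_bmon)

lemma cyc_add: "p \<in> FA \<Longrightarrow> q \<in> FA \<Longrightarrow> cyc \<tau> (fa_add p q) = cyc \<tau> p + cyc \<tau> q"
  by (simp add: cyc_def ev_add app_add)
lemma cyc_smult: "cyc \<tau> (fa_smult c p) = c *s cyc \<tau> p"
  by (simp add: cyc_def ev_smult app_mult app_scalar)
lemma cyc_mult: "p \<in> FA \<Longrightarrow> q \<in> FA \<Longrightarrow> cyc \<tau> (fa_mult p q) = app (ev (rho \<tau>) p) (cyc \<tau> q)"
  by (simp add: cyc_def ev_mult app_mult)
lemma cyc_sub: "p \<in> FA \<Longrightarrow> q \<in> FA \<Longrightarrow> cyc \<tau> (fa_sub p q) = cyc \<tau> p - cyc \<tau> q"
  by (simp add: fa_sub_eq cyc_add cyc_smult fa_smult_FA)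
lemma cyc_zero: "cyc \<tau> fa_zero = 0" by (simp add: cyc_def ev_zero app_0)
lemma cyc_BI: "p \<in> BI \<tau> \<Longrightarrow> cyc \<tau> p = 0" by (simp add: cyc_def ev_BI app_0)
lemma cyc_setsum: "finite A \<Longrightarrow> (\<And>i. i \<in> A \<Longrightarrow> f i \<in> FA) \<Longrightarrow> cyc \<tau> (fa_setsum f A) = (\<Sum>i\<in>A. cyc \<tau> (f i))"
proof (induction A rule: finite_induct)
  case empty then show ?case using cyc_zero by (simp add: fa_setsum_def fa_zero_def)
next
  case (insert x A)
  then have "fa_setsum f (insert x A) = fa_add (f x) (fa_setsum f A)" by (simp add: fa_setsum_def fa_add_def)
  then show ?case using insert by (simp add: cyc_add fa_setsum_FA)
qed

lemma cyc_represents: assumes "represents u x" shows "cyc \<tau> (fa_word u) = bvec x"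
proof -
  note b = bases_intros
  have scalar_one: "1 *s v = v" for v :: "complex^bt" by simp
  have cE: "app (Em \<tau> t) (bvec (BT (mat 1))) = bvec (BE {mat 1, mat 1 ** t} t)" if "t \<in> H3R" for t
    using app_Em[OF b(1)[OF H3G.one]] eact_BT[OF H3G.one, of t] conj_inv(1)[OF H3G.one, of t]
      conj_one by simp
  show ?thesis
    using assms
  proof cases
    case (T w)
    then show ?thesis by (simp add: cyc_def ev_word app_Tm b H3G.one)
  next
    case (E w t)
    have "app (Tm w) (app (Em \<tau> t) (bvec (BT (mat 1)))) = bvec (tact w (BE {mat 1, mat 1 ** t} t))"
      by (simp only: cE[OF E(4)] app_Tm[OF b(2)[OF H3G.one E(4)]])
    then have "cyc \<tau> (fa_word u) = bvec (tact w (BE {mat 1, mat 1 ** t} t))"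
      unfolding E(1) by (simp add: cyc_def ev_word app_mult)
    then show ?thesis unfolding tact_BE E(2) by simp
  next
    case (P w i j)
    have c: "coset_conj {mat 1, mat 1 ** j} j = j"
      using coset_conj[OF H3G.one P(5)] conj_one by simp
    have "eact i (BE {mat 1, mat 1 ** j} j) = BP (commclass i) (commclass i)"
      "ecoef \<tau> i (BE {mat 1, mat 1 ** j} j) = 1"
      using c P commclass_eq_com[OF P(4,5)] by auto
    then have "app (Tm w) (app (Em \<tau> i) (app (Em \<tau> j) (bvec (BT (mat 1))))) = bvec (tact w (BP (commclass i) (commclass i)))"
      by (simp only: cE[OF P(5)] app_Em[OF b(2)[OF H3G.one P(5)]] app_Tm[OF b(3)[OF P(4,4)]] scalar_one)
    then have "cyc \<tau> (fa_word u) = bvec (tact w (BP (commclass i) (commclass i)))"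
      unfolding P(1) by (simp add: cyc_def ev_word app_mult)
    then show ?thesis unfolding tact_BP[OF P(3,4)] P(2) .
  qed
qed

lemma word_reduces:
  assumes "set u \<subseteq> Gens"
  shows "\<exists>c v x. meq \<tau> u c v \<and> represents v x"
  using assms
proof (induction u)
  case Nil
  have "weq \<tau> [] [GT (mat 1)]" by (rule weq_sym[OF weq_T1])
  then show ?case using represents.T[OF H3G.one] by blast
next
  case (Cons g u)
  then obtain c v x where cv: "meq \<tau> u c v" "represents v x" by auto
  have g: "g \<in> Gens" using Cons by simp
  have 1: "meq \<tau> (g # u) c (g # v)" by (rule meq_Cons[OF cv(1) g])
  show ?case
  proof (cases g)
    case (GT w)
    then obtain z where "weq \<tau> (GT w # v) z" "represents z (tact w x)"
      using represents_T_step[OF cv(2)] g by (metis Gens_simps(1))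
    then show ?thesis using meq_weq_trans[OF 1] GT by blast
  next
    case (GE s)
    then obtain z where "meq \<tau> (GE s # v) (ecoef \<tau> s x) z" "represents z (eact s x)"
      using represents_E_step[OF cv(2)] g by (metis Gens_simps(2))
    then show ?thesis using meq_trans[OF 1] GE by blast
  qed
qed

section \<open>The basis\<close>

lemma bvec_nth: "x \<in> bases \<Longrightarrow> y \<in> bases \<Longrightarrow> bvec x $ Abs_bt y = (if x = y then 1 else 0)"
  by (simp add: bvec_def axis_def Abs_bt_inject)

lemma vec_expansion:
  assumes "finite A" "bij_betw \<eta> A bases"
  shows "v = (\<Sum>i\<in>A. v $ Abs_bt (\<eta> i) *s bvec (\<eta> i))"
proof -
  have "v $ j = (\<Sum>i\<in>A. v $ Abs_bt (\<eta> i) *s bvec (\<eta> i)) $ j" for j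
  proof -
    obtain y where y: "y \<in> bases" "j = Abs_bt y" using Abs_bt_cases by blast
    have "y \<in> \<eta> ` A" using y(1) assms(2) by (simp add: bij_betw_def)
    then obtain i0 where i0: "i0 \<in> A" "\<eta> i0 = y" by blast
    have "(\<Sum>i\<in>A. v $ Abs_bt (\<eta> i) *s bvec (\<eta> i)) $ j = (\<Sum>i\<in>A. v $ Abs_bt (\<eta> i) * (bvec (\<eta> i) $ j))" by simp
    also have "\<dots> = (\<Sum>i\<in>A. if i = i0 then v $ j else 0)"
    proof (rule sum.cong[OF refl])
      fix i assume i: "i \<in> A"
      have "\<eta> i \<in> bases" "\<eta> i = y \<longleftrightarrow> i = i0"
        using bij_betwE[OF assms(2)] i i0 inj_on_eq_iff[OF bij_betw_imp_inj_on[OF assms(2)] i i0(1)]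
        unfolding i0(2) by blast+
      then show "v $ Abs_bt (\<eta> i) * (bvec (\<eta> i) $ j) = (if i = i0 then v $ j else 0)"
        using bvec_nth[of "\<eta> i" y] y i0 by simp
    qed
    also have "\<dots> = v $ j" using assms(1) i0 by simp
    finally show ?thesis by simp
  qed
  then show ?thesis unfolding vec_eq_iff by blast
qed

definition rep_word :: "bas \<Rightarrow> gen list" where "rep_word x = (SOME u. represents u x)"

lemma rep_word: "x \<in> bases \<Longrightarrow> represents (rep_word x) x"
  unfolding rep_word_def by (rule someI_ex) (metis represents_exists)

definition normal_form :: "complex^bt \<Rightarrow> fa" where
  "normal_form v = fa_setsum (\<lambda>x. fa_smult (v $ Abs_bt x) (fa_word (rep_word x))) bases"

lemma normal_form_linear: "normal_form (c *s v + w) = fa_add (fa_smult c (normal_form v)) (normal_form w)"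
  by (simp add: normal_form_def fa_setsum_def fa_smult_def fa_add_def distrib_right sum.distrib sum_distrib_left
      mult.assoc)

lemma normal_form_zero: "normal_form 0 = fa_zero"
  by (simp add: normal_form_def fa_setsum_def fa_smult_def fa_zero_def)

lemma normal_form_bvec:
  assumes "y \<in> bases" shows "normal_form (bvec y) = fa_word (rep_word y)"
proof
  fix w
  have "normal_form (bvec y) w = (\<Sum>x\<in>bases. if x = y then fa_word (rep_word y) w else 0)"
    unfolding normal_form_def fa_setsum_def fa_smult_def
    by (rule sum.cong[OF refl]) (use assms in \<open>auto simp: bvec_nth\<close>)
  then show "normal_form (bvec y) w = fa_word (rep_word y) w" using assms finite_bases by simp
qed

text \<open>Every word reduces to a multiple of a normal word, and \<open>cyc\<close> sends a normal
  word to a basis vector; hence \<open>cyc\<close> reads off the coefficients of the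
  reduction.\<close>

lemma normal_form_congruent:
  assumes "p \<in> FA" shows "fa_sub p (normal_form (cyc \<tau> p)) \<in> BI \<tau>"
  using assms
proof (induction p rule: FA_induct)
  case zero
  have "fa_sub fa_zero (normal_form (cyc \<tau> fa_zero)) = fa_zero"
    by (simp add: cyc_zero normal_form_zero) (simp add: fa_sub_def fa_zero_def)
  then show ?case using BI_intros(1) by simp
next
  case (add c u q)
  obtain d v x where v: "meq \<tau> u d v" "represents v x" using word_reduces[OF add(1)] by metis
  have x: "x \<in> bases" using represents_bases v(2) .
  have "weq \<tau> v (rep_word x)" using represents_unique[OF v(2) rep_word[OF x]] .
  then have m: "meq \<tau> u d (rep_word x)" by (rule meq_weq_trans[OF v(1)])
  have rw: "fa_word (rep_word x) \<in> FA" using fa_word_FA represents_Gens rep_word[OF x] by blast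
  have "cyc \<tau> (fa_sub (fa_word u) (fa_smult d (fa_word (rep_word x)))) = 0"
    using cyc_BI m unfolding meq_def by blast
  then have "cyc \<tau> (fa_word u) = d *s bvec x + 0"
    using cyc_sub[OF fa_word_FA[OF add(1)] fa_smult_FA[OF rw]] cyc_represents[OF rep_word[OF x]]
    by (simp add: cyc_smult)
  then have "normal_form (cyc \<tau> (fa_word u)) = fa_add (fa_smult d (fa_word (rep_word x))) fa_zero"
    using normal_form_linear[of d "bvec x" 0] by (simp add: normal_form_zero normal_form_bvec[OF x])
  then have "fa_sub (fa_word u) (normal_form (cyc \<tau> (fa_word u))) \<in> BI \<tau>"
    using m unfolding meq_def by (simp add: fa_add_def fa_zero_def)
  then have "fa_add (fa_smult c (fa_sub (fa_word u) (normal_form (cyc \<tau> (fa_word u)))))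
      (fa_sub q (normal_form (cyc \<tau> q))) \<in> BI \<tau>"
    using add(3) BI_intros(2,3) by blast
  moreover have "cyc \<tau> (fa_add (fa_smult c (fa_word u)) q) = c *s cyc \<tau> (fa_word u) + cyc \<tau> q"
    using add(1,2) by (simp add: cyc_add cyc_smult fa_smult_FA fa_word_FA)
  then have "normal_form (cyc \<tau> (fa_add (fa_smult c (fa_word u)) q)) =
      fa_add (fa_smult c (normal_form (cyc \<tau> (fa_word u)))) (normal_form (cyc \<tau> q))"
    by (simp add: normal_form_linear)
  then have "fa_add (fa_smult c (fa_sub (fa_word u) (normal_form (cyc \<tau> (fa_word u)))))
      (fa_sub q (normal_form (cyc \<tau> q))) = fa_sub (fa_add (fa_smult c (fa_word u)) q)
      (normal_form (cyc \<tau> (fa_add (fa_smult c (fa_word u)) q)))"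
    by (simp add: fa_add_def fa_smult_def fa_sub_def algebra_simps)
  ultimately show ?case by simp
qed

text \<open>An element killed by \<open>cyc\<close> is congruent to the normal form of 0.
  Independence, spanning and left ideals can henceforth be studied in the module.\<close>

lemma BI_iff: "p \<in> BI \<tau> \<longleftrightarrow> p \<in> FA \<and> cyc \<tau> p = 0"
proof
  assume "p \<in> FA \<and> cyc \<tau> p = 0"
  then have "fa_sub p fa_zero \<in> BI \<tau>" using normal_form_congruent[of p \<tau>] by (simp add: normal_form_zero)
  then show "p \<in> BI \<tau>" by (simp add: fa_sub_def fa_zero_def)
qed (simp add: BI_FA cyc_BI)

lemma basis_mod_represents:
  assumes fin: "finite A" and bij: "bij_betw \<eta> A bases"
    and b: "\<And>i. i \<in> A \<Longrightarrow> b i = fa_word (u i) \<and> represents (u i) (\<eta> i)"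
  shows "basis_mod (BI \<tau>) b A"
proof -
  have bFA: "b i \<in> FA" if "i \<in> A" for i using b[OF that] represents_Gens fa_word_FA by metis
  have cyc: "cyc \<tau> (fa_setsum (\<lambda>i. fa_smult (c i) (b i)) A) = (\<Sum>i\<in>A. c i *s bvec (\<eta> i))" for c
  proof -
    have "cyc \<tau> (fa_setsum (\<lambda>i. fa_smult (c i) (b i)) A) = (\<Sum>i\<in>A. cyc \<tau> (fa_smult (c i) (b i)))"
      by (rule cyc_setsum[OF fin]) (simp add: fa_smult_FA bFA)
    also have "\<dots> = (\<Sum>i\<in>A. c i *s bvec (\<eta> i))"
      by (rule sum.cong[OF refl]) (use b cyc_represents in \<open>simp add: cyc_smult\<close>)
    finally show ?thesis .
  qed
  have "c i = 0" if c: "fa_setsum (\<lambda>i. fa_smult (c i) (b i)) A \<in> BI \<tau>" and i: "i \<in> A" for c i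
  proof -
    have "(\<Sum>j\<in>A. c j *s bvec (\<eta> j)) = 0" using cyc[of c] cyc_BI[OF c] by simp
    then have "0 = (\<Sum>j\<in>A. c j *s bvec (\<eta> j)) $ Abs_bt (\<eta> i)" by simp
    also have "\<dots> = (\<Sum>j\<in>A. c j * (bvec (\<eta> j) $ Abs_bt (\<eta> i)))" by simp
    also have "\<dots> = (\<Sum>j\<in>A. if j = i then c i else 0)"
    proof (rule sum.cong[OF refl])
      fix j assume j: "j \<in> A"
      have "\<eta> j \<in> bases" "\<eta> i \<in> bases" "\<eta> j = \<eta> i \<longleftrightarrow> j = i"
        using bij_betwE[OF bij] i j inj_on_eq_iff[OF bij_betw_imp_inj_on[OF bij] j i] by blast+
      then show "c j * (bvec (\<eta> j) $ Abs_bt (\<eta> i)) = (if j = i then c i else 0)" using bvec_nth by simp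
    qed
    also have "\<dots> = c i" using fin i by simp
    finally show ?thesis by simp
  qed
  moreover have "\<exists>c. fa_sub p (fa_setsum (\<lambda>i. fa_smult (c i) (b i)) A) \<in> BI \<tau>" if p: "p \<in> FA" for p
  proof -
    define c where "c = (\<lambda>i. cyc \<tau> p $ Abs_bt (\<eta> i))"
    define q where "q = fa_setsum (\<lambda>i. fa_smult (c i) (b i)) A"
    have q: "q \<in> FA" unfolding q_def by (rule fa_setsum_FA[OF fin]) (simp add: fa_smult_FA bFA)
    have "cyc \<tau> q = cyc \<tau> p" unfolding q_def cyc c_def using vec_expansion[OF fin bij, of "cyc \<tau> p"] by simp
    then have "fa_sub p q \<in> BI \<tau>" using p q by (simp add: BI_iff fa_sub_FA cyc_sub)
    then show ?thesis unfolding q_def by blast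
  qed
  ultimately show ?thesis unfolding basis_mod_def using fin bFA by blast
qed

lemma basis_mod_bij:
  assumes bm: "basis_mod I b A" and h: "bij_betw h B A" and B: "finite B"
  shows "basis_mod I (b \<circ> h) B"
proof -
  have eq: "fa_setsum (\<lambda>i. fa_smult (c i) (b i)) A = fa_setsum (\<lambda>j. fa_smult (c (h j)) ((b \<circ> h) j)) B" for c
    unfolding fa_setsum_def by (rule ext, rule sum.reindex_bij_betw[OF h, symmetric, unfolded comp_def, THEN trans]) simp
  have inv: "h (inv_into B h i) = i" if "i \<in> A" for i
    using h that unfolding bij_betw_def by (metis f_inv_into_f)
  have inv': "inv_into B h (h j) = j" "h j \<in> A" if "j \<in> B" for j
    using h that unfolding bij_betw_def by (auto simp: inv_into_f_f)
  have eq': "fa_setsum (\<lambda>j. fa_smult (c j) ((b \<circ> h) j)) B = fa_setsum (\<lambda>i. fa_smult (c (inv_into B h i)) (b i)) A" for c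
    unfolding eq by (simp add: fa_setsum_def inv' cong: sum.cong)
  show ?thesis
    unfolding basis_mod_def
  proof (intro conjI ballI allI impI B)
    fix j assume "j \<in> B" then show "(b \<circ> h) j \<in> FA" using bm inv'(2) unfolding basis_mod_def by simp
  next
    fix c j assume c: "fa_setsum (\<lambda>j. fa_smult (c j) ((b \<circ> h) j)) B \<in> I" and j: "j \<in> B"
    have "d i = 0" if "fa_setsum (\<lambda>i. fa_smult (d i) (b i)) A \<in> I" "i \<in> A" for d i
      using bm that unfolding basis_mod_def by blast
    from this[OF c[unfolded eq'] inv'(2)[OF j]] show "c j = 0" unfolding inv'(1)[OF j] .
  next
    fix p assume "p \<in> FA"
    then obtain c where "fa_sub p (fa_setsum (\<lambda>i. fa_smult (c i) (b i)) A) \<in> I"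
      using bm unfolding basis_mod_def by blast
    then show "\<exists>c. fa_sub p (fa_setsum (\<lambda>j. fa_smult (c j) ((b \<circ> h) j)) B) \<in> I"
      unfolding eq by (rule exI[of _ "\<lambda>j. c (h j)"])
  qed
qed

lemma has_dim_modI:
  assumes "basis_mod I b A" shows "has_dim_mod I (card A)"
proof -
  have "finite A" using assms by (simp add: basis_mod_def)
  then obtain h where "bij_betw h {..<card A} A" using ex_bij_betw_nat_finite[of A] by (auto simp: atLeast0LessThan)
  then have "basis_mod I (b \<circ> h) {..<card A}" using basis_mod_bij[OF assms] by blast
  then show ?thesis unfolding has_dim_mod_def by blast
qed

section \<open>Polynomials in a matrix and averaged projections\<close>

definition peval :: "complex poly \<Rightarrow> 'n::finite sqm \<Rightarrow> 'n sqm" where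
  "peval q A = fold_coeffs (\<lambda>c r. scalar c + A * r) q 0"

lemma peval_0: "peval 0 A = 0" by (simp add: peval_def)

lemma peval_pCons: "peval (pCons c q) A = scalar c + A * peval q A"
proof (cases "c = 0 \<and> q = 0")
  case False then show ?thesis unfolding peval_def by (cases "q = 0") simp_all
qed (simp add: peval_0 scalar_0)

lemma peval_add: "peval (p + q) A = peval p A + peval q A"
proof (induction p arbitrary: q)
  case (pCons a p)
  then show ?case by (cases q) (simp add: peval_pCons scalar_add algebra_simps)
qed (simp add: peval_0)

lemma peval_smult: "peval (smult c q) A = scalar c * peval q A"
  by (induction q) (simp_all add: peval_0 peval_pCons scalar_mult distrib_left scalar_left_comm)

lemma peval_mult: "peval (p * q) A = peval p A * peval q A"
  by (induction p) (simp_all add: peval_0 peval_pCons peval_add peval_smult scalar_0 algebra_simps)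

lemma peval_const: "peval [:c:] A = scalar c" by (simp add: peval_pCons peval_0)

lemma peval_pcompose: "peval (pcompose p q) A = peval p (peval q A)"
  by (induction p) (simp_all add: pcompose_pCons peval_0 peval_add peval_mult peval_const peval_pCons)

lemma peval_commute: assumes "X * A = A * X" shows "X * peval q A = peval q A * X"
proof (induction q)
  case (pCons a q)
  have "X * (A * peval q A) = A * peval q A * X" by (metis assms mult.assoc pCons.IH)
  then show ?case by (simp add: peval_pCons algebra_simps scalar_comm)
qed (simp add: peval_0)

lemma peval_prod: "finite I \<Longrightarrow> i \<in> I \<Longrightarrow> peval (m i) A = 0 \<Longrightarrow> peval (\<Prod>i\<in>I. m i) A = 0"
  by (subst prod.remove[of I i]) (simp_all add: peval_mult)

text \<open>On \<open>a\<close> the operator \<open>B\<close> acts as the simpler \<open>y\<close>.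
  Commutation allows the powers of \<open>B\<close> to be traded for powers of \<open>y\<close> one
  factor at a time.\<close>

lemma peval_intertwine:
  assumes "B * a = y * a" "y * B = B * y" shows "peval q B * a = peval q y * a"
proof (induction q)
  case (pCons c q)
  have "B * peval q y = peval q y * B" using peval_commute[OF assms(2)[symmetric]] .
  then have "B * (peval q B * a) = peval q y * (y * a)"
    unfolding pCons.IH by (metis assms(1) mult.assoc)
  also have "\<dots> = y * (peval q y * a)" using peval_commute[of y y q] by (metis mult.assoc)
  finally show ?case by (simp add: peval_pCons algebra_simps)
qed (simp add: peval_0)

lemma peval_intertwine_right:
  assumes "a * B = a * y" "y * B = B * y" shows "a * peval q B = a * peval q y"
proof (induction q)
  case (pCons c q)
  have "a * (B * peval q B) = a * peval q B * B" using peval_commute[of B B q] by (simp add: mult.assoc)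
  also have "\<dots> = a * (B * peval q y)" unfolding pCons.IH
    using peval_commute[OF assms(2)[symmetric], of q] by (simp add: mult.assoc)
  also have "\<dots> = a * (y * peval q y)" using assms(1) by (metis mult.assoc)
  finally show ?case by (simp add: peval_pCons algebra_simps)
qed (simp add: peval_0)

lemma app_sum: "app (\<Sum>i\<in>I. f i) v = (\<Sum>i\<in>I. app (f i) v)"
  by (induction I rule: infinite_finite_induct) (simp_all add: app_0 app_add)

lemma peval_sum: "peval (\<Sum>i\<in>I. f i) A = (\<Sum>i\<in>I. peval (f i) A)"
  by (induction I rule: infinite_finite_induct) (simp_all add: peval_0 peval_add)

lemma peval_monom: "peval (monom c k) A = scalar c * A ^ k"
  by (induction k) (simp_all add: monom_0 monom_Suc peval_const peval_pCons peval_0 scalar_0 scalar_left_comm)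

lemma vector_annihilator: "\<exists>q. q \<noteq> 0 \<and> app (peval q A) (v :: complex^'n::finite) = 0"
proof -
  define N where "N = card (cart_basis :: (complex^'n) set)"
  define f where "f = (\<lambda>k. app (A ^ k) v)"
  show ?thesis
  \<comment> \<open>Linear dependence speaks of sets of vectors, so a repetition among the iterates
    is treated separately; it directly gives a difference of two monomials.\<close>
  proof (cases "inj_on f {..N}")
    case False
    then obtain i j where ij: "i \<noteq> j" "f i = f j" unfolding inj_on_def by blast
    have "app (peval (monom 1 i + monom (-1) j) A) v = 0"
      using ij(2) by (simp add: peval_add peval_monom app_add app_mult app_scalar f_def vec_eq_iff)
    moreover have "coeff (monom 1 i + monom (-1) j) i = (1::complex)" using ij(1) by simp
    then have "monom 1 i + monom (-1) j \<noteq> (0 :: complex poly)" by (metis coeff_0 zero_neq_one)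
    ultimately show ?thesis by blast
  next
    case True
    then have "card (f ` {..N}) = Suc N" by (simp add: card_image)
    then have "vec.dependent (f ` {..N})"
      using vec.independent_span_bound[OF finite_cart_basis, of "f ` {..N}"] span_cart_basis N_def by force
    then obtain S u w where S: "finite S" "S \<subseteq> f ` {..N}" "(\<Sum>x\<in>S. u x *s x) = 0" "w \<in> S" "u w \<noteq> 0"
      unfolding vec.dependent_explicit by blast
    define K where "K = {k \<in> {..N}. f k \<in> S}"
    have bij: "bij_betw f K S" using True S(2) unfolding K_def bij_betw_def inj_on_def by auto
    define q where "q = (\<Sum>k\<in>K. monom (u (f k)) k)"
    have "app (peval q A) v = (\<Sum>k\<in>K. u (f k) *s f k)"
      by (simp add: q_def peval_sum peval_monom app_sum app_mult app_scalar f_def)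
    also have "\<dots> = 0" using sum.reindex_bij_betw[OF bij, of "\<lambda>x. u x *s x"] S(3) by simp
    finally have 0: "app (peval q A) v = 0" .
    obtain k where k: "k \<in> K" "f k = w" using bij S(4) unfolding bij_betw_def by blast
    have "finite K" by (simp add: K_def)
    then have "coeff q k = u w" using k by (simp add: q_def coeff_sum)
    then have "q \<noteq> 0" using S(5) by auto
    with 0 show ?thesis by blast
  qed
qed

text \<open>Polynomials in one matrix commute, so the product of annihilators of the standard basis
  vectors kills each of them.\<close>

lemma matrix_annihilator: "\<exists>q. q \<noteq> 0 \<and> peval q (A :: 'n::finite sqm) = 0"
proof -
  have "\<forall>i. \<exists>q. q \<noteq> 0 \<and> app (peval q A) (axis i 1) = 0" using vector_annihilator by blast
  then obtain m where m: "\<And>i. m i \<noteq> 0" "\<And>i. app (peval (m i) A) (axis i 1) = 0" by metis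
  define q where "q = (\<Prod>i\<in>(UNIV :: 'n set). m i)"
  have "app (peval q A) (axis i 1) = app 0 (axis i 1)" for i
  proof -
    have "q = (\<Prod>j\<in>UNIV - {i}. m j) * m i" unfolding q_def by (subst prod.remove[of _ i]) (simp_all add: mult.commute)
    then show ?thesis using m(2)[of i] app_vsmult[of "peval (\<Prod>j\<in>UNIV - {i}. m j) A" 0 0]
      by (simp add: peval_mult app_mult app_0)
  qed
  then have "peval q A = 0" by (rule sqm_eqI)
  moreover have "q \<noteq> 0" using m(1) by (simp add: q_def)
  ultimately show ?thesis by blast
qed

lemma common_annihilator:
  assumes "finite Y" shows "\<exists>q. q \<noteq> 0 \<and> (\<forall>y\<in>Y. peval q (y :: 'n::finite sqm) = 0)"
proof -
  obtain m where m: "\<And>y. m y \<noteq> 0 \<and> peval (m y) (y :: 'n sqm) = 0" using matrix_annihilator by metis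
  then have "(\<Prod>y\<in>Y. m y) \<noteq> 0" using assms by simp
  then show ?thesis using peval_prod[OF assms] m by blast
qed

text \<open>Write h = c + X g with c nonzero; then q = - g / c satisfies X q = 1 - h / c, so q(A)
  inverts A wherever h(A) vanishes. The same q serves every A and both sides.\<close>

lemma peval_quasi_inverse:
  assumes k: "poly h 0 \<noteq> 0"
  obtains q where "\<And>A a :: 'n::finite sqm. peval h A * a = 0 \<Longrightarrow> A * peval q A * a = a"
    "\<And>A a :: 'n sqm. a * peval h A = 0 \<Longrightarrow> a * A * peval q A = a"
proof -
  obtain c g where h: "h = pCons c g" by (cases h)
  then have c: "c \<noteq> 0" using k by simp
  define q where "q = smult (- 1 / c) g"
  have "peval q A = scalar (- 1 / c) * peval g A" for A :: "'n sqm" unfolding q_def by (rule peval_smult)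
  then have 1: "A * peval q A = scalar (- 1 / c) * (peval h A - scalar c)" for A :: "'n sqm"
    by (simp add: h peval_pCons scalar_left_comm)
  have 2: "scalar (- 1 / c) * scalar c = (- 1 :: 'n sqm)"
    using c by (simp add: scalar_mult[symmetric] scalar_minus scalar_1)
  have e: "A * peval q A = scalar (- 1 / c) * peval h A + 1" for A :: "'n sqm"
    unfolding 1 right_diff_distrib 2 by simp
  show ?thesis
  proof (rule that[of q])
    fix A a :: "'n sqm"
    show "peval h A * a = 0 \<Longrightarrow> A * peval q A * a = a" unfolding e by (simp add: distrib_right mult.assoc)
    show "a * peval h A = 0 \<Longrightarrow> a * A * peval q A = a"
      unfolding mult.assoc e by (simp add: distrib_left scalar_left_comm)
  qed
qed

text \<open>The heart of the semisimplicity argument. In the situation below, \<open>F = \<Sum>\<^sub>j a\<^sub>j p a\<^sub>j\<close> satisfies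
  \<open>a\<^sub>i F = a\<^sub>i p a\<^sub>i A\<close> and \<open>F a\<^sub>i = A a\<^sub>i p a\<^sub>i\<close>, so that \<open>F B\<close> commutes with every \<open>a\<^sub>i\<close> as soon as \<open>B\<close>
  inverts \<open>A\<close> on the \<open>a\<^sub>i\<close>; on a stable subspace fixed by \<open>p\<close>, \<open>F B\<close> is \<open>\<kappa> A B\<close>.\<close>

locale averaging =
  fixes I :: "'i set" and a :: "'i \<Rightarrow> 'n::finite sqm" and A B p :: "'n sqm" and \<kappa> :: complex
  assumes fin: "finite I" and A: "A = (\<Sum>i\<in>I. a i)" and AB: "A * B = B * A"
    and ABa: "\<And>i. i \<in> I \<Longrightarrow> A * B * a i = a i" and aAB: "\<And>i. i \<in> I \<Longrightarrow> a i * A * B = a i"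
    and exchange: "\<And>i j. i \<in> I \<Longrightarrow> j \<in> I \<Longrightarrow> a i * a j * p * a j = a i * p * a i * a j"
    and square: "\<And>i. i \<in> I \<Longrightarrow> a i * a i = scalar \<kappa> * a i" and \<kappa>: "\<kappa> \<noteq> 0"
begin

definition "F = (\<Sum>j\<in>I. a j * p * a j)"
text \<open>A B is the idempotent onto the part generated by the \<open>a i\<close>, where the
  corrected map is used; on the complementary part, killed by every \<open>a i\<close>, the
  compression of \<open>p\<close> is kept.\<close>

definition "avg = scalar (1 / \<kappa>) * (F * B) + (1 - A * B) * p * (1 - A * B)"

lemma a_F: "i \<in> I \<Longrightarrow> a i * F = a i * p * a i * A"
  unfolding F_def A sum_distrib_left by (rule sum.cong[OF refl]) (simp add: exchange mult.assoc[symmetric])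

lemma F_a: "i \<in> I \<Longrightarrow> F * a i = A * (a i * p * a i)"
  unfolding F_def A sum_distrib_right
  by (rule sum.cong[OF refl]) (simp add: exchange[symmetric] mult.assoc[symmetric])

lemma AB_F: "A * B * F = F" unfolding F_def sum_distrib_left
  by (rule sum.cong[OF refl]) (simp add: ABa mult.assoc[symmetric])

lemma F_AB: "F * (A * B) = F" unfolding F_def sum_distrib_right
  by (rule sum.cong[OF refl]) (simp add: aAB[unfolded mult.assoc] mult.assoc)

lemma A_F: "A * F = F * A"
proof -
  have "A * F = (\<Sum>i\<in>I. a i * p * a i * A)" by (simp add: A[of] sum_distrib_right a_F)
  then show ?thesis by (simp add: F_def sum_distrib_right)
qed

text \<open>\<open>B\<close> is tied to \<open>A\<close> alone. Inserting A B on one side of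
  \<open>F\<close> and cancelling it on the other transfers the commutation from \<open>A\<close> to
  \<open>B\<close>.\<close>

lemma B_F: "B * F = F * B"
proof -
  have "B * F = B * (F * (A * B))" by (simp only: F_AB)
  also have "\<dots> = B * (A * F) * B" unfolding A_F by (simp only: mult.assoc)
  also have "\<dots> = (A * B * F) * B" unfolding AB by (simp only: mult.assoc)
  finally show ?thesis unfolding AB_F .
qed

lemma a_FB: "i \<in> I \<Longrightarrow> a i * (F * B) = a i * p * a i"
proof -
  assume i: "i \<in> I"
  have "a i * (F * B) = a i * F * B" by (simp only: mult.assoc)
  also have "\<dots> = a i * p * (a i * A * B)" unfolding a_F[OF i] by (simp only: mult.assoc)
  finally show ?thesis unfolding aAB[OF i] .
qed

lemma FB_a: "i \<in> I \<Longrightarrow> F * B * a i = a i * p * a i"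
proof -
  assume i: "i \<in> I"
  have "F * B * a i = B * (F * a i)" unfolding B_F[symmetric] by (simp only: mult.assoc)
  also have "\<dots> = (A * B * a i) * p * a i" unfolding F_a[OF i] AB by (simp only: mult.assoc)
  finally show ?thesis unfolding ABa[OF i] .
qed

lemma kill: "i \<in> I \<Longrightarrow> a i * (1 - A * B) = 0" "i \<in> I \<Longrightarrow> (1 - A * B) * a i = 0"
  using aAB ABa by (simp_all add: right_diff_distrib left_diff_distrib mult.assoc)

lemma avg_commute_a: "i \<in> I \<Longrightarrow> a i * avg = avg * a i"
proof -
  assume i: "i \<in> I"
  have "a i * avg = scalar (1 / \<kappa>) * (a i * (F * B)) + (a i * (1 - A * B)) * p * (1 - A * B)"
    unfolding avg_def distrib_left scalar_left_comm by (simp only: mult.assoc)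
  also have "\<dots> = scalar (1 / \<kappa>) * (F * B * a i) + (1 - A * B) * p * ((1 - A * B) * a i)"
    unfolding kill[OF i] a_FB[OF i] FB_a[OF i] by simp
  also have "\<dots> = avg * a i" unfolding avg_def distrib_right by (simp only: mult.assoc)
  finally show ?thesis .
qed

lemma AB_idem: "(1 - A * B) * (1 - A * B) = 1 - A * B"
proof -
  have ABA: "A * B * A = A"
  proof -
    have "A * B * A = A * B * (\<Sum>i\<in>I. a i)" by (simp only: A[symmetric])
    also have "\<dots> = (\<Sum>i\<in>I. a i)" unfolding sum_distrib_left by (rule sum.cong[OF refl]) (rule ABa)
    also have "\<dots> = A" by (simp only: A[symmetric])
    finally show ?thesis .
  qed
  have "A * B * (A * B) = A * B" using ABA by (metis mult.assoc)
  then show ?thesis by (simp add: algebra_simps)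
qed

lemma avg_range:
  assumes U: "\<And>u v. u \<in> U \<Longrightarrow> v \<in> U \<Longrightarrow> u + v \<in> U" "\<And>c u. u \<in> U \<Longrightarrow> c *s u \<in> U" "0 \<in> U"
    and p: "\<And>v. app p v \<in> U" and a: "\<And>i u. i \<in> I \<Longrightarrow> u \<in> U \<Longrightarrow> app (a i) u \<in> U"
    and B: "\<And>u. u \<in> U \<Longrightarrow> app B u \<in> U"
  shows "app avg v \<in> U"
proof -
  have sumU: "finite J \<Longrightarrow> (\<And>j. j \<in> J \<Longrightarrow> f j \<in> U) \<Longrightarrow> sum f J \<in> U" for J :: "'i set" and f
    by (induction J rule: finite_induct) (use U in auto)
  have F: "app F w \<in> U" for w
    unfolding F_def app_sum app_mult by (rule sumU[OF fin]) (simp add: a p)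
  have AU: "app A u \<in> U" if "u \<in> U" for u
    unfolding A app_sum by (rule sumU[OF fin]) (simp add: a that)
  have "app (1 - A * B) u \<in> U" if "u \<in> U" for u
  proof -
    have "app (1 - A * B) u = u + (-1) *s app A (app B u)"
      using app_add[of "1 - A * B" "A * B" u] by (simp add: app_1 app_mult vec_eq_iff algebra_simps)
    then show ?thesis using U(1)[OF that U(2)[OF AU[OF B[OF that]], of "-1"]] by simp
  qed
  then show ?thesis unfolding avg_def app_add app_mult app_scalar using U F p by simp
qed

text \<open>On the stable subspace \<open>p\<close> is the identity, so \<open>F\<close> acts there
  as \<kappa> A; the two summands contribute A B and 1 - A B.\<close>

lemma avg_fix:
  assumes u: "u \<in> U" and p: "\<And>u. u \<in> U \<Longrightarrow> app p u = u" and a: "\<And>i u. i \<in> I \<Longrightarrow> u \<in> U \<Longrightarrow> app (a i) u \<in> U"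
    and AB': "\<And>u. u \<in> U \<Longrightarrow> app (1 - A * B) u \<in> U"
  shows "app avg u = u"
proof -
  have "app F u = (\<Sum>i\<in>I. app (a i * a i) u)"
    unfolding F_def app_sum by (rule sum.cong[OF refl]) (simp add: app_mult p a u)
  also have "\<dots> = app (scalar \<kappa> * A) u" unfolding A sum_distrib_left app_sum
    by (rule sum.cong[OF refl]) (simp add: square)
  finally have Fu: "app F u = app (scalar \<kappa> * A) u" .
  have "app (scalar (1 / \<kappa>) * (F * B)) u = app (scalar (1 / \<kappa>) * B) (app F u)"
    unfolding B_F[symmetric] by (simp add: app_mult)
  also have "\<dots> = app (scalar (1 / \<kappa>) * B * (scalar \<kappa> * A)) u" unfolding Fu by (simp add: app_mult)
  also have "scalar (1 / \<kappa>) * B * (scalar \<kappa> * A) = A * B"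
  proof -
    have "scalar (1 / \<kappa>) * B * (scalar \<kappa> * A) = scalar (1 / \<kappa>) * scalar \<kappa> * (B * A)"
      by (metis mult.assoc scalar_comm)
    also have "scalar (1 / \<kappa>) * scalar \<kappa> = (1 :: 'n sqm)"
      using \<kappa> by (simp add: scalar_mult[symmetric] scalar_1)
    finally show ?thesis by (simp add: AB)
  qed
  finally have 1: "app (scalar (1 / \<kappa>) * (F * B)) u = app (A * B) u" .
  have "app ((1 - A * B) * p * (1 - A * B)) u = app (1 - A * B) u"
    using p[OF AB'[OF u]] AB_idem by (metis app_mult)
  then have "app avg u = app (A * B + (1 - A * B)) u" unfolding avg_def app_add 1 by simp
  then show ?thesis by (simp add: app_1)
qed

text \<open>\<open>T\<close> permutes the \<open>a i\<close>, so the symmetric expressions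
  \<open>A\<close> and \<open>F\<close> are unaffected by conjugation with it.\<close>

lemma avg_commute:
  assumes T: "\<And>i. i \<in> I \<Longrightarrow> T * a i = a (\<sigma> i) * T" and \<sigma>: "bij_betw \<sigma> I I" and p: "T * p = p * T" and B: "T * B = B * T"
  shows "T * avg = avg * T"
proof -
  have "T * F = (\<Sum>i\<in>I. a (\<sigma> i) * p * a (\<sigma> i)) * T"
    unfolding F_def sum_distrib_left sum_distrib_right
  proof (rule sum.cong[OF refl])
    fix i assume i: "i \<in> I"
    have "T * (a i * p * a i) = (T * a i) * p * a i" by (simp only: mult.assoc)
    also have "\<dots> = a (\<sigma> i) * (T * p) * a i" unfolding T[OF i] by (simp only: mult.assoc)
    also have "\<dots> = a (\<sigma> i) * p * (T * a i)" unfolding p by (simp only: mult.assoc)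
    finally show "T * (a i * p * a i) = a (\<sigma> i) * p * a (\<sigma> i) * T" unfolding T[OF i] by (simp only: mult.assoc)
  qed
  also have "\<dots> = F * T" unfolding F_def using sum.reindex_bij_betw[OF \<sigma>, of "\<lambda>i. a i * p * a i"] by simp
  finally have TF: "T * F = F * T" .
  have "T * A = (\<Sum>i\<in>I. a (\<sigma> i)) * T"
    unfolding A sum_distrib_left sum_distrib_right by (rule sum.cong[OF refl]) (rule T)
  also have "\<dots> = A * T" unfolding A using sum.reindex_bij_betw[OF \<sigma>, of a] by simp
  finally have TA: "T * A = A * T" .
  have c: "T * (1 - A * B) = (1 - A * B) * T"
    using TA B by (simp add: algebra_simps) (metis mult.assoc)
  have "T * avg = scalar (1 / \<kappa>) * ((T * F) * B) + (T * (1 - A * B)) * p * (1 - A * B)"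
    unfolding avg_def distrib_left scalar_left_comm by (simp only: mult.assoc)
  also have "\<dots> = scalar (1 / \<kappa>) * (F * (T * B)) + (1 - A * B) * (T * p) * (1 - A * B)"
    unfolding TF c by (simp only: mult.assoc)
  also have "\<dots> = scalar (1 / \<kappa>) * (F * (B * T)) + (1 - A * B) * p * (T * (1 - A * B))"
    unfolding B p by (simp only: mult.assoc)
  also have "\<dots> = avg * T" unfolding c avg_def distrib_right by (simp only: mult.assoc)
  finally show ?thesis .
qed

end

lemma projection_exists:
  fixes U :: "(complex^'n::finite) set"
  assumes U: "\<And>u v. u \<in> U \<Longrightarrow> v \<in> U \<Longrightarrow> u + v \<in> U" "\<And>c u. u \<in> U \<Longrightarrow> c *s u \<in> U" "0 \<in> U"
  obtains p where "\<And>v. app p v \<in> U" "\<And>u. u \<in> U \<Longrightarrow> app p u = u"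
proof -
  have sub: "vec.subspace U" using U unfolding vec.subspace_def by blast
  obtain g where g: "g ` UNIV \<subseteq> U" "Vector_Spaces.linear (*s) (*s) g" "\<forall>v\<in>U. g (id v) = v"
    using vec.linear_exists_left_inverse_on[OF vec.linear_id sub] by auto
  have w: "app (Abs_sqm (matrix g)) v = g v" for v
    using matrix_works[OF g(2)] by (simp add: app.rep_eq Abs_sqm_inverse)
  show ?thesis by (rule that[of "Abs_sqm (matrix g)"]) (use g w in auto)
qed

section \<open>Generic semisimplicity\<close>

definition classes :: "mat3 set set" where "classes = commclass ` H3R"

definition leader :: "mat3 set \<Rightarrow> mat3" where "leader c = (SOME i. i \<in> H3R \<and> commclass i = c)"

lemma leader: "c \<in> classes \<Longrightarrow> leader c \<in> H3R" "c \<in> classes \<Longrightarrow> commclass (leader c) = c"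
proof -
  assume "c \<in> classes"
  then have "\<exists>i. i \<in> H3R \<and> commclass i = c" unfolding classes_def by blast
  from someI_ex[OF this] show "leader c \<in> H3R" "commclass (leader c) = c" unfolding leader_def by blast+
qed

lemma finite_classes: "finite classes" unfolding classes_def using finite_H3R by blast

lemma classes_intro: "i \<in> H3R \<Longrightarrow> commclass i \<in> classes" by (simp add: classes_def)

lemma leader_noncom: "c \<in> classes \<Longrightarrow> d \<in> classes \<Longrightarrow> c \<noteq> d \<Longrightarrow> \<not> com (leader c) (leader d)"
  using commclass_eq_com[of "leader c" "leader d"] leader by simp

lemma notin_class_noncom: "s \<in> H3R \<Longrightarrow> c \<in> classes \<Longrightarrow> s \<notin> c \<Longrightarrow> \<not> com s (leader c)"
  using in_commclass_com[of s "leader c"] leader by simp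

lemma in_class_com: "c \<in> classes \<Longrightarrow> s \<in> c \<Longrightarrow> s \<in> H3R \<and> commclass s = c"
proof -
  assume c: "c \<in> classes" "s \<in> c"
  then have sc: "s \<in> commclass (leader c)" using leader by simp
  then have s: "s \<in> H3R" by (simp add: commclass_def)
  have "commclass s = commclass (leader c)"
    using commclass_eq_com[OF s leader(1)[OF c(1)]] in_commclass_com[OF s] sc by blast
  then show ?thesis using s leader(2)[OF c(1)] by simp
qed

text \<open>Carries identities obtained by rewriting words over to the matrices of the
  module.\<close>

lemma weq_ev:
  assumes "weq \<tau> u v" "set u \<subseteq> Gens" "set v \<subseteq> Gens"
  shows "prod_list (map (rho \<tau>) u) = prod_list (map (rho \<tau>) v)"
proof -
  have "ev (rho \<tau>) (fa_sub (fa_word u) (fa_smult 1 (fa_word v))) = 0" using assms(1) ev_BI unfolding meq_def by blast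
  then show ?thesis using assms(2,3)
    by (simp add: ev_sub ev_smult ev_word fa_word_FA fa_smult_FA scalar_1)
qed

definition partner :: "mat3 \<Rightarrow> mat3" where "partner i = (SOME j. j \<in> H3R \<and> com i j \<and> i \<noteq> j)"

lemma partner: assumes "i \<in> H3R" shows "partner i \<in> H3R" "com i (partner i)" "i \<noteq> partner i"
proof -
  have "\<exists>j. j \<in> H3R \<and> com i j \<and> i \<noteq> j" using H3R_triple[OF assms] unfolding com_def by metis
  from someI_ex[OF this] show "partner i \<in> H3R" "com i (partner i)" "i \<noteq> partner i" unfolding partner_def by blast+
qed

text \<open>Any two distinct members of the class give the same product by \<open>weq_pair\<close>;
  \<open>leader\<close> and \<open>partner\<close> merely fix one pair.\<close>

definition Pm :: "complex \<Rightarrow> mat3 set \<Rightarrow> bt sqm" where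
  "Pm \<tau> c = Em \<tau> (leader c) * Em \<tau> (partner (leader c))"

lemma Pm_eq:
  assumes "i \<in> H3R" "j \<in> H3R" "com i j" "i \<noteq> j" shows "Pm \<tau> (commclass i) = Em \<tau> i * Em \<tau> j"
proof -
  have c: "commclass i \<in> classes" using classes_intro assms by blast
  define k where "k = leader (commclass i)"
  have k: "k \<in> H3R" "commclass k = commclass i" using leader[OF c] by (simp_all add: k_def)
  note p = partner[OF k(1)]
  have "k \<in> commclass i" "partner k \<in> commclass i" "j \<in> commclass i"
    using commclass_self[OF k(1)] in_commclass_com[OF p(1), of k] com_sym[OF p(2)] in_commclass_com[OF assms(2), of i]
      com_sym[OF assms(3)] k(2) by simp_all
  then have "weq \<tau> [GE i, GE j] [GE k, GE (partner k)]" using weq_pair[OF assms(1)] assms(4) p(3) by blast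
  from weq_ev[OF this] show ?thesis using assms k p by (simp add: Gens_simps Pm_def k_def)
qed

lemma Tm_Pm:
  assumes "w \<in> H3G" "i \<in> H3R"
  shows "Tm w * Pm \<tau> (commclass i) = Pm \<tau> (commclass (conj w i)) * Tm w"
proof -
  note p = partner[OF assms(2)]
  have "Pm \<tau> (commclass (conj w i)) = Em \<tau> (conj w i) * Em \<tau> (conj w (partner i))"
    by (rule Pm_eq) (simp_all add: conj_H3R assms p conj_com_iff conj_inj)
  moreover have "Pm \<tau> (commclass i) = Em \<tau> i * Em \<tau> (partner i)" by (rule Pm_eq[OF assms(2) p])
  ultimately show ?thesis
    using Tm_Em[OF assms, of \<tau>] Tm_Em[OF assms(1) p(1), of \<tau>] by (metis mult.assoc)
qed

lemma Em_Pm_in: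
  assumes "s \<in> H3R"
  shows "Em \<tau> s * Pm \<tau> (commclass s) = scalar \<tau> * Pm \<tau> (commclass s)"
    "Pm \<tau> (commclass s) * Em \<tau> s = scalar \<tau> * Pm \<tau> (commclass s)"
proof -
  note p = partner[OF assms]
  have P: "Pm \<tau> (commclass s) = Em \<tau> s * Em \<tau> (partner s)" by (rule Pm_eq[OF assms p])
  then have P': "Pm \<tau> (commclass s) = Em \<tau> (partner s) * Em \<tau> s" using Em_commute[OF assms p(1,2)] by simp
  show "Em \<tau> s * Pm \<tau> (commclass s) = scalar \<tau> * Pm \<tau> (commclass s)"
    unfolding P by (simp add: mult.assoc[symmetric] Em_square[OF assms])
  show "Pm \<tau> (commclass s) * Em \<tau> s = scalar \<tau> * Pm \<tau> (commclass s)"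
    unfolding P' by (simp add: mult.assoc Em_square[OF assms] scalar_left_comm)
qed

lemma Em_Pm_out:
  assumes "s \<in> H3R" "i \<in> H3R" "\<not> com s i"
  shows "Em \<tau> s * Pm \<tau> (commclass i) = Tm (swapper s i) * Pm \<tau> (commclass i)"
proof -
  note p = partner[OF assms(2)]
  have P: "Pm \<tau> (commclass i) = Em \<tau> i * Em \<tau> (partner i)" by (rule Pm_eq[OF assms(2) p])
  show ?thesis unfolding P mult.assoc[symmetric] Em_noncom(1)[OF assms] ..
qed

lemma Pm_Em_out:
  assumes "i \<in> H3R" "s \<in> H3R" "\<not> com i s"
  shows "Pm \<tau> (commclass i) * Em \<tau> s = Pm \<tau> (commclass i) * Tm (swapper i s)"
proof -
  note p = partner[OF assms(1)]
  have P: "Pm \<tau> (commclass i) = Em \<tau> (partner i) * Em \<tau> i"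
    using Pm_eq[OF assms(1) p] Em_commute[OF assms(1) p(1,2)] by simp
  show ?thesis unfolding P mult.assoc Em_noncom(2)[OF assms] ..
qed

lemma Pm_square: "c \<in> classes \<Longrightarrow> Pm \<tau> c * Pm \<tau> c = scalar (\<tau> * \<tau>) * Pm \<tau> c"
proof -
  assume c: "c \<in> classes"
  note l = leader[OF c]
  note p = partner[OF l(1)]
  have "commclass (partner (leader c)) = commclass (leader c)"
    using commclass_eq_com[OF p(1) l(1)] com_sym[OF p(2)] by blast
  then have e: "Em \<tau> (partner (leader c)) * Pm \<tau> c = scalar \<tau> * Pm \<tau> c"
    using Em_Pm_in(1)[OF p(1)] l(2) by simp
  have "Pm \<tau> c * Pm \<tau> c = Em \<tau> (leader c) * (Em \<tau> (partner (leader c)) * Pm \<tau> c)"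
    by (subst Pm_def) (simp only: mult.assoc)
  also have "\<dots> = scalar \<tau> * (Em \<tau> (leader c) * Pm \<tau> c)" unfolding e scalar_left_comm ..
  also have "\<dots> = scalar (\<tau> * \<tau>) * Pm \<tau> c"
    using Em_Pm_in(1)[OF l(1), of \<tau>] l(2) by (simp add: scalar_mult mult.assoc)
  finally show ?thesis .
qed

definition class_swap :: "mat3 set \<Rightarrow> mat3 set \<Rightarrow> mat3" where
  "class_swap c d = swapper (leader c) (leader d)"

lemma class_swap_H3G: "c \<in> classes \<Longrightarrow> d \<in> classes \<Longrightarrow> c \<noteq> d \<Longrightarrow> class_swap c d \<in> H3G"
  unfolding class_swap_def using swapper(3)[OF leader(1) leader(1) leader_noncom] by blast

text \<open>The generator of the leader of \<open>c\<close>, put next to \<open>Pm \<tau> d\<close>,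
  acts as the class swapper. Moving the swapper to the right turns \<open>Pm \<tau> d\<close> into
  \<open>Pm \<tau> c\<close>, on which the remaining factor is the scalar \<tau>.\<close>

lemma Pm_Pm:
  assumes "c \<in> classes" "d \<in> classes" "c \<noteq> d"
  shows "Pm \<tau> c * Pm \<tau> d = scalar \<tau> * (Tm (class_swap c d) * Pm \<tau> d)"
    and "Tm (class_swap c d) * Pm \<tau> d = Pm \<tau> c * Tm (class_swap c d)"
proof -
  note lc = leader[OF assms(1)] and ld = leader[OF assms(2)]
  note p = partner[OF lc(1)]
  note nc = leader_noncom[OF assms]
  note sw = swapper(3,4)[OF lc(1) ld(1) nc, folded class_swap_def]
  show 2: "Tm (class_swap c d) * Pm \<tau> d = Pm \<tau> c * Tm (class_swap c d)"
    using Tm_Pm[OF sw(1) ld(1), of \<tau>] unfolding sw(2) lc(2) ld(2) .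
  have "commclass (partner (leader c)) = commclass (leader c)"
    using commclass_eq_com[OF p(1) lc(1)] com_sym[OF p(2)] by blast
  then have e: "Em \<tau> (partner (leader c)) * Pm \<tau> c = scalar \<tau> * Pm \<tau> c"
    using Em_Pm_in(1)[OF p(1)] lc(2) by simp
  have f: "Em \<tau> (leader c) * Pm \<tau> d = Tm (class_swap c d) * Pm \<tau> d"
    using Em_Pm_out[OF lc(1) ld(1) nc] unfolding class_swap_def ld(2) .
  have "Pm \<tau> c * Pm \<tau> d = Em \<tau> (partner (leader c)) * (Em \<tau> (leader c) * Pm \<tau> d)"
    using Em_commute[OF lc(1) p(1,2)] unfolding Pm_def[of \<tau> c] by (simp only: mult.assoc)
  also have "\<dots> = (Em \<tau> (partner (leader c)) * Pm \<tau> c) * Tm (class_swap c d)" unfolding f 2 by (simp only: mult.assoc)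
  also have "\<dots> = scalar \<tau> * (Tm (class_swap c d) * Pm \<tau> d)" unfolding e 2 by (simp only: mult.assoc)
  finally show "Pm \<tau> c * Pm \<tau> d = scalar \<tau> * (Tm (class_swap c d) * Pm \<tau> d)" .
qed

definition "Psum \<tau> = (\<Sum>c\<in>classes. Pm \<tau> c)"
definition "Esum \<tau> = (\<Sum>s\<in>H3R. Em \<tau> s)"

text \<open>Group ring parts of three actions: z for \<open>Psum\<close> on a class product, x for
  \<open>Esum\<close> on a class product, y for \<open>Esum\<close> on a single generator; L and R
  tell from which side the sum multiplies.\<close>

definition "zL d = (\<Sum>c\<in>classes - {d}. Tm (class_swap c d))"
definition "zR c = (\<Sum>d\<in>classes - {c}. Tm (class_swap c d))"
definition "xL c = (\<Sum>s\<in>H3R - c. Tm (swapper s (leader c)))"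
definition "xR c = (\<Sum>s\<in>H3R - c. Tm (swapper (leader c) s))"
definition "yL t = (\<Sum>s\<in>H3R - commclass t. Tm (swapper s t))"
definition "yR t = (\<Sum>s\<in>H3R - commclass t. Tm (swapper t s))"

lemma Psum_Pm: "d \<in> classes \<Longrightarrow> Psum \<tau> * Pm \<tau> d = scalar \<tau> * ((scalar \<tau> + zL d) * Pm \<tau> d)"
proof -
  assume d: "d \<in> classes"
  have "Psum \<tau> * Pm \<tau> d = Pm \<tau> d * Pm \<tau> d + (\<Sum>c\<in>classes - {d}. Pm \<tau> c * Pm \<tau> d)"
    unfolding Psum_def sum_distrib_right by (rule sum.remove[OF finite_classes d])
  also have "(\<Sum>c\<in>classes - {d}. Pm \<tau> c * Pm \<tau> d) = scalar \<tau> * (zL d * Pm \<tau> d)"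
    unfolding zL_def sum_distrib_left sum_distrib_right
    by (rule sum.cong[OF refl]) (use Pm_Pm(1) d in simp)
  finally show ?thesis by (simp add: Pm_square[OF d] scalar_mult distrib_left distrib_right mult.assoc)
qed

lemma Pm_Psum: "c \<in> classes \<Longrightarrow> Pm \<tau> c * Psum \<tau> = scalar \<tau> * (Pm \<tau> c * (scalar \<tau> + zR c))"
proof -
  assume c: "c \<in> classes"
  have "Pm \<tau> c * Psum \<tau> = Pm \<tau> c * Pm \<tau> c + (\<Sum>d\<in>classes - {c}. Pm \<tau> c * Pm \<tau> d)"
    unfolding Psum_def sum_distrib_left by (rule sum.remove[OF finite_classes c])
  also have "(\<Sum>d\<in>classes - {c}. Pm \<tau> c * Pm \<tau> d) = scalar \<tau> * (Pm \<tau> c * zR c)"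
    unfolding zR_def sum_distrib_left
  proof (rule sum.cong[OF refl])
    fix d assume "d \<in> classes - {c}"
    then have d: "d \<in> classes" "c \<noteq> d" by auto
    show "Pm \<tau> c * Pm \<tau> d = scalar \<tau> * (Pm \<tau> c * Tm (class_swap c d))"
      using Pm_Pm(1)[OF c d] unfolding Pm_Pm(2)[OF c d] .
  qed
  finally show ?thesis
    by (simp add: Pm_square[OF c] scalar_mult distrib_left mult.assoc scalar_comm[of \<tau> "Pm \<tau> c", symmetric])
qed

lemma commclass_subset: "commclass t \<subseteq> H3R" by (auto simp: commclass_def)

lemma card_commclass: "s \<in> H3R \<Longrightarrow> card (commclass s) = 3"
proof -
  assume "s \<in> H3R"
  then obtain j k where "commclass s = {s, j, k}" "s \<noteq> j" "s \<noteq> k" "j \<noteq> k" using H3R_triple by metis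
  then show ?thesis by simp
qed

lemma class_subset: "c \<in> classes \<Longrightarrow> c \<subseteq> H3R" using in_class_com by blast

lemma sum_H3R_split:
  fixes f :: "mat3 \<Rightarrow> bt sqm"
  assumes "c \<subseteq> H3R" shows "(\<Sum>s\<in>H3R. f s) = (\<Sum>s\<in>c. f s) + (\<Sum>s\<in>H3R - c. f s)"
  using sum.subset_diff[OF assms finite_H3R, of f] by (simp add: add.commute)

lemma card_class: "c \<in> classes \<Longrightarrow> card c = 3" unfolding classes_def using card_commclass by blast

lemma scalar_of_nat: "scalar (of_nat n) = of_nat n"
  by (induction n) (simp_all add: scalar_0 scalar_1 scalar_add)

lemma Esum_Pm: "c \<in> classes \<Longrightarrow> Esum \<tau> * Pm \<tau> c = (scalar (3 * \<tau>) + xL c) * Pm \<tau> c"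
proof -
  assume c: "c \<in> classes"
  have "Esum \<tau> * Pm \<tau> c = (\<Sum>s\<in>c. Em \<tau> s * Pm \<tau> c) + (\<Sum>s\<in>H3R - c. Em \<tau> s * Pm \<tau> c)"
    unfolding Esum_def sum_distrib_right by (rule sum_H3R_split[OF class_subset[OF c]])
  also have "(\<Sum>s\<in>c. Em \<tau> s * Pm \<tau> c) = (\<Sum>s\<in>c. scalar \<tau> * Pm \<tau> c)"
    by (rule sum.cong[OF refl]) (use Em_Pm_in(1) in_class_com[OF c] in metis)
  also have "\<dots> = scalar (3 * \<tau>) * Pm \<tau> c"
    using scalar_of_nat[of 3, where 'a=bt] by (simp add: card_class[OF c] scalar_mult mult.assoc)
  also have "(\<Sum>s\<in>H3R - c. Em \<tau> s * Pm \<tau> c) = xL c * Pm \<tau> c"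
    unfolding xL_def sum_distrib_right
  proof (rule sum.cong[OF refl])
    fix s assume s: "s \<in> H3R - c"
    then show "Em \<tau> s * Pm \<tau> c = Tm (swapper s (leader c)) * Pm \<tau> c"
      using Em_Pm_out[OF _ leader(1)[OF c] notin_class_noncom[OF _ c], of s \<tau>] leader(2)[OF c] by simp
  qed
  finally show ?thesis by (simp add: distrib_right)
qed

lemma Pm_Esum: "c \<in> classes \<Longrightarrow> Pm \<tau> c * Esum \<tau> = Pm \<tau> c * (scalar (3 * \<tau>) + xR c)"
proof -
  assume c: "c \<in> classes"
  have "Pm \<tau> c * Esum \<tau> = (\<Sum>s\<in>c. Pm \<tau> c * Em \<tau> s) + (\<Sum>s\<in>H3R - c. Pm \<tau> c * Em \<tau> s)"
    unfolding Esum_def sum_distrib_left by (rule sum_H3R_split[OF class_subset[OF c]])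
  also have "(\<Sum>s\<in>c. Pm \<tau> c * Em \<tau> s) = (\<Sum>s\<in>c. scalar \<tau> * Pm \<tau> c)"
    by (rule sum.cong[OF refl]) (use Em_Pm_in(2) in_class_com[OF c] in metis)
  also have "\<dots> = Pm \<tau> c * scalar (3 * \<tau>)"
    using scalar_of_nat[of 3, where 'a=bt] scalar_comm[of "3 * \<tau>" "Pm \<tau> c"]
    by (simp add: card_class[OF c] scalar_mult mult.assoc)
  also have "(\<Sum>s\<in>H3R - c. Pm \<tau> c * Em \<tau> s) = Pm \<tau> c * xR c"
    unfolding xR_def sum_distrib_left
  proof (rule sum.cong[OF refl])
    fix s assume s: "s \<in> H3R - c"
    then have "\<not> com (leader c) s" using notin_class_noncom[OF _ c, of s] com_sym by blast
    then show "Pm \<tau> c * Em \<tau> s = Pm \<tau> c * Tm (swapper (leader c) s)"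
      using Pm_Em_out[OF leader(1)[OF c], of s \<tau>] s leader(2)[OF c] by simp
  qed
  finally show ?thesis by (simp add: distrib_left)
qed

text \<open>The two other members of the class of \<open>t\<close> each contribute the class
  product. This correction is what makes the action of \<open>Esum\<close> triangular instead of
  scalar plus group ring.\<close>

lemma Esum_Em:
  assumes t: "t \<in> H3R"
  shows "Esum \<tau> * Em \<tau> t = (scalar \<tau> + yL t) * Em \<tau> t + of_nat 2 * Pm \<tau> (commclass t)"
    and "Em \<tau> t * Esum \<tau> = Em \<tau> t * (scalar \<tau> + yR t) + of_nat 2 * Pm \<tau> (commclass t)"
proof -
  have fin: "finite (commclass t)" using finite_subset[OF commclass_subset finite_H3R] .
  have card: "card (commclass t - {t}) = 2" using card_commclass[OF t] commclass_self[OF t] fin by simp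
  have inner: "Em \<tau> s * Em \<tau> t = Pm \<tau> (commclass t) \<and> Em \<tau> t * Em \<tau> s = Pm \<tau> (commclass t)"
    if "s \<in> commclass t - {t}" for s
  proof -
    have s: "s \<in> H3R" "com t s" "t \<noteq> s" using that by (auto simp: commclass_def com_def)
    then show ?thesis using Pm_eq[OF t s] Em_commute[OF t s(1,2)] by simp
  qed
  have outer: "\<not> com s t" "\<not> com t s" "s \<in> H3R" if "s \<in> H3R - commclass t" for s
    using that in_commclass_com[of s t] com_sym by blast+
  have "Esum \<tau> * Em \<tau> t = (\<Sum>s\<in>commclass t. Em \<tau> s * Em \<tau> t) + (\<Sum>s\<in>H3R - commclass t. Em \<tau> s * Em \<tau> t)"
    unfolding Esum_def sum_distrib_right by (rule sum_H3R_split[OF commclass_subset])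
  also have "(\<Sum>s\<in>commclass t. Em \<tau> s * Em \<tau> t) = Em \<tau> t * Em \<tau> t + (\<Sum>s\<in>commclass t - {t}. Em \<tau> s * Em \<tau> t)"
    by (rule sum.remove[OF fin commclass_self[OF t]])
  also have "(\<Sum>s\<in>commclass t - {t}. Em \<tau> s * Em \<tau> t) = of_nat 2 * Pm \<tau> (commclass t)"
    using sum.cong[OF refl, of "commclass t - {t}" "\<lambda>s. Em \<tau> s * Em \<tau> t" "\<lambda>_. Pm \<tau> (commclass t)"] inner card
    by simp
  also have "(\<Sum>s\<in>H3R - commclass t. Em \<tau> s * Em \<tau> t) = yL t * Em \<tau> t"
    unfolding yL_def sum_distrib_right by (rule sum.cong[OF refl]) (rule Em_noncom(1)[OF outer(3) t outer(1)])
  finally show "Esum \<tau> * Em \<tau> t = (scalar \<tau> + yL t) * Em \<tau> t + of_nat 2 * Pm \<tau> (commclass t)"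
    unfolding Em_square[OF t] by (simp add: distrib_right)
  have "Em \<tau> t * Esum \<tau> = (\<Sum>s\<in>commclass t. Em \<tau> t * Em \<tau> s) + (\<Sum>s\<in>H3R - commclass t. Em \<tau> t * Em \<tau> s)"
    unfolding Esum_def sum_distrib_left by (rule sum_H3R_split[OF commclass_subset])
  also have "(\<Sum>s\<in>commclass t. Em \<tau> t * Em \<tau> s) = Em \<tau> t * Em \<tau> t + (\<Sum>s\<in>commclass t - {t}. Em \<tau> t * Em \<tau> s)"
    by (rule sum.remove[OF fin commclass_self[OF t]])
  also have "(\<Sum>s\<in>commclass t - {t}. Em \<tau> t * Em \<tau> s) = of_nat 2 * Pm \<tau> (commclass t)"
    using sum.cong[OF refl, of "commclass t - {t}" "\<lambda>s. Em \<tau> t * Em \<tau> s" "\<lambda>_. Pm \<tau> (commclass t)"] inner card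
    by simp
  also have "(\<Sum>s\<in>H3R - commclass t. Em \<tau> t * Em \<tau> s) = Em \<tau> t * yR t"
    unfolding yR_def sum_distrib_left by (rule sum.cong[OF refl]) (rule Em_noncom(2)[OF t outer(3) outer(2)])
  finally show "Em \<tau> t * Esum \<tau> = Em \<tau> t * (scalar \<tau> + yR t) + of_nat 2 * Pm \<tau> (commclass t)"
    unfolding Em_square[OF t] by (simp add: distrib_left scalar_comm)
qed

lemma conj_bij: "w \<in> H3G \<Longrightarrow> bij_betw (conj w) H3R H3R"
  by (rule bij_betw_byWitness[where f'="conj (matrix_inv w)"])
    (auto simp: conj_inv conj_H3R conj_inv_H3R)

lemma conj_image_class: "w \<in> H3G \<Longrightarrow> c \<in> classes \<Longrightarrow> conj w ` c = commclass (conj w (leader c))"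
  using conj_commclass[of w "leader c"] leader by simp

lemma conj_bij_classes: "w \<in> H3G \<Longrightarrow> bij_betw (\<lambda>c. conj w ` c) classes classes"
proof (rule bij_betw_byWitness[where f'="\<lambda>c. conj (matrix_inv w) ` c"])
  assume w: "w \<in> H3G"
  have im: "conj v ` c \<in> classes" if "v \<in> H3G" "c \<in> classes" for v c
    unfolding conj_image_class[OF that] using classes_intro conj_H3R leader that by blast
  show "(\<lambda>c. conj w ` c) ` classes \<subseteq> classes" "(\<lambda>c. conj (matrix_inv w) ` c) ` classes \<subseteq> classes"
    using im w H3G_inv by blast+
qed (simp_all add: image_image conj_inv)

lemma Tm_Pm_class: "w \<in> H3G \<Longrightarrow> c \<in> classes \<Longrightarrow> Tm w * Pm \<tau> c = Pm \<tau> (conj w ` c) * Tm w"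
  using Tm_Pm[of w "leader c" \<tau>] conj_image_class[of w c] leader by simp

lemma Tm_Psum: assumes "w \<in> H3G" shows "Tm w * Psum \<tau> = Psum \<tau> * Tm w"
proof -
  have "Tm w * Psum \<tau> = (\<Sum>c\<in>classes. Pm \<tau> (conj w ` c)) * Tm w"
    unfolding Psum_def sum_distrib_left sum_distrib_right
    by (rule sum.cong[OF refl]) (rule Tm_Pm_class[OF assms])
  then show ?thesis unfolding Psum_def using sum.reindex_bij_betw[OF conj_bij_classes[OF assms], of "Pm \<tau>"] by simp
qed

lemma Tm_Esum: assumes "w \<in> H3G" shows "Tm w * Esum \<tau> = Esum \<tau> * Tm w"
proof -
  have "Tm w * Esum \<tau> = (\<Sum>s\<in>H3R. Em \<tau> (conj w s)) * Tm w"
    unfolding Esum_def sum_distrib_left sum_distrib_right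
    by (rule sum.cong[OF refl]) (rule Tm_Em[OF assms])
  then show ?thesis unfolding Esum_def using sum.reindex_bij_betw[OF conj_bij[OF assms], of "Em \<tau>"] by simp
qed

lemma sum_commute:
  fixes X :: "'r::ring_1"
  assumes "\<And>i. i \<in> J \<Longrightarrow> f i * X = X * f i" shows "sum f J * X = X * sum f J"
  unfolding sum_distrib_left sum_distrib_right by (rule sum.cong[OF refl]) (rule assms)

text \<open>All six are sums of group elements; this supplies the commutation that
  \<open>peval_intertwine\<close> asks for.\<close>

lemma group_sums_commute:
  assumes X: "\<And>w. w \<in> H3G \<Longrightarrow> Tm w * X = X * Tm w"
  shows "c \<in> classes \<Longrightarrow> zL c * X = X * zL c" "c \<in> classes \<Longrightarrow> zR c * X = X * zR c"
    "c \<in> classes \<Longrightarrow> xL c * X = X * xL c" "c \<in> classes \<Longrightarrow> xR c * X = X * xR c"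
    "t \<in> H3R \<Longrightarrow> yL t * X = X * yL t" "t \<in> H3R \<Longrightarrow> yR t * X = X * yR t"
proof -
  assume c: "c \<in> classes"
  show "zL c * X = X * zL c" "zR c * X = X * zR c" unfolding zL_def zR_def
    by (rule sum_commute, rule X, rule class_swap_H3G, use c in auto)+
  have nc: "\<not> com s (leader c)" "\<not> com (leader c) s" if "s \<in> H3R - c" for s
    using notin_class_noncom[OF _ c, of s] that com_sym by blast+
  show "xL c * X = X * xL c" unfolding xL_def
    by (rule sum_commute, rule X, rule swapper(3)[OF _ leader(1)[OF c] nc(1)]) blast+
  show "xR c * X = X * xR c" unfolding xR_def
    by (rule sum_commute, rule X, rule swapper(3)[OF leader(1)[OF c] _ nc(2)]) blast+
next
  assume t: "t \<in> H3R"
  have outer: "\<not> com s t" "\<not> com t s" if "s \<in> H3R - commclass t" for s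
    using that in_commclass_com[of s t] com_sym by blast+
  show "yL t * X = X * yL t" unfolding yL_def
    by (rule sum_commute, rule X, rule swapper(3)[OF _ t outer(1)]) blast+
  show "yR t * X = X * yR t" unfolding yR_def
    by (rule sum_commute, rule X, rule swapper(3)[OF t _ outer(2)]) blast+
qed

lemma peval_linear: "peval [:b, a:] A = scalar a * A + scalar b"
  by (simp add: peval_pCons peval_0 scalar_comm add.commute)

text \<open>Multiplication by \<open>Psum\<close> and \<open>Esum\<close> on the \<open>Pm c\<close> and \<open>Em t\<close> is a multiple of \<open>\<tau>\<close> plus one of the
  group ring elements below, up to a factor \<open>\<tau>\<close>. These do not involve \<open>\<tau>\<close>, so neither does \<open>m\<close>.\<close>

definition annihilates :: "complex poly \<Rightarrow> bool" where
  "annihilates m \<longleftrightarrow> (\<forall>c\<in>classes. peval m (zL c) = 0 \<and> peval m (zR c) = 0 \<and> peval m (xL c) = 0 \<and> peval m (xR c) = 0)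
     \<and> (\<forall>t\<in>H3R. peval m (yL t) = 0 \<and> peval m (yR t) = 0)"

lemma annihilates_exists: "\<exists>m. m \<noteq> 0 \<and> annihilates m"
proof -
  have "finite (zL ` classes \<union> zR ` classes \<union> xL ` classes \<union> xR ` classes \<union> yL ` H3R \<union> yR ` H3R)"
    using finite_classes finite_H3R by simp
  from common_annihilator[OF this] obtain m where m: "m \<noteq> 0"
    "\<forall>y\<in>zL ` classes \<union> zR ` classes \<union> xL ` classes \<union> xR ` classes \<union> yL ` H3R \<union> yR ` H3R. peval m y = 0"
    by blast
  then have "annihilates m" unfolding annihilates_def by simp
  then show ?thesis using m(1) by blast
qed

text \<open>The operator \<open>B\<close>, that is \<open>Psum\<close> divided by \<tau> minus
  \<tau>, acts on \<open>Pm \<tau> c\<close> as \<open>zL c\<close>, so m(B) vanishes there.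
  Substituting gives h(X) = m(X / \<tau> - \<tau>), with constant term m(- \<tau>).\<close>

lemma Psum_inverse:
  assumes "\<tau> \<noteq> 0" "annihilates m" "poly m (- \<tau>) \<noteq> 0"
  obtains q where "\<And>c. c \<in> classes \<Longrightarrow> Psum \<tau> * peval q (Psum \<tau>) * Pm \<tau> c = Pm \<tau> c"
    "\<And>c. c \<in> classes \<Longrightarrow> Pm \<tau> c * Psum \<tau> * peval q (Psum \<tau>) = Pm \<tau> c"
proof -
  define h where "h = pcompose m [:- \<tau>, 1 / \<tau>:]"
  define B where "B = scalar (1 / \<tau>) * Psum \<tau> + scalar (- \<tau>)"
  have hB: "peval h (Psum \<tau>) = peval m B" by (simp only: h_def B_def peval_pcompose peval_linear)
  have "poly h 0 \<noteq> 0" using assms(3) by (simp add: h_def poly_pcompose)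
  then obtain q where q: "\<And>A a :: bt sqm. peval h A * a = 0 \<Longrightarrow> A * peval q A * a = a"
    "\<And>A a :: bt sqm. a * peval h A = 0 \<Longrightarrow> a * A * peval q A = a"
    using peval_quasi_inverse by metis
  have inv: "scalar (1 / \<tau>) * scalar \<tau> = (1 :: bt sqm)"
    using assms(1) by (simp add: scalar_mult[symmetric] scalar_1)
  have TB: "Tm w * B = B * Tm w" if "w \<in> H3G" for w
    unfolding B_def distrib_left distrib_right scalar_left_comm[of "Tm w"] Tm_Psum[OF that]
      scalar_comm[of "- \<tau>" "Tm w"] by (simp only: mult.assoc)
  show ?thesis
  proof (rule that[of q])
    fix c assume c: "c \<in> classes"
    have "scalar (1 / \<tau>) * Psum \<tau> * Pm \<tau> c = scalar (1 / \<tau>) * scalar \<tau> * ((scalar \<tau> + zL c) * Pm \<tau> c)"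
      unfolding mult.assoc Psum_Pm[OF c] ..
    then have "B * Pm \<tau> c = zL c * Pm \<tau> c"
      unfolding inv B_def by (simp add: distrib_right left_diff_distrib scalar_minus)
    then have "peval m B * Pm \<tau> c = peval m (zL c) * Pm \<tau> c"
      by (rule peval_intertwine) (rule group_sums_commute(1)[OF TB c])
    then show "Psum \<tau> * peval q (Psum \<tau>) * Pm \<tau> c = Pm \<tau> c"
      using q(1)[of "Psum \<tau>"] assms(2) c unfolding hB annihilates_def by simp
    have "Pm \<tau> c * (scalar (1 / \<tau>) * Psum \<tau>) = scalar (1 / \<tau>) * (Pm \<tau> c * Psum \<tau>)" by (rule scalar_left_comm)
    also have "\<dots> = scalar (1 / \<tau>) * scalar \<tau> * (Pm \<tau> c * (scalar \<tau> + zR c))"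
      unfolding Pm_Psum[OF c] by (simp only: mult.assoc)
    finally have "Pm \<tau> c * B = Pm \<tau> c * zR c"
      unfolding inv B_def by (simp add: distrib_left right_diff_distrib scalar_minus)
    then have "Pm \<tau> c * peval m B = Pm \<tau> c * peval m (zR c)"
      by (rule peval_intertwine_right) (rule group_sums_commute(2)[OF TB c])
    then show "Pm \<tau> c * Psum \<tau> * peval q (Psum \<tau>) = Pm \<tau> c"
      using q(2)[of "Pm \<tau> c" "Psum \<tau>"] assms(2) c unfolding hB annihilates_def by simp
  qed
qed

text \<open>Powers of \<open>D\<close> act on the generator as powers of \<open>yL t\<close> up to
  class products. \<open>Q\<close> collects the correction; its commutation with \<open>Esum\<close>
  later lets a second polynomial pass through it and reach the class product.\<close>

lemma Esum_intertwine:
  assumes t: "t \<in> H3R" and D: "D = Esum \<tau> - scalar \<tau>"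
  shows "\<exists>Q. Q * Esum \<tau> = Esum \<tau> * Q \<and> peval m D * Em \<tau> t = peval m (yL t) * Em \<tau> t + Q * Pm \<tau> (commclass t)"
proof (induction m)
  case 0 show ?case by (rule exI[of _ 0]) (simp add: peval_0)
next
  case (pCons a m)
  then obtain Q where Q: "Q * Esum \<tau> = Esum \<tau> * Q"
    "peval m D * Em \<tau> t = peval m (yL t) * Em \<tau> t + Q * Pm \<tau> (commclass t)" by blast
  let ?P = "Pm \<tau> (commclass t)"
  have yE: "yL t * Esum \<tau> = Esum \<tau> * yL t" using group_sums_commute(5)[OF Tm_Esum t] .
  have yD: "yL t * D = D * yL t" unfolding D by (simp add: algebra_simps yE scalar_comm)
  have DE: "D * Esum \<tau> = Esum \<tau> * D" unfolding D by (simp add: algebra_simps scalar_comm)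
  have pD: "D * peval m (yL t) = peval m (yL t) * D" using peval_commute[OF yD[symmetric]] .
  have pE: "Esum \<tau> * peval m (yL t) = peval m (yL t) * Esum \<tau>" using peval_commute[OF yE[symmetric]] .
  have De: "D * Em \<tau> t = yL t * Em \<tau> t + of_nat 2 * ?P"
    unfolding D left_diff_distrib Esum_Em(1)[OF t] by (simp add: distrib_right)
  define Q' where "Q' = peval m (yL t) * of_nat 2 + D * Q"
  have "peval (pCons a m) D * Em \<tau> t = scalar a * Em \<tau> t + D * (peval m D * Em \<tau> t)"
    by (simp only: peval_pCons distrib_right mult.assoc)
  also have "\<dots> = scalar a * Em \<tau> t + peval m (yL t) * (D * Em \<tau> t) + D * Q * ?P"
    unfolding Q(2) distrib_left by (simp only: mult.assoc[symmetric] pD add.assoc)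
  also have "\<dots> = scalar a * Em \<tau> t + peval m (yL t) * yL t * Em \<tau> t + Q' * ?P"
    unfolding De Q'_def distrib_left distrib_right by (simp only: mult.assoc add.assoc)
  also have "peval m (yL t) * yL t = yL t * peval m (yL t)" using peval_commute[of "yL t" "yL t" m] by simp
  finally have "peval (pCons a m) D * Em \<tau> t = peval (pCons a m) (yL t) * Em \<tau> t + Q' * ?P"
    by (simp only: peval_pCons distrib_right mult.assoc)
  moreover have "Q' * Esum \<tau> = Esum \<tau> * Q'"
  proof -
    have "peval m (yL t) * of_nat 2 * Esum \<tau> = Esum \<tau> * (peval m (yL t) * of_nat 2)"
      by (metis pE mult.assoc mult_of_nat_commute)
    moreover have "D * Q * Esum \<tau> = Esum \<tau> * (D * Q)" by (metis Q(1) DE mult.assoc)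
    ultimately show ?thesis unfolding Q'_def distrib_left distrib_right by simp
  qed
  ultimately show ?case by blast
qed

lemma Esum_intertwine_right:
  assumes t: "t \<in> H3R" and D: "D = Esum \<tau> - scalar \<tau>"
  shows "\<exists>Q. Q * Esum \<tau> = Esum \<tau> * Q \<and> Em \<tau> t * peval m D = Em \<tau> t * peval m (yR t) + Pm \<tau> (commclass t) * Q"
proof (induction m)
  case 0 show ?case by (rule exI[of _ 0]) (simp add: peval_0)
next
  case (pCons a m)
  then obtain Q where Q: "Q * Esum \<tau> = Esum \<tau> * Q"
    "Em \<tau> t * peval m D = Em \<tau> t * peval m (yR t) + Pm \<tau> (commclass t) * Q" by blast
  let ?P = "Pm \<tau> (commclass t)"
  have yE: "yR t * Esum \<tau> = Esum \<tau> * yR t" using group_sums_commute(6)[OF Tm_Esum t] .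
  have yD: "yR t * D = D * yR t" unfolding D by (simp add: algebra_simps yE scalar_comm)
  have DE: "D * Esum \<tau> = Esum \<tau> * D" unfolding D by (simp add: algebra_simps scalar_comm)
  have pD: "D * peval m (yR t) = peval m (yR t) * D" using peval_commute[OF yD[symmetric]] .
  have pE: "Esum \<tau> * peval m (yR t) = peval m (yR t) * Esum \<tau>" using peval_commute[OF yE[symmetric]] .
  have De: "Em \<tau> t * D = Em \<tau> t * yR t + of_nat 2 * ?P"
    unfolding D right_diff_distrib Esum_Em(2)[OF t] by (simp add: distrib_left scalar_comm)
  have DD: "D * peval m D = peval m D * D" using peval_commute[of D D m] by simp
  define Q' where "Q' = of_nat 2 * peval m (yR t) + Q * D"
  have "Em \<tau> t * peval (pCons a m) D = Em \<tau> t * scalar a + (Em \<tau> t * peval m D) * D"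
    by (simp only: peval_pCons distrib_left mult.assoc DD)
  also have "\<dots> = Em \<tau> t * scalar a + (Em \<tau> t * D) * peval m (yR t) + ?P * (Q * D)"
    unfolding Q(2) distrib_right by (simp only: mult.assoc pD add.assoc)
  also have "\<dots> = Em \<tau> t * scalar a + Em \<tau> t * (yR t * peval m (yR t)) + (of_nat 2 * ?P * peval m (yR t) + ?P * (Q * D))"
    unfolding De distrib_right by (simp only: mult.assoc add.assoc)
  also have "of_nat 2 * ?P * peval m (yR t) + ?P * (Q * D) = ?P * Q'"
    unfolding Q'_def distrib_left mult_of_nat_commute[of 2 ?P] by (simp only: mult.assoc)
  finally have "Em \<tau> t * peval (pCons a m) D = Em \<tau> t * peval (pCons a m) (yR t) + ?P * Q'"
    by (simp only: peval_pCons distrib_left)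
  moreover have "Q' * Esum \<tau> = Esum \<tau> * Q'"
  proof -
    have "of_nat 2 * peval m (yR t) * Esum \<tau> = Esum \<tau> * (of_nat 2 * peval m (yR t))"
      by (metis pE mult.assoc mult_of_nat_commute)
    moreover have "Q * D * Esum \<tau> = Esum \<tau> * (Q * D)" by (metis Q(1) DE mult.assoc)
    ultimately show ?thesis unfolding Q'_def distrib_left distrib_right by simp
  qed
  ultimately show ?case by blast
qed

text \<open>m(D) sends each generator to a multiple of its class product, and m(D') kills class
  products. Hence h(X) = m(X - \<tau>) m(X - 3 \<tau>) annihilates \<open>Esum\<close> on all
  generators, and the two conditions on \<open>m\<close> say that h(0) is nonzero.\<close>

lemma Esum_inverse:
  assumes "annihilates m" "poly m (- \<tau>) \<noteq> 0" "poly m (- (3 * \<tau>)) \<noteq> 0"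
  obtains q where "\<And>t. t \<in> H3R \<Longrightarrow> Esum \<tau> * peval q (Esum \<tau>) * Em \<tau> t = Em \<tau> t"
    "\<And>t. t \<in> H3R \<Longrightarrow> Em \<tau> t * Esum \<tau> * peval q (Esum \<tau>) = Em \<tau> t"
proof -
  define D where "D = Esum \<tau> - scalar \<tau>"
  define D' where "D' = Esum \<tau> - scalar (3 * \<tau>)"
  define h where "h = pcompose m [:- \<tau>, 1:] * pcompose m [:- (3 * \<tau>), 1:]"
  have "peval [:- \<tau>, 1:] (Esum \<tau>) = D" "peval [:- (3 * \<tau>), 1:] (Esum \<tau>) = D'"
    by (simp_all only: peval_linear D_def D'_def scalar_1 scalar_minus) simp_all
  then have hD: "peval h (Esum \<tau>) = peval m D * peval m D'"
    by (simp add: h_def peval_mult peval_pcompose)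
  have hD': "peval h (Esum \<tau>) = peval m D' * peval m D"
    unfolding hD using peval_mult[of "pcompose m [:- \<tau>, 1:]" "pcompose m [:- (3 * \<tau>), 1:]" "Esum \<tau>"]
      peval_mult[of "pcompose m [:- (3 * \<tau>), 1:]" "pcompose m [:- \<tau>, 1:]" "Esum \<tau>"]
      \<open>peval [:- \<tau>, 1:] (Esum \<tau>) = D\<close> \<open>peval [:- (3 * \<tau>), 1:] (Esum \<tau>) = D'\<close>
    by (simp only: peval_pcompose mult.commute[of "pcompose m [:- \<tau>, 1:]"])
  have "poly h 0 \<noteq> 0" using assms(2,3) by (simp add: h_def poly_pcompose)
  then obtain q where q: "\<And>A a :: bt sqm. peval h A * a = 0 \<Longrightarrow> A * peval q A * a = a"
    "\<And>A a :: bt sqm. a * peval h A = 0 \<Longrightarrow> a * A * peval q A = a"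
    using peval_quasi_inverse by metis
  have TD: "Tm w * D' = D' * Tm w" if "w \<in> H3G" for w
    unfolding D'_def by (simp add: algebra_simps Tm_Esum[OF that] scalar_comm)
  have DQ: "Q * peval m D' = peval m D' * Q" if "Q * Esum \<tau> = Esum \<tau> * Q" for Q
    by (rule peval_commute) (use that in \<open>simp add: D'_def algebra_simps scalar_comm\<close>)
  show ?thesis
  proof (rule that[of q])
    fix t assume t: "t \<in> H3R"
    have c: "commclass t \<in> classes" by (rule classes_intro[OF t])
    let ?P = "Pm \<tau> (commclass t)"
    have "D' * ?P = xL (commclass t) * ?P"
      unfolding D'_def left_diff_distrib Esum_Pm[OF c] by (simp add: distrib_right)
    then have "peval m D' * ?P = peval m (xL (commclass t)) * ?P"
      by (rule peval_intertwine) (rule group_sums_commute(3)[OF TD c])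
    then have P0: "peval m D' * ?P = 0" using assms(1) c unfolding annihilates_def by simp
    obtain Q where Q: "Q * Esum \<tau> = Esum \<tau> * Q"
      "peval m D * Em \<tau> t = peval m (yL t) * Em \<tau> t + Q * ?P" using Esum_intertwine[OF t D_def] by blast
    have "peval m D * Em \<tau> t = Q * ?P" using Q(2) assms(1) t unfolding annihilates_def by simp
    then have "peval h (Esum \<tau>) * Em \<tau> t = Q * (peval m D' * ?P)"
      unfolding hD' mult.assoc by (simp add: mult.assoc[symmetric] DQ[OF Q(1)])
    then show "Esum \<tau> * peval q (Esum \<tau>) * Em \<tau> t = Em \<tau> t" using q(1) unfolding P0 by simp
    have "?P * D' = ?P * xR (commclass t)"
      unfolding D'_def right_diff_distrib Pm_Esum[OF c] by (simp add: distrib_left)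
    then have "?P * peval m D' = ?P * peval m (xR (commclass t))"
      by (rule peval_intertwine_right) (rule group_sums_commute(4)[OF TD c])
    then have P0: "?P * peval m D' = 0" using assms(1) c unfolding annihilates_def by simp
    obtain Q where Q: "Q * Esum \<tau> = Esum \<tau> * Q"
      "Em \<tau> t * peval m D = Em \<tau> t * peval m (yR t) + ?P * Q" using Esum_intertwine_right[OF t D_def] by blast
    have "Em \<tau> t * peval m D = ?P * Q" using Q(2) assms(1) t unfolding annihilates_def by simp
    then have "Em \<tau> t * peval h (Esum \<tau>) = ?P * peval m D' * Q"
      unfolding hD mult.assoc[symmetric] by (simp add: mult.assoc DQ[OF Q(1)])
    then show "Em \<tau> t * Esum \<tau> * peval q (Esum \<tau>) = Em \<tau> t" using q(2) unfolding P0 by simp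
  qed
qed

section \<open>Equivariant projections and complements\<close>

lemma Tm_inv_mult: "w \<in> H3G \<Longrightarrow> Tm w * Tm (matrix_inv w) = 1"
  by (simp add: Tm_mult H3G_inv Tm_one)

lemma matrix_inv_mult: "g \<in> H3G \<Longrightarrow> h \<in> H3G \<Longrightarrow> matrix_inv (g ** h) = matrix_inv h ** matrix_inv g"
proof (rule matrix_inv_unique)
  assume g: "g \<in> H3G" "h \<in> H3G"
  show "g ** h ** (matrix_inv h ** matrix_inv g) = mat 1" "matrix_inv h ** matrix_inv g ** (g ** h) = mat 1"
    by (simp_all add: matrix_mul_assoc[symmetric] H3G_cancel[OF g(1)] H3G_cancel[OF g(2)] H3G_inv[OF g(1)] H3G_inv[OF g(2)])
qed

definition group_average :: "bt sqm \<Rightarrow> bt sqm" where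
  "group_average p = scalar (1 / of_nat (card H3G)) * (\<Sum>g\<in>H3G. Tm g * p * Tm (matrix_inv g))"

lemma group_average_commute:
  assumes h: "h \<in> H3G" shows "Tm h * group_average p = group_average p * Tm h"
proof -
  have bij: "bij_betw (\<lambda>g. h ** g) H3G H3G"
    by (rule bij_betw_byWitness[where f'="\<lambda>g. matrix_inv h ** g"])
      (use h in \<open>auto simp: H3G_cancel H3G_mult H3G_inv\<close>)
  have "Tm h * (\<Sum>g\<in>H3G. Tm g * p * Tm (matrix_inv g)) = (\<Sum>g\<in>H3G. Tm (h ** g) * p * Tm (matrix_inv (h ** g))) * Tm h"
    unfolding sum_distrib_left sum_distrib_right
  proof (rule sum.cong[OF refl])
    fix g assume g: "g \<in> H3G"
    have i: "matrix_inv h \<in> H3G" "matrix_inv g \<in> H3G" using H3G_inv g h by blast+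
    have e: "Tm (h ** g) = Tm h * Tm g" using Tm_mult[OF h g] by simp
    have "Tm (matrix_inv (h ** g)) * Tm h = Tm (matrix_inv g ** matrix_inv h ** h)"
      unfolding matrix_inv_mult[OF h g] by (rule Tm_mult[OF H3G_mult[OF i(2,1)] h])
    also have "matrix_inv g ** matrix_inv h ** h = matrix_inv g"
      using H3G_inv(3)[OF h] by (simp add: matrix_mul_assoc[symmetric])
    finally show "Tm h * (Tm g * p * Tm (matrix_inv g)) = Tm (h ** g) * p * Tm (matrix_inv (h ** g)) * Tm h"
      unfolding e by (simp add: mult.assoc)
  qed
  also have "\<dots> = (\<Sum>g\<in>H3G. Tm g * p * Tm (matrix_inv g)) * Tm h"
    using sum.reindex_bij_betw[OF bij, of "\<lambda>g. Tm g * p * Tm (matrix_inv g)"] by simp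
  finally show ?thesis unfolding group_average_def by (simp add: scalar_left_comm mult.assoc)
qed

locale submodule =
  fixes \<tau> :: complex and U :: "(complex^bt) set"
  assumes add: "u \<in> U \<Longrightarrow> v \<in> U \<Longrightarrow> u + v \<in> U" and smult: "u \<in> U \<Longrightarrow> c *s u \<in> U" and zero: "0 \<in> U"
    and Tm: "g \<in> H3G \<Longrightarrow> u \<in> U \<Longrightarrow> app (Tm g) u \<in> U"
    and Em: "s \<in> H3R \<Longrightarrow> u \<in> U \<Longrightarrow> app (Em \<tau> s) u \<in> U"
begin

lemma sum_closed: "finite J \<Longrightarrow> (\<And>j. j \<in> J \<Longrightarrow> f j \<in> U) \<Longrightarrow> sum f J \<in> U"
  by (induction J rule: finite_induct) (simp_all add: add zero)

lemma Pm_closed: "c \<in> classes \<Longrightarrow> u \<in> U \<Longrightarrow> app (Pm \<tau> c) u \<in> U"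
  unfolding Pm_def app_mult using Em leader(1) partner(1) by simp

lemma peval_closed: "(\<And>u. u \<in> U \<Longrightarrow> app A u \<in> U) \<Longrightarrow> u \<in> U \<Longrightarrow> app (peval q A) u \<in> U"
  by (induction q) (simp_all add: peval_0 peval_pCons app_0 zero app_add app_mult app_scalar add smult)

lemma one_minus_closed: "(\<And>u. u \<in> U \<Longrightarrow> app A u \<in> U) \<Longrightarrow> u \<in> U \<Longrightarrow> app (1 - A) u \<in> U"
proof -
  assume a: "\<And>u. u \<in> U \<Longrightarrow> app A u \<in> U" and u: "u \<in> U"
  have "app (1 - A) u = u + (-1) *s app A u"
    using app_add[of "1 - A" A u] by (simp add: app_1 vec_eq_iff algebra_simps)
  then show ?thesis using add[OF u smult[OF a[OF u], of "-1"]] by simp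
qed

lemma equivariant_projection:
  assumes \<tau>: "\<tau> \<noteq> 0" and m: "annihilates m" "poly m (- \<tau>) \<noteq> 0" "poly m (- (3 * \<tau>)) \<noteq> 0"
  obtains p where "\<And>v. app p v \<in> U" "\<And>u. u \<in> U \<Longrightarrow> app p u = u"
    "\<And>g. g \<in> H3G \<Longrightarrow> Tm g * p = p * Tm g" "\<And>s. s \<in> H3R \<Longrightarrow> Em \<tau> s * p = p * Em \<tau> s"
proof -
  obtain p0 where p0: "\<And>v. app p0 v \<in> U" "\<And>u. u \<in> U \<Longrightarrow> app p0 u = u"
    using projection_exists[of U] add smult zero by metis
  define p1 where "p1 = group_average p0"
  have p1_T: "Tm g * p1 = p1 * Tm g" if "g \<in> H3G" for g
    unfolding p1_def by (rule group_average_commute[OF that])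
  have p1_U: "app p1 v \<in> U" for v
    unfolding p1_def group_average_def app_mult app_scalar app_sum
    by (intro smult sum_closed finite_H3G Tm p0)
  have card0: "card H3G \<noteq> 0" using finite_H3G H3G.one by auto
  have p1_fix: "app p1 u = u" if u: "u \<in> U" for u
  proof -
    have "app (Tm g * p0 * Tm (matrix_inv g)) u = u" if g: "g \<in> H3G" for g
    proof -
      have "app (Tm g * p0 * Tm (matrix_inv g)) u = app (Tm g * Tm (matrix_inv g)) u"
        by (simp add: app_mult p0(2)[OF Tm[OF H3G_inv(1)[OF g] u]])
      then show ?thesis by (simp add: Tm_inv_mult[OF g] app_1)
    qed
    then have "app p1 u = (1 / of_nat (card H3G)) *s (\<Sum>g\<in>H3G. u)"
      unfolding p1_def group_average_def app_mult[of "scalar _"] app_scalar app_sum by simp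
    also have "\<dots> = u" using card0 by (simp add: vec_eq_iff of_nat_index)
    finally show ?thesis .
  qed
  obtain q where q: "\<And>c. c \<in> classes \<Longrightarrow> Psum \<tau> * peval q (Psum \<tau>) * Pm \<tau> c = Pm \<tau> c"
    "\<And>c. c \<in> classes \<Longrightarrow> Pm \<tau> c * Psum \<tau> * peval q (Psum \<tau>) = Pm \<tau> c"
    using Psum_inverse[OF \<tau> m(1,2)] by metis
  let ?B = "peval q (Psum \<tau>)"
  have Psum_U: "app (Psum \<tau>) u \<in> U" if "u \<in> U" for u
    unfolding Psum_def app_sum by (intro sum_closed finite_classes Pm_closed that)
  \<comment> \<open>Here \<kappa> is the square of \<tau>. The exchange rule for distinct classes
    needs only that \<open>p1\<close> commutes with the class swapper.\<close>
  interpret P: averaging classes "Pm \<tau>" "Psum \<tau>" ?B p1 "\<tau> * \<tau>"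
  proof
    show "Psum \<tau> * ?B = ?B * Psum \<tau>" by (rule peval_commute) (rule refl)
    fix c d assume c: "c \<in> classes" "d \<in> classes"
    show "Pm \<tau> c * Pm \<tau> d * p1 * Pm \<tau> d = Pm \<tau> c * p1 * Pm \<tau> c * Pm \<tau> d"
    proof (cases "c = d")
      case True
      then show ?thesis using Pm_square[OF c(1)]
        by (simp add: mult.assoc scalar_left_comm)
    next
      case False
      let ?T = "Tm (class_swap c d)"
      note pp = Pm_Pm[OF c False, of \<tau>] and T = p1_T[OF class_swap_H3G[OF c False]]
      have "Pm \<tau> c * Pm \<tau> d * p1 * Pm \<tau> d = scalar \<tau> * (Pm \<tau> c * (?T * p1) * Pm \<tau> d)"
        unfolding pp(1) unfolding pp(2) by (simp only: mult.assoc)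
      also have "\<dots> = Pm \<tau> c * p1 * (scalar \<tau> * (?T * Pm \<tau> d))"
        unfolding T scalar_left_comm[of "Pm \<tau> c * p1"] by (simp only: mult.assoc)
      also have "\<dots> = Pm \<tau> c * p1 * Pm \<tau> c * Pm \<tau> d" unfolding pp(1)[symmetric] by (simp only: mult.assoc)
      finally show ?thesis .
    qed
  qed (use finite_classes q Pm_square \<tau> in \<open>simp_all add: Psum_def\<close>)
  define p2 where "p2 = P.avg"
  have B_U: "app ?B u \<in> U" if "u \<in> U" for u by (rule peval_closed[OF Psum_U that])
  have p2_U: "app p2 v \<in> U" for v
    unfolding p2_def by (rule P.avg_range) (simp_all add: add smult zero p1_U Pm_closed B_U)
  have p2_fix: "app p2 u = u" if "u \<in> U" for u
    unfolding p2_def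
    by (rule P.avg_fix[OF that p1_fix Pm_closed one_minus_closed]) (simp_all add: app_mult Psum_U B_U)
  have p2_T: "Tm g * p2 = p2 * Tm g" if g: "g \<in> H3G" for g
    unfolding p2_def
    by (rule P.avg_commute[OF Tm_Pm_class[OF g] conj_bij_classes[OF g] p1_T[OF g] peval_commute[OF Tm_Psum[OF g]]])
  have p2_P: "Pm \<tau> c * p2 = p2 * Pm \<tau> c" if "c \<in> classes" for c
    unfolding p2_def by (rule P.avg_commute_a[OF that])
  obtain r where r: "\<And>t. t \<in> H3R \<Longrightarrow> Esum \<tau> * peval r (Esum \<tau>) * Em \<tau> t = Em \<tau> t"
    "\<And>t. t \<in> H3R \<Longrightarrow> Em \<tau> t * Esum \<tau> * peval r (Esum \<tau>) = Em \<tau> t"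
    using Esum_inverse[OF m] by metis
  let ?C = "peval r (Esum \<tau>)"
  have Esum_U: "app (Esum \<tau>) u \<in> U" if "u \<in> U" for u
    unfolding Esum_def app_sum by (intro sum_closed finite_H3R Em that)
  interpret E: averaging H3R "Em \<tau>" "Esum \<tau>" ?C p2 \<tau>
  proof
    show "Esum \<tau> * ?C = ?C * Esum \<tau>" by (rule peval_commute) (rule refl)
    fix s t assume st: "s \<in> H3R" "t \<in> H3R"
    consider "s = t" | "s \<noteq> t" "com s t" | "\<not> com s t" by blast
    then show "Em \<tau> s * Em \<tau> t * p2 * Em \<tau> t = Em \<tau> s * p2 * Em \<tau> s * Em \<tau> t"
    proof cases
      case 1
      then show ?thesis using Em_square[OF st(1), of \<tau>] by (simp add: mult.assoc scalar_left_comm)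
    next
      \<comment> \<open>The point where commutation with class products enters: it brings both sides
        to \<tau> times \<open>Q * p2\<close>.\<close>
      case 2
      define Q where "Q = Pm \<tau> (commclass s)"
      have Q: "Em \<tau> s * Em \<tau> t = Q" "Em \<tau> t * Em \<tau> s = Q"
        using Pm_eq[OF st 2(2,1), of \<tau>] Em_commute[OF st 2(2), of \<tau>] by (simp_all add: Q_def)
      have Qp: "Q * p2 = p2 * Q" unfolding Q_def by (rule p2_P[OF classes_intro[OF st(1)]])
      have Qs: "Em \<tau> s * Q = scalar \<tau> * Q" unfolding Q_def by (rule Em_Pm_in(1)[OF st(1)])
      have "commclass t = commclass s" using commclass_eq_com[OF st(2,1)] com_sym[OF 2(2)] by blast
      then have Qt: "Q * Em \<tau> t = scalar \<tau> * Q" using Em_Pm_in(2)[OF st(2), of \<tau>] by (simp add: Q_def)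
      have "Em \<tau> s * Em \<tau> t * p2 * Em \<tau> t = p2 * (Q * Em \<tau> t)" unfolding Q(1) Qp by (simp only: mult.assoc)
      also have "\<dots> = scalar \<tau> * (Q * p2)" unfolding Qt scalar_left_comm Qp ..
      also have "\<dots> = Em \<tau> s * (Q * p2)" unfolding mult.assoc[symmetric] Qs ..
      also have "\<dots> = Em \<tau> s * p2 * Em \<tau> s * Em \<tau> t" unfolding Qp unfolding Q(1)[symmetric] by (simp only: mult.assoc)
      finally show ?thesis .
    next
      case 3
      let ?T = "Tm (swapper s t)"
      note nc = Em_noncom[OF st 3, of \<tau>] and T = p2_T[OF swapper(3)[OF st 3]]
      have "Em \<tau> s * Em \<tau> t * p2 * Em \<tau> t = Em \<tau> s * (?T * p2) * Em \<tau> t"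
        unfolding nc(2) by (simp only: mult.assoc)
      also have "\<dots> = Em \<tau> s * p2 * (Em \<tau> s * Em \<tau> t)" unfolding T nc(1) by (simp only: mult.assoc)
      finally show ?thesis by (simp only: mult.assoc)
    qed
  qed (use finite_H3R r Em_square \<tau> in \<open>simp_all add: Esum_def\<close>)
  have C_U: "app ?C u \<in> U" if "u \<in> U" for u by (rule peval_closed[OF Esum_U that])
  show ?thesis
  proof (rule that[of E.avg])
    show "app E.avg v \<in> U" for v
      by (rule E.avg_range) (simp_all add: add smult zero p2_U Em C_U)
    show "app E.avg u = u" if "u \<in> U" for u
      by (rule E.avg_fix[OF that p2_fix Em one_minus_closed]) (simp_all add: app_mult Esum_U C_U)
    show "Tm g * E.avg = E.avg * Tm g" if g: "g \<in> H3G" for g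
      by (rule E.avg_commute[OF Tm_Em[OF g] conj_bij[OF g] p2_T[OF g] peval_commute[OF Tm_Esum[OF g]]])
    show "Em \<tau> s * E.avg = E.avg * Em \<tau> s" if "s \<in> H3R" for s by (rule E.avg_commute_a[OF that])
  qed
qed

end

lemma ev_commute:
  assumes "\<And>g. g \<in> H3G \<Longrightarrow> Tm g * p = p * Tm g" "\<And>s. s \<in> H3R \<Longrightarrow> Em \<tau> s * p = p * Em \<tau> s" "a \<in> FA"
  shows "ev (rho \<tau>) a * p = p * ev (rho \<tau>) a"
  using assms(3)
proof (induction a rule: FA_induct)
  case zero then show ?case by (simp add: ev_zero)
next
  case (add c u q)
  have "prod_list (map (rho \<tau>) u) * p = p * prod_list (map (rho \<tau>) u)"
    using add(1)
  proof (induction u)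
    case (Cons g u)
    then have g: "g \<in> Gens" and IH: "prod_list (map (rho \<tau>) u) * p = p * prod_list (map (rho \<tau>) u)" by auto
    have "rho \<tau> g * p = p * rho \<tau> g" using g assms(1,2) by (cases g) (simp_all add: Gens_simps)
    then show ?case using IH by simp (metis mult.assoc)
  qed simp
  then show ?case using add
    by (simp add: ev_add ev_smult ev_word fa_smult_FA fa_word_FA distrib_left distrib_right scalar_left_comm mult.assoc)
qed

text \<open>Through \<open>cyc\<close> a left ideal containing \<open>BI \<tau>\<close> becomes a
  submodule; the kernel of an equivariant projection onto it pulls back to the complementary left
  ideal.\<close>

lemma semisimple_generic:
  assumes \<tau>: "\<tau> \<noteq> 0" and m: "annihilates m" "poly m (- \<tau>) \<noteq> 0" "poly m (- (3 * \<tau>)) \<noteq> 0"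
  shows "semisimple_mod (BI \<tau>)"
  unfolding semisimple_mod_def
proof (intro allI impI)
  fix L assume L: "left_ideal L \<and> BI \<tau> \<subseteq> L"
  then have LFA: "L \<subseteq> FA" and L0: "fa_zero \<in> L" and Ladd: "\<And>p q. p \<in> L \<Longrightarrow> q \<in> L \<Longrightarrow> fa_add p q \<in> L"
    and Lsm: "\<And>c p. p \<in> L \<Longrightarrow> fa_smult c p \<in> L" and Lmult: "\<And>a p. a \<in> FA \<Longrightarrow> p \<in> L \<Longrightarrow> fa_mult a p \<in> L"
    and LB: "BI \<tau> \<subseteq> L"
    unfolding left_ideal_def by blast+
  define U where "U = cyc \<tau> ` L"
  have UI: "p \<in> L \<Longrightarrow> cyc \<tau> p \<in> U" for p by (simp add: U_def)
  interpret submodule \<tau> U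
  proof
    fix u v assume "u \<in> U" "v \<in> U"
    then obtain p q where pq: "p \<in> L" "q \<in> L" "u = cyc \<tau> p" "v = cyc \<tau> q" unfolding U_def by blast
    then have "p \<in> FA" "q \<in> FA" using LFA by blast+
    then show "u + v \<in> U" using UI[OF Ladd[OF pq(1,2)]] cyc_add[of p q \<tau>] pq by simp
  next
    fix u c assume "u \<in> U"
    then obtain p where "p \<in> L" "u = cyc \<tau> p" unfolding U_def by blast
    then show "c *s u \<in> U" using UI[OF Lsm[of p c]] cyc_smult[of \<tau> c p] by simp
  next
    show "0 \<in> U" using UI[OF L0] cyc_zero by simp
  next
    fix g u assume g: "g \<in> H3G" and "u \<in> U"
    then obtain p where "p \<in> L" "u = cyc \<tau> p" unfolding U_def by blast
    then show "app (Tm g) u \<in> U"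
      using UI[OF Lmult[OF Tw_FA[OF g], of p]] cyc_mult[OF Tw_FA[OF g], of p \<tau>] LFA ev_Tw[of \<tau> g] by auto
  next
    fix s u assume s: "s \<in> H3R" and "u \<in> U"
    then obtain p where "p \<in> L" "u = cyc \<tau> p" unfolding U_def by blast
    then show "app (Em \<tau> s) u \<in> U"
      using UI[OF Lmult[OF Es_FA[OF s], of p]] cyc_mult[OF Es_FA[OF s], of p \<tau>] LFA ev_Es[of \<tau> s] by auto
  qed
  obtain \<pi> where \<pi>: "\<And>v. app \<pi> v \<in> U" "\<And>u. u \<in> U \<Longrightarrow> app \<pi> u = u"
    "\<And>g. g \<in> H3G \<Longrightarrow> Tm g * \<pi> = \<pi> * Tm g" "\<And>s. s \<in> H3R \<Longrightarrow> Em \<tau> s * \<pi> = \<pi> * Em \<tau> s"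
    using equivariant_projection[OF \<tau> m] by metis
  define L' where "L' = {p \<in> FA. app \<pi> (cyc \<tau> p) = 0}"
  have app0: "app A 0 = 0" for A :: "bt sqm" using app_vsmult[of A 0 0] by simp
  have "left_ideal L'"
    unfolding left_ideal_def
  proof (intro conjI ballI allI)
    show "L' \<subseteq> FA" by (auto simp: L'_def)
    show "fa_zero \<in> L'" by (simp add: L'_def fa_zero_FA cyc_zero app0)
  next
    fix p q assume "p \<in> L'" "q \<in> L'"
    then show "fa_add p q \<in> L'" by (simp add: L'_def fa_add_FA cyc_add app_vadd)
  next
    fix c p assume "p \<in> L'"
    then show "fa_smult c p \<in> L'" by (simp add: L'_def fa_smult_FA cyc_smult app_vsmult)
  next
    fix a p assume a: "a \<in> FA" and p: "p \<in> L'"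
    have "app \<pi> (cyc \<tau> (fa_mult a p)) = app (\<pi> * ev (rho \<tau>) a) (cyc \<tau> p)"
      using a p by (simp add: L'_def cyc_mult app_mult)
    also have "\<dots> = app (ev (rho \<tau>) a) (app \<pi> (cyc \<tau> p))"
      by (metis ev_commute[OF \<pi>(3,4) a] app_mult)
    finally show "fa_mult a p \<in> L'" using a p by (simp add: L'_def fa_mult_FA app0)
  qed
  moreover have "BI \<tau> \<subseteq> L'"
    using BI_iff app0 by (auto simp: L'_def)
  moreover have "L \<inter> L' = BI \<tau>"
  proof
    show "BI \<tau> \<subseteq> L \<inter> L'" using LB \<open>BI \<tau> \<subseteq> L'\<close> by blast
    show "L \<inter> L' \<subseteq> BI \<tau>"
    proof
      fix p assume p: "p \<in> L \<inter> L'"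
      then have "cyc \<tau> p = 0" using \<pi>(2)[OF UI[of p]] by (simp add: L'_def)
      then show "p \<in> BI \<tau>" using p LFA BI_iff by blast
    qed
  qed
  moreover have "\<exists>a\<in>L. \<exists>b\<in>L'. p = fa_add a b" if p: "p \<in> FA" for p
  proof -
    obtain a where a: "a \<in> L" "app \<pi> (cyc \<tau> p) = cyc \<tau> a" using \<pi>(1)[of "cyc \<tau> p"] unfolding U_def by blast
    have aFA: "a \<in> FA" using a LFA by blast
    have "app \<pi> (cyc \<tau> (fa_sub p a)) = app \<pi> (cyc \<tau> p) + (-1) *s app \<pi> (cyc \<tau> a)"
      using p aFA by (simp only: fa_sub_eq cyc_add cyc_smult fa_smult_FA app_vadd app_vsmult)
    also have "\<dots> = 0" using a(2) \<pi>(2)[OF UI[OF a(1)]] by (simp add: vec_eq_iff)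
    finally have "fa_sub p a \<in> L'" using p aFA by (simp add: L'_def fa_sub_FA)
    moreover have "p = fa_add a (fa_sub p a)" by (simp add: fa_add_def fa_sub_def)
    ultimately show ?thesis using a(1) by blast
  qed
  ultimately show "\<exists>L'. left_ideal L' \<and> BI \<tau> \<subseteq> L' \<and> L \<inter> L' = BI \<tau> \<and> (\<forall>p\<in>FA. \<exists>a\<in>L. \<exists>b\<in>L'. p = fa_add a b)"
    by blast
qed

lemma semisimple_polynomial:
  "\<exists>f :: complex poly. f \<noteq> 0 \<and> [:-1, 1:] ^ 4 * [:4, 1:] dvd f \<and> (\<forall>\<tau>. poly f \<tau> \<noteq> 0 \<longrightarrow> semisimple_mod (BI \<tau>))"
proof -
  obtain m where m: "m \<noteq> 0" "annihilates m" using annihilates_exists by blast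
  \<comment> \<open>The factors exclude \<tau> = 0 and the zeros of m(- \<tau>) and m(- 3 \<tau>),
    the three conditions of \<open>semisimple_generic\<close>. Multiplying in the prescribed divisor
    keeps the implication, since a nonzero product has nonzero factors.\<close>
  define g where "g = [:0, 1:] * (pcompose m [:0, -1:] * pcompose m [:0, -3:])"
  have "pcompose m [:0, -1:] \<noteq> 0" "pcompose m [:0, -3:] \<noteq> 0"
    using pcompose_eq_0[of m "[:0, -1:]"] pcompose_eq_0[of m "[:0, -3:]"] m(1) by auto
  moreover have "[:-1, 1:] ^ 4 \<noteq> (0 :: complex poly)" "[:4, 1:] \<noteq> (0 :: complex poly)" "[:0, 1:] \<noteq> (0 :: complex poly)"
    by simp_all
  ultimately have "[:-1, 1:] ^ 4 * [:4, 1:] * g \<noteq> 0" unfolding g_def mult_eq_0_iff by simp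
  moreover have "semisimple_mod (BI \<tau>)" if "poly ([:-1, 1:] ^ 4 * [:4, 1:] * g) \<tau> \<noteq> 0" for \<tau>
  proof (rule semisimple_generic[OF _ m(2)])
    show "\<tau> \<noteq> 0" "poly m (- \<tau>) \<noteq> 0" "poly m (- (3 * \<tau>)) \<noteq> 0"
      using that by (auto simp: g_def poly_pcompose mult.commute)
  qed
  ultimately show ?thesis by (intro exI[of _ "[:-1, 1:] ^ 4 * [:4, 1:] * g"]) simp
qed

section \<open>The theorem\<close>

lemma finite_LamIdx: "finite LamIdx"
proof -
  have eq: "LamIdx = LT ` H3G \<union> (\<lambda>(s, j). LE s j) ` (H3R \<times> {1..60}) \<union> (\<lambda>(a, b). LP a b) ` ({1..5} \<times> {1..5})"
    unfolding LamIdx_def by auto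
  show ?thesis unfolding eq by (simp add: finite_H3G finite_H3R)
qed

lemma card_LamIdx: "card LamIdx = card H3G + card H3R * 60 + 25"
proof -
  define A where "A = (\<lambda>(s, j). LE s j) ` (H3R \<times> {1..60})"
  define B where "B = (\<lambda>(a, b). LP a b) ` ({1..5} \<times> {1..5})"
  have eq: "LamIdx = (LT ` H3G \<union> A) \<union> B" unfolding LamIdx_def A_def B_def by auto
  have fin: "finite A" "finite B" using finite_H3R by (simp_all add: A_def B_def)
  have "card A = card (H3R \<times> {1..60::nat})" unfolding A_def by (rule card_image) (auto simp: inj_on_def)
  moreover have "card B = card ({1..5::nat} \<times> {1..5::nat})" unfolding B_def by (rule card_image) (auto simp: inj_on_def)
  moreover have "card (LT ` H3G) = card H3G" by (rule card_image) (auto simp: inj_on_def)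
  moreover have "LT ` H3G \<inter> A = {}" "(LT ` H3G \<union> A) \<inter> B = {}" by (auto simp: A_def B_def)
  ultimately show ?thesis unfolding eq
    using fin finite_H3G by (simp add: card_Un_disjoint card_cartesian_product)
qed

lemma mult_reflection_ne: assumes "s \<in> H3R" "w \<in> H3G" shows "w ** s \<noteq> w"
proof
  assume "w ** s = w"
  then have "s = mat 1" using H3G_cancel(2)[OF assms(2), of s] H3G_inv(3)[OF assms(2)] by simp
  then have "com r s" for r by (simp add: com_def)
  then show False using exists_noncom[OF assms(1)] by metis
qed

text \<open>The group order is read off the coset data: sixty representatives, each with two
  elements in its coset because \<open>w ** s\<close> differs from \<open>w\<close>.\<close>

lemma card_H3G_of_cosets:
  fixes ws :: "nat \<Rightarrow> mat3"
  assumes s: "s \<in> H3R" and w: "\<And>j. j \<in> {1..60} \<Longrightarrow> ws j \<in> H3G"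
    and ex: "\<And>w. w \<in> H3G \<Longrightarrow> \<exists>!j. j \<in> {1..60} \<and> (w = ws j \<or> w = ws j ** s)"
  shows "card H3G = 120"
proof -
  define f where "f = (\<lambda>(j, b). if b then ws j else ws j ** s)"
  have G: "f x \<in> H3G" if "x \<in> {1..60} \<times> UNIV" for x
    using that w s H3R_in_H3G H3G_mult unfolding f_def by (auto split: prod.splits)
  have "inj_on f ({1..60} \<times> (UNIV :: bool set))"
  proof (rule inj_onI)
    fix x y assume x: "x \<in> {1..60} \<times> (UNIV :: bool set)" and y: "y \<in> {1..60} \<times> (UNIV :: bool set)" and e: "f x = f y"
    obtain i b j c where ij: "x = (i, b)" "y = (j, c)" by (metis surj_pair)
    have "i \<in> {1..60}" "f x = ws i \<or> f x = ws i ** s" using x ij by (auto simp: f_def)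
    moreover have "j \<in> {1..60}" "f y = ws j \<or> f y = ws j ** s" using y ij by (auto simp: f_def)
    ultimately have "i = j" using ex[OF G[OF x]] e by metis
    moreover have "b = c"
      using e ij \<open>i = j\<close> mult_reflection_ne[OF s w[of i]] x by (auto simp: f_def split: if_splits)
    ultimately show "x = y" using ij by simp
  qed
  moreover have "f ` ({1..60} \<times> (UNIV :: bool set)) = H3G"
  proof
    show "f ` ({1..60} \<times> UNIV) \<subseteq> H3G" using G by blast
    show "H3G \<subseteq> f ` ({1..60} \<times> UNIV)"
    proof
      fix v assume "v \<in> H3G"
      then obtain j where j: "j \<in> {1..60}" "v = ws j \<or> v = ws j ** s" using ex by blast
      then have "v = f (j, v = ws j)" by (auto simp: f_def)
      then show "v \<in> f ` ({1..60} \<times> UNIV)" using j(1) by blast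
    qed
  qed
  ultimately have "card H3G = card ({1..60::nat} \<times> (UNIV :: bool set))" by (metis card_image)
  then show ?thesis by (simp add: card_cartesian_product)
qed

lemma card_H3R_of_classes: assumes "card classes = 5" shows "card H3R = 15"
proof -
  have "H3R = \<Union> classes" using class_subset commclass_self unfolding classes_def by blast
  moreover have "card (\<Union> classes) = (\<Sum>c\<in>classes. card c)"
  proof (rule card_Union_disjoint)
    show "pairwise disjnt classes" unfolding pairwise_def disjnt_def using in_class_com by blast
    show "finite c" if "c \<in> classes" for c using finite_subset[OF class_subset[OF that] finite_H3R] .
  qed
  ultimately show ?thesis using assms by (simp add: card_class)
qed

lemma stab_image: "g \<in> stab A \<Longrightarrow> w \<in> H3G \<Longrightarrow> conj (w ** g) ` A = conj w ` A"
proof -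
  assume g: "g \<in> stab A" "w \<in> H3G"
  then have "g \<in> H3G" "conj g ` A = A" unfolding stab_def by blast+
  then show ?thesis using conj_simps(1)[OF g(2)] by (metis (no_types, lifting) image_cong image_image)
qed

theorem theorem7p1:
  fixes ws :: "mat3 \<Rightarrow> nat \<Rightarrow> mat3"
    and Rc :: "nat \<Rightarrow> mat3 set"
    and ia ja ka :: "nat \<Rightarrow> mat3"
    and wa :: "nat \<Rightarrow> nat \<Rightarrow> mat3"
  assumes ws_reps: "\<forall>s\<in>H3R. (\<forall>j\<in>{1..60}. ws s j \<in> H3G) \<and>
             (\<forall>w\<in>H3G. \<exists>!j. j \<in> {1..60} \<and> (w = ws s j \<or> w = ws s j ** s))"
    and Rc_classes: "inj_on Rc {1..5}" "\<forall>\<alpha>\<in>{1..5}. \<exists>s\<in>H3R. Rc \<alpha> = commclass s"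
        "\<forall>s\<in>H3R. commclass s \<in> Rc ` {1..5}"
    and Rc_labels: "\<forall>\<alpha>\<in>{1..5}. Rc \<alpha> = {ia \<alpha>, ja \<alpha>, ka \<alpha>} \<and>
             ia \<alpha> \<noteq> ja \<alpha> \<and> ia \<alpha> \<noteq> ka \<alpha> \<and> ja \<alpha> \<noteq> ka \<alpha>"
    and wa_reps: "\<forall>\<alpha>\<in>{1..5}. (\<forall>\<beta>\<in>{1..5}. wa \<alpha> \<beta> \<in> H3G) \<and>
             (\<forall>w\<in>H3G. \<exists>!\<beta>. \<beta> \<in> {1..5} \<and> (\<exists>g\<in>stab (Rc \<alpha>). w = wa \<alpha> \<beta> ** g))"
  shows "(\<forall>\<tau>. has_dim_mod (BI \<tau>) 1045 \<and> basis_mod (BI \<tau>) (Lam ws ia ja wa) LamIdx)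
       \<and> (\<exists>f :: complex poly. f \<noteq> 0 \<and> [:-1, 1:] ^ 4 * [:4, 1:] dvd f \<and>
            (\<forall>\<tau>. poly f \<tau> \<noteq> 0 \<longrightarrow> semisimple_mod (BI \<tau>)))"
proof -
  have wsG: "ws s j \<in> H3G" if "s \<in> H3R" "j \<in> {1..60}" for s j using ws_reps that by blast
  have wsE: "\<exists>!j. j \<in> {1..60} \<and> (w = ws s j \<or> w = ws s j ** s)" if "s \<in> H3R" "w \<in> H3G" for s w
    using ws_reps that by blast
  have waG: "wa \<alpha> \<beta> \<in> H3G" if "\<alpha> \<in> {1..5}" "\<beta> \<in> {1..5}" for \<alpha> \<beta> using wa_reps that by blast
  have waE: "\<exists>!\<beta>. \<beta> \<in> {1..5} \<and> (\<exists>g\<in>stab (Rc \<alpha>). w = wa \<alpha> \<beta> ** g)" if "\<alpha> \<in> {1..5}" "w \<in> H3G" for \<alpha> w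
    using wa_reps that by blast
  have Rc: "ia \<alpha> \<in> H3R" "ja \<alpha> \<in> H3R" "com (ia \<alpha>) (ja \<alpha>)" "ia \<alpha> \<noteq> ja \<alpha>" "commclass (ia \<alpha>) = Rc \<alpha>"
    if a: "\<alpha> \<in> {1..5}" for \<alpha>
  proof -
    obtain s where s: "s \<in> H3R" "Rc \<alpha> = commclass s" using Rc_classes(2) a by blast
    have "ia \<alpha> \<in> Rc \<alpha>" "ja \<alpha> \<in> Rc \<alpha>" "ia \<alpha> \<noteq> ja \<alpha>" using Rc_labels a by auto
    moreover have "Rc \<alpha> \<in> classes" using s classes_intro by simp
    ultimately have "ia \<alpha> \<in> H3R \<and> commclass (ia \<alpha>) = Rc \<alpha>" "ja \<alpha> \<in> H3R \<and> commclass (ja \<alpha>) = Rc \<alpha>"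
      "ia \<alpha> \<noteq> ja \<alpha>" using in_class_com by blast+
    then show "ia \<alpha> \<in> H3R" "ja \<alpha> \<in> H3R" "com (ia \<alpha>) (ja \<alpha>)" "ia \<alpha> \<noteq> ja \<alpha>" "commclass (ia \<alpha>) = Rc \<alpha>"
      using commclass_eq_com[of "ia \<alpha>" "ja \<alpha>"] by simp_all
  qed
  have classes: "classes = Rc ` {1..5}"
    using Rc_classes(2,3) unfolding classes_def by blast
  then have "card classes = 5" using card_image[OF Rc_classes(1)] by simp
  then have cardR: "card H3R = 15" by (rule card_H3R_of_classes)
  then obtain s0 where s0: "s0 \<in> H3R" by fastforce
  have cardG: "card H3G = 120" by (rule card_H3G_of_cosets[OF s0 wsG[OF s0] wsE[OF s0]])
  \<comment> \<open>\<open>\<eta>\<close> gives the module basis element and \<open>u\<close> the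
    normal word attached to an index; once \<open>\<eta>\<close> is bijective,
    \<open>basis_mod_represents\<close> yields the basis.\<close>
  define \<eta> where "\<eta> = (\<lambda>x. case x of LT w \<Rightarrow> BT w | LE s j \<Rightarrow> BE {ws s j, ws s j ** s} s
      | LP \<alpha> \<beta> \<Rightarrow> BP (conj (wa \<alpha> \<beta>) ` Rc \<alpha>) (Rc \<alpha>))"
  define u where "u = (\<lambda>x. case x of LT w \<Rightarrow> [GT w] | LE s j \<Rightarrow> [GT (ws s j), GE s]
      | LP \<alpha> \<beta> \<Rightarrow> [GT (wa \<alpha> \<beta>), GE (ia \<alpha>), GE (ja \<alpha>)])"
  have idx: "(\<exists>w\<in>H3G. x = LT w) \<or> (\<exists>s\<in>H3R. \<exists>j\<in>{1..60}. x = LE s j) \<or> (\<exists>\<alpha>\<in>{1..5}. \<exists>\<beta>\<in>{1..5}. x = LP \<alpha> \<beta>)"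
    if "x \<in> LamIdx" for x using that unfolding LamIdx_def by blast
  have reps: "Lam ws ia ja wa x = fa_word (u x) \<and> represents (u x) (\<eta> x)" if x: "x \<in> LamIdx" for x
    using idx[OF x]
  proof (elim disjE bexE)
    fix w assume "w \<in> H3G" "x = LT w"
    then show ?thesis by (simp add: u_def \<eta>_def represents.T)
  next
    fix s j assume "s \<in> H3R" "j \<in> {1..60}" "x = LE s j"
    then show ?thesis using represents.E[OF wsG] by (simp add: u_def \<eta>_def)
  next
    fix \<alpha> \<beta> assume ab: "\<alpha> \<in> {1..5}" "\<beta> \<in> {1..5}" "x = LP \<alpha> \<beta>"
    have "represents [GT (wa \<alpha> \<beta>), GE (ia \<alpha>), GE (ja \<alpha>)] (BP (commclass (conj (wa \<alpha> \<beta>) (ia \<alpha>))) (commclass (ia \<alpha>)))"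
      by (rule represents.P[OF waG[OF ab(1,2)] Rc(1-4)[OF ab(1)]])
    then show ?thesis
      using conj_commclass[OF waG[OF ab(1,2)] Rc(1)[OF ab(1)]] Rc(5)[OF ab(1)] ab(3)
      by (simp add: u_def \<eta>_def)
  qed
  have "inj_on \<eta> LamIdx"
  proof (rule inj_onI)
    fix x y assume xy: "x \<in> LamIdx" "y \<in> LamIdx" "\<eta> x = \<eta> y"
    show "x = y"
      using idx[OF xy(1)]
    proof (elim disjE bexE)
      fix w assume "w \<in> H3G" "x = LT w"
      then show ?thesis using xy(3) by (cases y) (simp_all add: \<eta>_def)
    next
      fix s j assume x: "s \<in> H3R" "j \<in> {1..60}" "x = LE s j"
      then obtain j' where y: "y = LE s j'" "{ws s j, ws s j ** s} = {ws s j', ws s j' ** s}"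
        using xy(3) by (cases y) (auto simp: \<eta>_def)
      then have j': "j' \<in> {1..60}" using idx[OF xy(2)] by auto
      \<comment> \<open>Equal cosets put the representative with index \<open>j\<close> into the
        coset with index \<open>j'\<close>, against uniqueness unless the indices agree.\<close>
      have "ws s j = ws s j' \<or> ws s j = ws s j' ** s" using y(2) by blast
      then have "j = j'" using wsE[OF x(1) wsG[OF x(1,2)]] x(2) j' by blast
      then show ?thesis using x y by simp
    next
      fix \<alpha> \<beta> assume x: "\<alpha> \<in> {1..5}" "\<beta> \<in> {1..5}" "x = LP \<alpha> \<beta>"
      then obtain \<alpha>' \<beta>' where y: "y = LP \<alpha>' \<beta>'" "conj (wa \<alpha> \<beta>) ` Rc \<alpha> = conj (wa \<alpha>' \<beta>') ` Rc \<alpha>'" "Rc \<alpha> = Rc \<alpha>'"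
        using xy(3) by (cases y) (auto simp: \<eta>_def)
      then have y': "\<alpha>' \<in> {1..5}" "\<beta>' \<in> {1..5}" using idx[OF xy(2)] by auto
      have aa: "\<alpha> = \<alpha>'" using inj_onD[OF Rc_classes(1) y(3) x(1) y'(1)] .
      let ?v = "wa \<alpha> \<beta>" and ?w = "wa \<alpha> \<beta>'"
      have G: "?v \<in> H3G" "?w \<in> H3G" using waG x y' by blast+
      have i: "matrix_inv ?w \<in> H3G" using H3G_inv(1)[OF G(2)] .
      \<comment> \<open>Equal image classes place the two representatives in the same left coset of
        the stabilizer.\<close>
      define g where "g = matrix_inv ?w ** ?v"
      have g: "g \<in> H3G" "?v = ?w ** g" using H3G_mult[OF i G(1)] H3G_cancel(1)[OF G(2), of ?v, symmetric] unfolding g_def by blast+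
      have "conj g ` Rc \<alpha> = conj (matrix_inv ?w) ` (conj ?v ` Rc \<alpha>)"
        unfolding image_image using conj_simps(1)[OF i G(1)] by (simp add: g_def)
      also have "\<dots> = conj (matrix_inv ?w) ` (conj ?w ` Rc \<alpha>)" using y(2) aa by simp
      also have "\<dots> = Rc \<alpha>" unfolding image_image using conj_inv(2)[OF G(2)] by simp
      finally have "g \<in> stab (Rc \<alpha>)" using g(1) by (simp add: stab_def)
      moreover have "mat 1 \<in> stab (Rc \<alpha>)" using H3G.one conj_one by (simp add: stab_def)
      moreover have "?v = ?v ** mat 1" by simp
      ultimately have "\<beta> = \<beta>'" using waE[OF x(1) G(1)] x(2) y'(2) g(2) by blast
      then show ?thesis using x(3) y(1) aa by simp
    qed
  qed
  moreover have "\<eta> ` LamIdx = bases"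
  proof
    show "\<eta> ` LamIdx \<subseteq> bases" using reps represents_bases by blast
    show "bases \<subseteq> \<eta> ` LamIdx"
    proof
      fix z assume "z \<in> bases"
      then show "z \<in> \<eta> ` LamIdx"
      proof (cases rule: bases_cases)
        case (T w)
        then have "z = \<eta> (LT w)" "LT w \<in> LamIdx" by (auto simp: \<eta>_def LamIdx_def)
        then show ?thesis by (rule image_eqI)
      next
        case (E w t)
        obtain j where j: "j \<in> {1..60}" "w = ws t j \<or> w = ws t j ** t" using wsE[OF E(2,1)] by blast
        have "ws t j ** t ** t = ws t j" using H3R_involution[OF E(2)] by (simp add: matrix_mul_assoc[symmetric])
        then have "{w, w ** t} = {ws t j, ws t j ** t}" using j(2) by auto
        then have "z = \<eta> (LE t j)" using E(3) by (simp add: \<eta>_def)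
        moreover have "LE t j \<in> LamIdx" using E(2) j(1) by (auto simp: LamIdx_def)
        ultimately show ?thesis by (rule image_eqI)
      next
        case (P b a)
        obtain \<alpha> where \<alpha>: "\<alpha> \<in> {1..5}" "commclass a = Rc \<alpha>" using Rc_classes(3) P(2) by blast
        \<comment> \<open>A basis element allows any pair of classes; transitivity supplies a group
          element joining them, which is then replaced by its coset representative.\<close>
        obtain w where w: "w \<in> H3G" "commclass (conj w a) = commclass b" using class_transitive[OF P(1,2)] by blast
        obtain \<beta> g where b: "\<beta> \<in> {1..5}" "g \<in> stab (Rc \<alpha>)" "w = wa \<alpha> \<beta> ** g" using waE[OF \<alpha>(1) w(1)] by blast
        have "conj (wa \<alpha> \<beta>) ` Rc \<alpha> = conj w ` Rc \<alpha>" using stab_image[OF b(2) waG[OF \<alpha>(1) b(1)]] b(3) by simp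
        also have "\<dots> = commclass b" using conj_commclass[OF w(1) P(2)] w(2) \<alpha>(2) by simp
        finally have "z = \<eta> (LP \<alpha> \<beta>)" using P(3) \<alpha>(2) by (simp add: \<eta>_def)
        moreover have "LP \<alpha> \<beta> \<in> LamIdx" using \<alpha>(1) b(1) by (simp add: LamIdx_def)
        ultimately show ?thesis by (rule image_eqI)
      qed
    qed
  qed
  ultimately have bij: "bij_betw \<eta> LamIdx bases" by (simp add: bij_betw_def)
  have basis: "basis_mod (BI \<tau>) (Lam ws ia ja wa) LamIdx" for \<tau>
    by (rule basis_mod_represents[OF finite_LamIdx bij reps])
  have "card LamIdx = 1045" using card_LamIdx cardG cardR by simp
  then have "has_dim_mod (BI \<tau>) 1045" for \<tau> using has_dim_modI[OF basis, of \<tau>] by simp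
  then show ?thesis using basis semisimple_polynomial by blast
qed

end
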